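(* Let $d\ge2$, $M>0$ and $K(x)=-\log|x|$, so $\nabla K(x)=-x/|x|^2$. Suppose that $U_1,U_2\in\bigcap_{1\le p<\infty}L^p(\mathbb{R}^d)$ are nonnegative functions with $\int_{\mathbb{R}^d}U_i\,d\xi=M$ and $\int_{\mathbb{R}^d}|\xi|^2U_i(\xi)\,d\xi<\infty$ ($i=1,2$) which are both weak solutions of $$\Delta U+\tfrac12\nabla\cdot(\xi U)+\nabla\cdot\bigl(U(\nabla K*U)\bigr)=0\qquad\text{in }\mathbb{R}^d.$$ Then $U_1=U_2$ a.e. in $\mathbb{R}^d$. In particular, this equation admits at most one solution in this class.
   Context: "Weak solution" means in the sense of distributions: for all $\varphi\in C_c^\infty(\mathbb{R}^d)$, $\int U\Delta\varphi\,d\xi-\frac12\int U\,\xi\cdot\nabla\varphi\,d\xi-\int U(\nabla K*U)\cdot\nabla\varphi\,d\xi=0$. *)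

theory Defs
  imports "HOL-Analysis.Analysis"
begin

text \<open>Throughout, R^d is a type of class \<open>euclidean_space\<close> with \<open>d = DIM('a)\<close>.\<close>

subsection \<open>Differential operators and test functions\<close>

definition gradient :: "('a::euclidean_space \<Rightarrow> real) \<Rightarrow> 'a \<Rightarrow> 'a" where
  "gradient f x = (\<Sum>b\<in>Basis. frechet_derivative f (at x) b *\<^sub>R b)"

definition laplacian :: "('a::euclidean_space \<Rightarrow> real) \<Rightarrow> 'a \<Rightarrow> real" where
  "laplacian f x =
     (\<Sum>b\<in>Basis. frechet_derivative (\<lambda>y. frechet_derivative f (at y) b) (at x) b)"

primrec C_k :: "nat \<Rightarrow> ('a::euclidean_space \<Rightarrow> real) \<Rightarrow> bool" where
  "C_k 0 f \<longleftrightarrow> continuous_on UNIV f"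
| "C_k (Suc k) f \<longleftrightarrow>
     (\<forall>x. f differentiable (at x)) \<and> (\<forall>v. C_k k (\<lambda>x. frechet_derivative f (at x) v))"

definition test_function :: "('a::euclidean_space \<Rightarrow> real) \<Rightarrow> bool" where
  "test_function \<phi> \<longleftrightarrow> (\<forall>k. C_k k \<phi>) \<and> compact (closure {x. \<phi> x \<noteq> 0})"

subsection \<open>The equation\<close>

definition in_Lp :: "real \<Rightarrow> ('a::euclidean_space \<Rightarrow> real) \<Rightarrow> bool" where
  "in_Lp p U \<longleftrightarrow>
     U \<in> borel_measurable lebesgue \<and> integrable lebesgue (\<lambda>x. \<bar>U x\<bar> powr p)"

definition log_kernel :: "'a::euclidean_space \<Rightarrow> real" where
  "log_kernel x = - ln (norm x)"

text \<open>The value of \<open>gradient log_kernel\<close> at the origin is unspecified; it only enters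
  through integrals, where a single point does not matter.\<close>

lemma gradient_log_kernel:
  fixes x :: "'a::euclidean_space"
  assumes "x \<noteq> 0"
  shows "gradient log_kernel x = - (x /\<^sub>R (norm x)\<^sup>2)"
proof -
  have "(norm has_derivative (\<lambda>h. h \<bullet> sgn x)) (at x)"
    using GDERIV_norm [OF assms] by (simp add: gderiv_def)
  then have "((\<lambda>y. - ln (norm y)) has_derivative (\<lambda>h. - (1 / norm x * (h \<bullet> sgn x)))) (at x)"
    using assms by (auto intro!: derivative_eq_intros simp: divide_inverse)
  then have "(log_kernel has_derivative (\<lambda>h. - ((x \<bullet> h) / (norm x)\<^sup>2))) (at x)"
    by (simp add: log_kernel_def [abs_def] sgn_div_norm divide_inverse power2_eq_square
        inner_commute mult.commute mult.left_commute)
  then have "frechet_derivative log_kernel (at x) = (\<lambda>h. - ((x \<bullet> h) / (norm x)\<^sup>2))"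
    by (metis frechet_derivative_at)
  then have "gradient log_kernel x = (\<Sum>b\<in>Basis. - (inverse ((norm x)\<^sup>2) *\<^sub>R ((x \<bullet> b) *\<^sub>R b)))"
    by (simp add: gradient_def divide_inverse mult.commute)
  also have "\<dots> = - (inverse ((norm x)\<^sup>2) *\<^sub>R (\<Sum>b\<in>Basis. (x \<bullet> b) *\<^sub>R b))"
    by (simp only: sum_negf scaleR_sum_right)
  finally show ?thesis
    by (simp add: euclidean_representation)
qed

definition grad_conv ::
  "('a::euclidean_space \<Rightarrow> real) \<Rightarrow> ('a \<Rightarrow> real) \<Rightarrow> 'a \<Rightarrow> 'a" where
  "grad_conv K U \<xi> = (\<integral>\<eta>. U \<eta> *\<^sub>R gradient K (\<xi> - \<eta>) \<partial>lebesgue)"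

text \<open>The distributional form of
  \<open>\<Delta>U + 1/2 div (\<xi> U) + div (U (grad K * U)) = 0\<close>. For \<open>U\<close> in all \<open>L^p\<close>, \<open>1 \<le> p < \<infinity>\<close>, and
  \<open>K = log_kernel\<close> in dimension at least 2, all these integrals converge absolutely, so the
  convention that the integral of a nonintegrable function is 0 plays no role.\<close>

definition weak_solution ::
  "('a::euclidean_space \<Rightarrow> real) \<Rightarrow> ('a \<Rightarrow> real) \<Rightarrow> bool" where
  "weak_solution K U \<longleftrightarrow>
     (\<forall>\<phi>. test_function \<phi> \<longrightarrow>
        (\<integral>\<xi>. U \<xi> * laplacian \<phi> \<xi> \<partial>lebesgue)
        - 1 / 2 * (\<integral>\<xi>. U \<xi> * (\<xi> \<bullet> gradient \<phi> \<xi>) \<partial>lebesgue)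
        - (\<integral>\<xi>. U \<xi> * (grad_conv K U \<xi> \<bullet> gradient \<phi> \<xi>) \<partial>lebesgue) = 0)"

text \<open>Nonnegativity is required only almost everywhere, as is usual for elements of \<open>L^p\<close>.\<close>

definition admissible :: "real \<Rightarrow> ('a::euclidean_space \<Rightarrow> real) \<Rightarrow> bool" where
  "admissible M U \<longleftrightarrow>
     (\<forall>p\<ge>1. in_Lp p U) \<and>
     (AE \<xi> in lebesgue. U \<xi> \<ge> 0) \<and>
     (\<integral>\<xi>. U \<xi> \<partial>lebesgue) = M \<and>
     integrable lebesgue (\<lambda>\<xi>. (norm \<xi>)\<^sup>2 * U \<xi>)"

end

theory Submission
  imports Defs "HOL-Probability.Distributions"
begin

text \<open>
  Write \<open>V = |\<xi>|\<^sup>2/4 + K * U\<close> and \<open>E = exp (- V)\<close>, so that the equation reads \<open>div (grad U + U grad V) = 0\<close>.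
  Uniqueness has two independent parts.

  A solution is a Gibbs density, \<open>U = k E\<close> with a constant \<open>k\<close>. The quotient \<open>f = U / E\<close> solves
  \<open>div (E grad f) = 0\<close>. Nothing is known about the growth of \<open>f\<close>, so instead of \<open>f\<close> itself the bounded
  decreasing function \<open>P = 1 / (1 + f) = E / (E + U)\<close> is tested, with a cutoff \<open>\<eta>\<close>. This gives the
  Caccioppoli inequality
  \<open>\<integral> E \<eta>\<^sup>2 |grad P|\<^sup>2 \<le> 10 \<integral> E |grad \<eta>|\<^sup>2\<close>. Since \<open>E\<close> has Gaussian tails, the right-hand side vanishes as the
  cutoff exhausts the space; hence \<open>P\<close>, and with it \<open>f\<close>, is constant. To make this rigorous, \<open>U\<close> is
  mollified to \<open>w\<close> (the mollifier, centred at any point, is an admissible test function, so the mollified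
  flux is divergence free in the classical sense), and \<open>K\<close> is replaced by \<open>- ln (|z|\<^sup>2 + \<delta>) / 2\<close>, which makes
  \<open>E\<close> continuously differentiable. The drift \<open>grad V\<close> is approximated uniformly on bounded sets, with an error
  \<open>\<omega>\<close>; the resulting error in the flux is at most \<open>\<omega> w\<close>, is absorbed by the same inequality
  (\<open>energy_estimate\<close>), and costs only \<open>4 \<omega>\<^sup>2 \<integral> E \<eta>\<^sup>2\<close>. The limit (\<open>approximating_ratio\<close>) then rests on the convergence
  of \<open>w\<close> to \<open>U\<close> in the mean.

  Two Gibbs densities of equal mass agree. With \<open>\<rho> = U1 - U2\<close> one has, almost everywhere,
  \<open>ln U1 - ln U2 = c - K * \<rho>\<close>. Multiplication by \<open>\<rho>\<close> and integration remove \<open>c\<close>, as \<open>\<integral> \<rho> = 0\<close>, and yield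
  \<open>\<integral> \<rho> (ln U1 - ln U2) = - \<integral>\<integral> K(x - y) \<rho>(x) \<rho>(y)\<close>. The left-hand side is nonnegative because the logarithm
  increases. The right-hand side is nonpositive because the kernel \<open>K = - ln |x|\<close> is positive definite on neutral
  charges (\<open>log_energy_nonpos\<close>): by Frullani's integral it is, up to constants in \<open>x\<close>, a mixture of
  Gaussians, and a Gaussian is the convolution of a Gaussian with itself. So both sides vanish and \<open>U1 = U2\<close>.
\<close>

section \<open>Smooth bump functions and mollifiers\<close>

lemma C_k_Suc_imp: "C_k (Suc k) f \<Longrightarrow> C_k k f"
proof (induction k arbitrary: f)
  case 0
  then show ?case
    by (auto simp: continuous_on_eq_continuous_at intro: differentiable_imp_continuous_within)
next
  case (Suc k)
  then show ?case by (simp del: C_k.simps add: C_k.simps(2)[of "Suc k"] C_k.simps(2)[of k])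
qed

lemma C_k_SucI:
  assumes "\<And>x. (f has_derivative D x) (at x)" and "\<And>v. C_k k (\<lambda>x. D x v)"
  shows "C_k (Suc k) f"
proof -
  have "frechet_derivative f (at x) = D x" for x
    using assms(1) by (metis frechet_derivative_at)
  then show ?thesis
    using assms by (auto simp: differentiable_def)
qed

lemma C_k_SucD:
  assumes "C_k (Suc k) f"
  shows "(f has_derivative frechet_derivative f (at x)) (at x)"
    and "C_k k (\<lambda>x. frechet_derivative f (at x) v)"
  using assms by (auto simp: frechet_derivative_works)

lemma C_k_const: "C_k k (\<lambda>_. c)"
proof (induction k arbitrary: c)
  case (Suc k)
  show ?case by (rule C_k_SucI[OF has_derivative_const]) (rule Suc)
qed simp

lemma C_k_add: "C_k k f \<Longrightarrow> C_k k g \<Longrightarrow> C_k k (\<lambda>x. f x + g x)"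
proof (induction k arbitrary: f g)
  case 0
  then show ?case by (auto intro: continuous_intros)
next
  case (Suc k)
  show ?case
    by (rule C_k_SucI[OF has_derivative_add[OF C_k_SucD(1)[OF Suc.prems(1)] C_k_SucD(1)[OF Suc.prems(2)]]])
      (intro Suc.IH C_k_SucD(2) Suc.prems)
qed

lemma C_k_mult: "C_k k f \<Longrightarrow> C_k k g \<Longrightarrow> C_k k (\<lambda>x. f x * g x)"
proof (induction k arbitrary: f g)
  case 0
  then show ?case by (auto intro: continuous_intros)
next
  case (Suc k)
  show ?case
    by (rule C_k_SucI[OF has_derivative_mult[OF C_k_SucD(1)[OF Suc.prems(1)] C_k_SucD(1)[OF Suc.prems(2)]]])
      (intro C_k_add Suc.IH C_k_SucD(2) Suc.prems C_k_Suc_imp)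
qed

lemma C_k_affine: "C_k k (\<lambda>y::'a::euclidean_space. c + v \<bullet> y)"
proof (cases k)
  case (Suc j)
  have "((\<lambda>y. c + v \<bullet> y) has_derivative (\<lambda>h. v \<bullet> h)) (at x)" for x :: 'a
    by (auto intro!: derivative_eq_intros)
  then show ?thesis unfolding Suc by (rule C_k_SucI) (rule C_k_const)
qed (auto intro!: continuous_intros)

lemma C_k_dist_square: "C_k k (\<lambda>y::'a::euclidean_space. c - (x - y) \<bullet> (x - y))"
proof (cases k)
  case (Suc j)
  have "((\<lambda>y. c - (x - y) \<bullet> (x - y)) has_derivative (\<lambda>h. 2 * (x \<bullet> h) + (- 2 *\<^sub>R h) \<bullet> y)) (at y)" for y :: 'a
    by (auto intro!: derivative_eq_intros simp: inner_diff_left inner_diff_right inner_commute algebra_simps)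
  then show ?thesis unfolding Suc by (rule C_k_SucI) (rule C_k_affine)
qed (auto intro!: continuous_intros)

text \<open>The family \<open>p(1/s) exp(-1/s)\<close>, extended by 0 to \<open>s \<le> 0\<close>, is closed under differentiation. Taking
  all polynomials \<open>p\<close> at once therefore turns smoothness into a one-line induction.\<close>

definition bump :: "real poly \<Rightarrow> real \<Rightarrow> real" where
  "bump p s = (if s > 0 then poly p (1 / s) * exp (- (1 / s)) else 0)"

lemma poly_times_exp_tendsto_0:
  "((\<lambda>y::real. poly p y * exp (- y)) \<longlongrightarrow> 0) at_top"
proof -
  have "((\<lambda>y::real. \<Sum>i\<le>degree p. coeff p i * (y ^ i / exp y)) \<longlongrightarrow> (\<Sum>i\<le>degree p. coeff p i * 0)) at_top"
    by (intro tendsto_intros tendsto_power_div_exp_0)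
  then show ?thesis
    by (simp add: poly_altdef exp_minus divide_inverse sum_distrib_left sum_distrib_right mult_ac)
qed

lemma bump_has_derivative:
  "(bump p has_real_derivative bump ([:0, 0, 1:] * (p - pderiv p)) s) (at s)"
proof -
  consider "s > 0" | "s < 0" | "s = 0" by linarith
  then show ?thesis
  proof cases
    case 1
    have "((\<lambda>s. poly p (1 / s) * exp (- (1 / s))) has_real_derivative
        bump ([:0, 0, 1:] * (p - pderiv p)) s) (at s)"
      using 1 by (auto intro!: derivative_eq_intros poly_DERIV[THEN DERIV_chain2]
          simp: bump_def field_simps power2_eq_square)
    moreover have "\<forall>\<^sub>F t in nhds s. bump p t = poly p (1 / t) * exp (- (1 / t))"
      using eventually_nhds_in_open[of "{0<..}" s] 1 by (auto simp: bump_def elim!: eventually_mono)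
    ultimately show ?thesis by (subst DERIV_cong_ev[OF refl _ refl])
  next
    case 2
    have "\<forall>\<^sub>F t in nhds s. bump p t = 0"
      using eventually_nhds_in_open[of "{..<0}" s] 2 by (auto simp: bump_def elim!: eventually_mono)
    then show ?thesis using 2 by (subst DERIV_cong_ev[OF refl _ refl]) (auto simp: bump_def)
  next
    case 3
    have "((\<lambda>h. poly (pCons 0 p) (inverse h) * exp (- inverse h)) \<longlongrightarrow> 0) (at_right 0)"
      using filterlim_compose[OF poly_times_exp_tendsto_0 filterlim_inverse_at_top_right] .
    then have "((\<lambda>h. bump p h / h) \<longlongrightarrow> 0) (at_right 0)"
      by (rule Lim_transform_eventually)
        (auto simp: eventually_at_right_less bump_def field_simps intro!: eventually_at_rightI[of 0 1])
    moreover have "((\<lambda>h. bump p h / h) \<longlongrightarrow> 0) (at_left 0)"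
      by (rule Lim_transform_eventually[OF tendsto_const])
        (auto simp: bump_def intro!: eventually_at_leftI[of "-1" 0])
    ultimately have "((\<lambda>h. bump p h / h) \<longlongrightarrow> 0) (at 0)"
      by (simp add: filterlim_at_split)
    then show ?thesis using 3 by (simp add: DERIV_def bump_def)
  qed
qed

lemma continuous_on_bump [continuous_intros]:
  "continuous_on S f \<Longrightarrow> continuous_on S (\<lambda>x. bump p (f x))"
  by (rule continuous_on_compose2[of UNIV "bump p"])
    (auto intro!: continuous_at_imp_continuous_on DERIV_isCont[OF bump_has_derivative])

text \<open>The chain rule produces a member of the same family times a derivative of \<open>q\<close>, so the
  induction on \<open>k\<close> runs for all polynomials simultaneously.\<close>

lemma C_k_bump:
  fixes q :: "'a::euclidean_space \<Rightarrow> real"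
  assumes "\<And>k. C_k k q"
  shows "C_k k (\<lambda>x. bump p (q x))"
proof (induction k arbitrary: p)
  case 0
  show ?case using assms[of 0] by (auto intro: continuous_intros)
next
  case (Suc k)
  have "((\<lambda>x. bump p (q x)) has_derivative
      (\<lambda>v. bump ([:0, 0, 1:] * (p - pderiv p)) (q x) * frechet_derivative q (at x) v)) (at x)" for x
    using has_derivative_compose[OF C_k_SucD(1)[OF assms[of "Suc 0"]] 
        bump_has_derivative[unfolded has_field_derivative_def]]
    by (simp add: o_def)
  then show ?case
    by (rule C_k_SucI) (intro C_k_mult Suc.IH C_k_SucD(2) assms)
qed

lemma continuous_on_GDERIV:
  assumes "\<And>x. GDERIV f x :> D x" shows "continuous_on UNIV f"
  using assms unfolding gderiv_def
  by (auto intro!: continuous_at_imp_continuous_on has_derivative_continuous)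

lemma frechet_derivative_GDERIV:
  assumes "GDERIV f x :> D" shows "frechet_derivative f (at x) = (\<lambda>h. h \<bullet> D)"
  using assms unfolding gderiv_def by (metis frechet_derivative_at)

lemma gradient_GDERIV:
  assumes "GDERIV f x :> D" shows "gradient f x = D"
  using euclidean_representation[of D]
  by (simp add: gradient_def frechet_derivative_GDERIV[OF assms] inner_commute[of D])

lemma integrable_if_compact_support:
  fixes f :: "'a::euclidean_space \<Rightarrow> real"
  assumes "continuous_on UNIV f" and "\<And>x. norm x \<ge> R \<Longrightarrow> f x = 0"
  shows "integrable lborel f"
proof -
  have "integrable lborel (\<lambda>x. indicator (cball 0 R) x *\<^sub>R f x)"
    by (rule borel_integrable_compact) (auto intro: continuous_on_subset[OF assms(1)])
  also have "(\<lambda>x. indicator (cball 0 R) x *\<^sub>R f x) = f"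
    using assms(2) by (auto simp: fun_eq_iff split: split_indicator)
  finally show ?thesis .
qed

lemma bounded_if_compact_support:
  fixes f :: "'a::euclidean_space \<Rightarrow> 'b::real_normed_vector"
  assumes "continuous_on UNIV f" and "\<And>z. norm z \<ge> R \<Longrightarrow> f z = 0"
  obtains C where "C > 0" and "\<And>z. norm (f z) \<le> C"
proof -
  have "bounded (f ` cball 0 R)"
    by (intro compact_imp_bounded compact_continuous_image continuous_on_subset[OF assms(1)]) auto
  then obtain C where C: "C > 0" "\<And>z. z \<in> cball 0 R \<Longrightarrow> norm (f z) \<le> C"
    by (auto simp: bounded_pos)
  have "norm (f z) \<le> C" for z
    using C assms(2)[of z] by (cases "norm z \<le> R") auto
  with C show thesis by (intro that) auto
qed

text \<open>A radial bump, together with its gradient \<open>G\<close> and the gradients \<open>H b\<close> of the components of \<open>G\<close>. Its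
  reflected translates are test functions, so the weak formulation may be evaluated on them.\<close>

locale mollifier =
  fixes \<epsilon> :: real and r :: "'a::euclidean_space \<Rightarrow> real"
    and G :: "'a \<Rightarrow> 'a" and H :: "'a \<Rightarrow> 'a \<Rightarrow> 'a"
  assumes nonneg: "r z \<ge> 0"
    and has_integral_1: "has_bochner_integral lborel r 1"
    and supp: "norm z \<ge> \<epsilon> \<Longrightarrow> r z = 0" "norm z \<ge> \<epsilon> \<Longrightarrow> G z = 0" "norm z \<ge> \<epsilon> \<Longrightarrow> H b z = 0"
    and gderiv_r: "GDERIV r z :> G z"
    and gderiv_G: "GDERIV (\<lambda>z. G z \<bullet> b) z :> H b z"
    and cont: "continuous_on UNIV r" "continuous_on UNIV G" "continuous_on UNIV (H b)"
    and test: "test_function (\<lambda>y. r (x - y))"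

lemma mollifier_exists:
  assumes "\<epsilon> > 0"
  obtains r :: "'a::euclidean_space \<Rightarrow> real" and G H where "mollifier \<epsilon> r G H"
proof -
  define q :: "'a \<Rightarrow> real" where "q z = \<epsilon>\<^sup>2 - z \<bullet> z" for z
  define p1 p2 :: "real poly" where "p1 = [:0, 0, 1:] * (1 - pderiv 1)" and "p2 = [:0, 0, 1:] * (p1 - pderiv p1)"
  have q_le: "q z \<le> 0" if "norm z \<ge> \<epsilon>" for z
    using power_mono[OF that, of 2] assms by (simp add: q_def power2_norm_eq_inner)
  have q_pos: "q z > 0" if "norm z < \<epsilon>" for z
    using power_strict_mono[OF that, of 2] by (simp add: q_def power2_norm_eq_inner)
  have bump0: "bump p (q z) = 0" if "norm z \<ge> \<epsilon>" for z p
    using q_le[OF that] by (simp add: bump_def)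
  have contq: "continuous_on S q" for S
    unfolding q_def by (intro continuous_intros)
  have gq: "GDERIV q z :> (-2) *\<^sub>R z" for z
    unfolding gderiv_def q_def by (auto intro!: derivative_eq_intros simp: inner_commute)
  have gbump: "GDERIV (\<lambda>z. bump p (q z)) z :> bump ([:0, 0, 1:] * (p - pderiv p)) (q z) *\<^sub>R (-2) *\<^sub>R z" for p z
    by (rule GDERIV_DERIV_compose[OF gq bump_has_derivative])
  \<comment> \<open>the bump is normalised by its total mass; the open ball, where it is positive, is not negligible\<close>
  define B where "B = (LBINT z. bump 1 (q z))"
  have cb: "continuous_on S (\<lambda>z. bump p (q z))" for S p
    by (intro continuous_intros contq)
  have nn: "bump 1 (q z) \<ge> 0" for z by (simp add: bump_def)
  have int: "integrable lborel (\<lambda>z. bump 1 (q z))"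
    by (rule integrable_if_compact_support[OF cb bump0])
  have "B \<noteq> 0"
  proof
    assume "B = 0"
    then have ae: "AE z in lborel. bump 1 (q z) = 0"
      using integral_nonneg_eq_0_iff_AE[OF int] nn by (auto simp: B_def)
    have "AE z::'a in lborel. z \<notin> ball 0 \<epsilon>"
    proof (rule AE_mp[OF ae], rule AE_I2)
      fix z :: 'a show "bump 1 (q z) = 0 \<longrightarrow> z \<notin> ball 0 \<epsilon>"
        using q_pos[of z] by (auto simp: bump_def)
    qed
    then have "ball 0 \<epsilon> \<in> null_sets (lborel :: 'a measure)"
      by (subst (asm) AE_iff_null_sets[symmetric]) auto
    then show False
      using assms open_not_negligible[of "ball 0 \<epsilon> :: 'a set"]
      by (auto simp: negligible_iff_null_sets dest: null_sets_completionI)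
  qed
  moreover have "B \<ge> 0" unfolding B_def by (intro integral_nonneg_AE) (auto simp: nn)
  ultimately have B: "B > 0" by simp
  define r where "r = (\<lambda>z. bump 1 (q z) / B)"
  define G where "G = (\<lambda>z. (-2 * bump p1 (q z) / B) *\<^sub>R z)"
  define H where "H = (\<lambda>b z. (-2 / B) *\<^sub>R (bump p1 (q z) *\<^sub>R b + (z \<bullet> b) *\<^sub>R bump p2 (q z) *\<^sub>R (-2) *\<^sub>R z))"
  have "mollifier \<epsilon> r G H"
  proof
    show "has_bochner_integral lborel r 1"
      using int B by (simp add: has_bochner_integral_iff r_def B_def)
    show "GDERIV r z :> G z" for z
      unfolding gderiv_def
      using has_derivative_mult_right[OF gbump[of 1 z, unfolded gderiv_def], of "1 / B"]
      by (simp add: r_def G_def p1_def mult_ac)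
    show "GDERIV (\<lambda>z. G z \<bullet> b) z :> H b z" for b z
    proof -
      have "GDERIV (\<lambda>z. z \<bullet> b) z :> b"
        unfolding gderiv_def by (auto intro!: derivative_eq_intros)
      from GDERIV_mult[OF gbump[of p1 z] this, folded p2_def]
      show ?thesis
        unfolding gderiv_def G_def H_def
        by (drule_tac x="-2 / B" in has_derivative_mult_right) (simp add: mult_ac)
    qed
    show "test_function (\<lambda>y. r (x - y))" for x
      unfolding test_function_def
    proof
      have "C_k k (\<lambda>y. bump 1 (\<epsilon>\<^sup>2 - (x - y) \<bullet> (x - y)) * (1 / B))" for k
        by (intro C_k_mult C_k_const C_k_bump C_k_dist_square)
      then show "\<forall>k. C_k k (\<lambda>y. r (x - y))" by (simp add: r_def q_def)
      have "{y. r (x - y) \<noteq> 0} \<subseteq> cball x \<epsilon>"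
        using bump0 by (force simp: r_def dist_norm)
      then have "closure {y. r (x - y) \<noteq> 0} \<subseteq> cball x \<epsilon>"
        by (rule closure_minimal) auto
      then show "compact (closure {y. r (x - y) \<noteq> 0})"
        by (meson bounded_cball bounded_subset closed_closure compact_eq_bounded_closed)
    qed
  qed (use B in \<open>auto simp: r_def G_def H_def bump0 nn intro!: continuous_intros contq\<close>)
  then show thesis by (rule that)
qed

lemma GDERIV_reflect:
  assumes "GDERIV f (x - y) :> D" shows "GDERIV (\<lambda>y. f (x - y)) y :> - D"
proof -
  have "((\<lambda>y. x - y) has_derivative (\<lambda>h. - h)) (at y)"
    by (auto intro!: derivative_eq_intros)
  from has_derivative_compose[OF this assms[unfolded gderiv_def]]
  show ?thesis by (simp add: gderiv_def)
qed

context mollifier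
begin

lemma gradient_test: "gradient (\<lambda>y. r (x - y)) y = - G (x - y)"
  by (intro gradient_GDERIV GDERIV_reflect gderiv_r)

lemma laplacian_test: "laplacian (\<lambda>y. r (x - y)) y = (\<Sum>b\<in>Basis. H b (x - y) \<bullet> b)"
proof -
  have 1: "frechet_derivative (\<lambda>y. r (x - y)) (at y) b = - (G (x - y) \<bullet> b)" for y b
    by (subst frechet_derivative_GDERIV[OF GDERIV_reflect[OF gderiv_r]]) (simp add: inner_commute)
  have "GDERIV (\<lambda>y. - (G (x - y) \<bullet> b)) y :> H b (x - y)" for b
    using GDERIV_minus[OF GDERIV_reflect[OF gderiv_G[of b "x - y"]]] by simp
  from frechet_derivative_GDERIV[OF this] show ?thesis
    by (simp add: laplacian_def 1 inner_commute[of _ "H _ _"])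
qed

end

section \<open>Translations, convolutions and integration by parts\<close>

lemma lborel_reflect: "distr lborel borel (\<lambda>y. x - y) = (lborel :: 'a::euclidean_space measure)"
  by (subst (2) lborel_affine[of "-1" x]) (auto simp: density_1)

lemma integrable_lborel_reflect:
  fixes f :: "'a::euclidean_space \<Rightarrow> 'b::{banach, second_countable_topology}"
  assumes "integrable lborel f"
  shows "integrable lborel (\<lambda>y. f (x - y))"
  using assms by (subst (asm) lborel_reflect[of x, symmetric]) (simp add: integrable_distr_eq borel_measurable_integrable[OF assms, simplified])

lemma integrable_lborel_shift:
  fixes f :: "'a::euclidean_space \<Rightarrow> 'b::{banach, second_countable_topology}"
  assumes "integrable lborel f"
  shows "integrable lborel (\<lambda>y. f (x + y))"
  using assms by (subst (asm) lborel_distr_plus[of x, symmetric]) (simp add: integrable_distr_eq borel_measurable_integrable[OF assms, simplified])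

lemma integral_lborel_reflect:
  fixes f :: "'a::euclidean_space \<Rightarrow> 'b::{banach, second_countable_topology}"
  assumes [measurable]: "f \<in> borel_measurable borel"
  shows "(LBINT y. f (x - y)) = (LBINT y. f y)"
  by (subst (2) lborel_reflect[of x, symmetric]) (simp add: integral_distr)

lemma integral_lborel_shift:
  fixes f :: "'a::euclidean_space \<Rightarrow> 'b::{banach, second_countable_topology}"
  assumes [measurable]: "f \<in> borel_measurable borel"
  shows "(LBINT y. f (x + y)) = (LBINT y. f y)"
  by (subst (2) lborel_distr_plus[of x, symmetric]) (simp add: integral_distr)

subsection \<open>Continuity of translations in the mean\<close>

text \<open>Translation preserves the mean distance, so a function inherits from its approximations in
  the mean that its translates converge to it.\<close>

lemma L1_translation_approx:
  fixes f g :: "'a::euclidean_space \<Rightarrow> real"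
  assumes f: "integrable lborel f" and g: "integrable lborel g"
  shows "(LBINT x. \<bar>f (h + x) - f x\<bar>)
    \<le> 2 * (LBINT x. \<bar>f x - g x\<bar>) + (LBINT x. \<bar>g (h + x) - g x\<bar>)"
proof -
  note fh = integrable_lborel_shift[OF f, of h] and gh = integrable_lborel_shift[OF g, of h]
  have [measurable]: "f \<in> borel_measurable borel" "g \<in> borel_measurable borel"
    using f g by auto
  have "(LBINT x. \<bar>f (h + x) - f x\<bar>)
      \<le> (LBINT x. \<bar>f (h + x) - g (h + x)\<bar> + \<bar>f x - g x\<bar> + \<bar>g (h + x) - g x\<bar>)"
    by (intro integral_mono Bochner_Integration.integrable_add integrable_abs
        Bochner_Integration.integrable_diff fh gh f g) auto
  also have "\<dots> = (LBINT x. \<bar>f (h + x) - g (h + x)\<bar>) + (LBINT x. \<bar>f x - g x\<bar>)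
      + (LBINT x. \<bar>g (h + x) - g x\<bar>)"
    using f g fh gh by simp
  also have "(LBINT x. \<bar>f (h + x) - g (h + x)\<bar>) = (LBINT x. \<bar>f x - g x\<bar>)"
    by (rule integral_lborel_shift[of "\<lambda>x. \<bar>f x - g x\<bar>"]) measurable
  finally show ?thesis by simp
qed

text \<open>On an open set, points do not leave under small translations; hence the positive part of the
  difference of the indicators tends to 0 by dominated convergence. The two indicators have equal
  integrals, so the negative part is as small as the positive one.\<close>

lemma L1_translation_open:
  fixes S :: "'a::euclidean_space set" and X :: "nat \<Rightarrow> 'a"
  assumes S: "open S" "emeasure lborel S < \<infinity>" and X: "X \<longlonglongrightarrow> 0"
  shows "(\<lambda>n. LBINT x. \<bar>indicator S (X n + x) - indicator S x :: real\<bar>) \<longlonglongrightarrow> 0"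
proof -
  let ?f = "indicator S :: 'a \<Rightarrow> real"
  have [measurable]: "S \<in> sets borel" using S by auto
  have f: "integrable lborel ?f" using S by (simp add: integrable_indicator_iff)
  note fh = integrable_lborel_shift[OF f]
  have "(\<lambda>n. LBINT x. max 0 (?f x - ?f (X n + x))) \<longlonglongrightarrow> (\<integral>x. 0 \<partial>(lborel :: 'a measure))"
  proof (rule integral_dominated_convergence[where w="?f"])
    show "AE x in lborel. (\<lambda>n. max 0 (?f x - ?f (X n + x))) \<longlonglongrightarrow> 0"
    proof (intro AE_I2)
      fix x :: 'a
      show "(\<lambda>n. max 0 (?f x - ?f (X n + x))) \<longlonglongrightarrow> 0"
      proof (cases "x \<in> S")
        case True
        have "(\<lambda>n. X n + x) \<longlonglongrightarrow> 0 + x" by (intro tendsto_intros X)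
        then have "\<forall>\<^sub>F n in sequentially. X n + x \<in> S"
          using True S by (intro topological_tendstoD) auto
        then have "\<forall>\<^sub>F n in sequentially. max 0 (?f x - ?f (X n + x)) = 0"
          by eventually_elim auto
        then show ?thesis by (simp add: tendsto_eventually)
      qed simp
    qed
  qed (use f in \<open>auto split: split_indicator\<close>)
  then have "(\<lambda>n. 2 * (LBINT x. max 0 (?f x - ?f (X n + x)))) \<longlonglongrightarrow> 2 * 0"
    by (intro tendsto_intros) simp
  moreover have "(LBINT x. \<bar>?f (X n + x) - ?f x\<bar>) = 2 * (LBINT x. max 0 (?f x - ?f (X n + x)))" for n
  proof -
    have "(LBINT x. \<bar>?f (X n + x) - ?f x\<bar>)
        = (LBINT x. 2 * max 0 (?f x - ?f (X n + x)) + (?f (X n + x) - ?f x))"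
      by (intro Bochner_Integration.integral_cong) (auto split: split_indicator)
    also have "\<dots> = 2 * (LBINT x. max 0 (?f x - ?f (X n + x))) + ((LBINT x. ?f (X n + x)) - (LBINT x. ?f x))"
      using f fh[of "X n"] by simp
    also have "(LBINT x. ?f (X n + x)) = (LBINT x. ?f x)"
      by (rule integral_lborel_shift) measurable
    finally show ?thesis by simp
  qed
  ultimately show ?thesis by simp
qed

text \<open>Outer regularity passes from open sets to Borel sets of finite measure; the rest is the
  standard induction for integrable functions.\<close>

lemma L1_translation_sequence:
  fixes f :: "'a::euclidean_space \<Rightarrow> real" and X :: "nat \<Rightarrow> 'a"
  assumes f: "integrable lborel f" and X: "X \<longlonglongrightarrow> 0"
  shows "(\<lambda>n. LBINT x. \<bar>f (X n + x) - f x\<bar>) \<longlonglongrightarrow> 0"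
proof -
  have approx: "(\<lambda>n. LBINT x. \<bar>f (X n + x) - f x\<bar>) \<longlonglongrightarrow> 0"
    if f: "integrable lborel f"
    and g: "\<And>e. e > 0 \<Longrightarrow> \<exists>g. integrable lborel g \<and> (LBINT x. \<bar>f x - g x\<bar>) < e \<and>
        (\<lambda>n. LBINT x. \<bar>g (X n + x) - g x\<bar>) \<longlonglongrightarrow> 0" for f :: "'a \<Rightarrow> real"
  proof (rule LIMSEQ_I)
    fix e :: real assume "e > 0"
    then obtain g where g: "integrable lborel g" "(LBINT x. \<bar>f x - g x\<bar>) < e / 4"
        "(\<lambda>n. LBINT x. \<bar>g (X n + x) - g x\<bar>) \<longlonglongrightarrow> 0"
      using g[of "e / 4"] by auto
    then obtain N where N: "\<And>n. n \<ge> N \<Longrightarrow> norm ((LBINT x. \<bar>g (X n + x) - g x\<bar>) - 0) < e / 2"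
      using LIMSEQ_D[OF g(3), of "e / 2"] \<open>e > 0\<close> by auto
    have "norm ((LBINT x. \<bar>f (X n + x) - f x\<bar>) - 0) < e" if "n \<ge> N" for n
      using L1_translation_approx[OF f g(1), of "X n"] N[OF that] g(2) by simp
    then show "\<exists>no. \<forall>n\<ge>no. norm ((LBINT x. \<bar>f (X n + x) - f x\<bar>) - 0) < e" by blast
  qed
  from f show ?thesis
  proof (induction rule: integrable_induct)
    case (base A c)
    then have [measurable]: "A \<in> sets borel" by simp
    show ?case
    proof (rule approx)
      show "integrable lborel (\<lambda>x. indicator A x *\<^sub>R c)"
        using base by (intro integrable_scaleR_left) (auto simp: integrable_indicator_iff)
      fix e :: real assume e: "e > 0"
      define e' where "e' = e / (\<bar>c\<bar> + 1)"
      have e': "e' > 0" using e by (simp add: e'_def add_nonneg_pos)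
      obtain S where S: "open S" "A \<subseteq> S" "emeasure lborel (S - A) < e'"
        using outer_regular_lborel[OF _ e', of A] by auto
      then have [measurable]: "S \<in> sets borel" by auto
      have "emeasure lborel S = emeasure lborel A + emeasure lborel (S - A)"
        using S by (subst plus_emeasure) (auto intro: arg_cong)
      then have finS: "emeasure lborel S < \<infinity>"
        using base S by (simp add: less_top order_less_trans)
      then have iS: "integrable lborel (indicator S :: 'a \<Rightarrow> real)"
        by (simp add: integrable_indicator_iff)
      have "(LBINT x. \<bar>indicator A x *\<^sub>R c - indicator S x *\<^sub>R c\<bar>) = (LBINT x. indicator (S - A) x * \<bar>c\<bar>)"
        using S by (intro Bochner_Integration.integral_cong) (auto split: split_indicator)
      also have "\<dots> = measure lborel (S - A) * \<bar>c\<bar>"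
        by simp
      also have "\<dots> \<le> e' * \<bar>c\<bar>"
      proof (rule mult_right_mono)
        show "measure lborel (S - A) \<le> e'"
          using S(3) e' by (simp add: measure_def enn2real_leI)
      qed simp
      also have "\<dots> < e"
        using e by (simp add: e'_def field_simps)
      finally have 1: "(LBINT x. \<bar>indicator A x *\<^sub>R c - indicator S x *\<^sub>R c\<bar>) < e" .
      have "(\<lambda>n. (LBINT x. \<bar>indicator S (X n + x) - indicator S x :: real\<bar>) * \<bar>c\<bar>) \<longlonglongrightarrow> 0 * \<bar>c\<bar>"
        by (intro tendsto_intros L1_translation_open S X finS)
      also have "(\<lambda>n. (LBINT x. \<bar>indicator S (X n + x) - indicator S x :: real\<bar>) * \<bar>c\<bar>)
          = (\<lambda>n. LBINT x. \<bar>indicator S (X n + x) *\<^sub>R c - indicator S x *\<^sub>R c\<bar>)"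
        by (simp add: left_diff_distrib[symmetric] abs_mult)
      finally have 2: "(\<lambda>n. LBINT x. \<bar>indicator S (X n + x) *\<^sub>R c - indicator S x *\<^sub>R c\<bar>) \<longlonglongrightarrow> 0"
        by simp
      show "\<exists>g. integrable lborel g \<and> (LBINT x. \<bar>indicator A x *\<^sub>R c - g x\<bar>) < e \<and>
          (\<lambda>n. LBINT x. \<bar>g (X n + x) - g x\<bar>) \<longlonglongrightarrow> 0"
        using iS 1 2 by (intro exI[of _ "\<lambda>x. indicator S x *\<^sub>R c"]) auto
    qed
  next
    case (add f g)
    note fh = integrable_lborel_shift[OF add(1)] and gh = integrable_lborel_shift[OF add(2)]
    have "(\<lambda>n. (LBINT x. \<bar>f (X n + x) - f x\<bar>) + (LBINT x. \<bar>g (X n + x) - g x\<bar>)) \<longlonglongrightarrow> 0 + 0"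
      by (intro tendsto_intros add)
    then have "(\<lambda>n. (LBINT x. \<bar>f (X n + x) - f x\<bar>) + (LBINT x. \<bar>g (X n + x) - g x\<bar>)) \<longlonglongrightarrow> 0" 
      by simp
    then show ?case
    proof (rule tendsto_sandwich[OF _ _ tendsto_const, rotated -1])
      show "\<forall>\<^sub>F n in sequentially. (LBINT x. \<bar>f (X n + x) + g (X n + x) - (f x + g x)\<bar>)
          \<le> (LBINT x. \<bar>f (X n + x) - f x\<bar>) + (LBINT x. \<bar>g (X n + x) - g x\<bar>)"
      proof (intro always_eventually allI)
        fix n
        have "(LBINT x. \<bar>f (X n + x) + g (X n + x) - (f x + g x)\<bar>)
            \<le> (LBINT x. \<bar>f (X n + x) - f x\<bar> + \<bar>g (X n + x) - g x\<bar>)"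
          using add(1,2) fh[of "X n"] gh[of "X n"] by (intro integral_mono) auto
        also have "\<dots> = (LBINT x. \<bar>f (X n + x) - f x\<bar>) + (LBINT x. \<bar>g (X n + x) - g x\<bar>)"
          using add(1,2) fh[of "X n"] gh[of "X n"] by simp
        finally show "(LBINT x. \<bar>f (X n + x) + g (X n + x) - (f x + g x)\<bar>)
          \<le> (LBINT x. \<bar>f (X n + x) - f x\<bar>) + (LBINT x. \<bar>g (X n + x) - g x\<bar>)" .
      qed
    qed simp
  next
    case (lim f s)
    show ?case
    proof (rule approx[OF lim(4)])
      fix e :: real assume "e > 0"
      have "(\<lambda>i. LBINT x. \<bar>f x - s i x\<bar>) \<longlonglongrightarrow> (\<integral>x. 0 \<partial>(lborel :: 'a measure))"
      proof (rule integral_dominated_convergence[where w="\<lambda>x. 3 * \<bar>f x\<bar>"])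
        show "AE x in lborel. (\<lambda>i. \<bar>f x - s i x\<bar>) \<longlonglongrightarrow> 0"
        proof (intro AE_I2)
          fix x :: 'a
          have "(\<lambda>i. \<bar>f x - s i x\<bar>) \<longlonglongrightarrow> \<bar>f x - f x\<bar>"
            using lim(2)[of x] by (intro tendsto_intros) auto
          then show "(\<lambda>i. \<bar>f x - s i x\<bar>) \<longlonglongrightarrow> 0" by simp
        qed
        show "AE x in lborel. norm \<bar>f x - s i x\<bar> \<le> 3 * \<bar>f x\<bar>" for i
          using lim(3)[of _ i] by (intro AE_I2) (smt (verit) real_norm_def space_lborel UNIV_I)
      qed (use lim(1,4) in auto)
      then obtain i where "(LBINT x. \<bar>f x - s i x\<bar>) < e"
        using LIMSEQ_D[of _ _ e] \<open>e > 0\<close> by fastforce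
      then show "\<exists>g. integrable lborel g \<and> (LBINT x. \<bar>f x - g x\<bar>) < e \<and>
          (\<lambda>n. LBINT x. \<bar>g (X n + x) - g x\<bar>) \<longlonglongrightarrow> 0"
        using lim(1,5) by blast
    qed
  qed
qed

lemma L1_translation:
  fixes f :: "'a::euclidean_space \<Rightarrow> real"
  assumes f: "integrable lborel f" and "e > 0"
  obtains d where "d > 0" and "\<And>h. norm h < d \<Longrightarrow> (LBINT x. \<bar>f (h + x) - f x\<bar>) < e"
proof -
  have "((\<lambda>h. LBINT x. \<bar>f (h + x) - f x\<bar>) \<longlongrightarrow> 0) (at 0)"
    unfolding tendsto_at_iff_sequentially using L1_translation_sequence[OF f] by (auto simp: o_def)
  then obtain d where d: "d > 0" "\<And>h. h \<noteq> 0 \<Longrightarrow> norm h < d \<Longrightarrow> (LBINT x. \<bar>f (h + x) - f x\<bar>) < e"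
    using order_tendstoD(2)[of _ 0 "at 0" e] \<open>e > 0\<close> by (force simp: eventually_at)
  have "(LBINT x. \<bar>f (h + x) - f x\<bar>) < e" if "norm h < d" for h
    using d(2)[OF _ that] \<open>e > 0\<close> by (cases "h = 0") auto
  with d(1) show thesis by (rule that)
qed


subsection \<open>Integration by parts\<close>

lemma GDERIV_line:
  assumes "GDERIV f (x + t *\<^sub>R b) :> D"
  shows "((\<lambda>t. f (x + t *\<^sub>R b)) has_real_derivative D \<bullet> b) (at t)"
proof -
  have "((\<lambda>t. x + t *\<^sub>R b) has_derivative (\<lambda>s. s *\<^sub>R b)) (at t)"
    by (auto intro!: derivative_eq_intros)
  from has_derivative_compose[OF this assms[unfolded gderiv_def]]
  show ?thesis by (simp add: has_field_derivative_def inner_commute mult.commute[of "b \<bullet> D"] mult_commute_abs)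
qed

text \<open>Difference quotients have integral 0 by translation invariance, and they converge dominatedly
  to the directional derivative.\<close>

lemma integral_directional_derivative_zero:
  fixes f :: "'a::euclidean_space \<Rightarrow> real"
  assumes D: "\<And>x. GDERIV f x :> D x" and cont: "continuous_on UNIV D"
    and supp: "\<And>x. norm x \<ge> R \<Longrightarrow> f x = 0" "\<And>x. norm x \<ge> R \<Longrightarrow> D x = 0"
  shows "(LBINT x. D x \<bullet> b) = 0"
proof -
  obtain C where C: "C > 0" "\<And>x. norm (D x) \<le> C"
    using bounded_if_compact_support[OF cont supp(2)] by blast
  define t :: "nat \<Rightarrow> real" where "t n = inverse (real (Suc n))" for n
  have t: "t n > 0" "t n \<le> 1" for n by (auto simp: t_def divide_simps)
  have contf: "continuous_on UNIV f"
    by (rule continuous_on_GDERIV[OF D])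
  have [measurable]: "f \<in> borel_measurable borel" "D \<in> borel_measurable borel"
    using contf cont by (auto intro: borel_measurable_continuous_onI)
  have intf: "integrable lborel f" by (rule integrable_if_compact_support[OF contf supp(1)])
  define s where "s n x = (f (t n *\<^sub>R b + x) - f x) / t n" for n x
  have line: "((\<lambda>t. f (x + t *\<^sub>R b)) has_real_derivative D (x + s *\<^sub>R b) \<bullet> b) (at s)" for x s
    by (rule GDERIV_line[OF D])
  have "(\<lambda>n. LBINT x. s n x) \<longlonglongrightarrow> (LBINT x. D x \<bullet> b)"
  proof (rule integral_dominated_convergence[where w="\<lambda>x. (C * norm b) * indicator (cball 0 (R + norm b)) x"])
    show "AE x in lborel. (\<lambda>n. s n x) \<longlonglongrightarrow> D x \<bullet> b"
    proof (intro AE_I2)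
      fix x
      have "((\<lambda>h. (f (x + h *\<^sub>R b) - f x) / h) \<longlongrightarrow> D x \<bullet> b) (at 0)"
        using line[of x 0] by (simp add: DERIV_def)
      moreover have "filterlim t (at 0) sequentially"
      proof (rule filterlim_atI)
        show "t \<longlonglongrightarrow> 0" unfolding t_def by (rule LIMSEQ_inverse_real_of_nat)
      qed (auto simp: t_def)
      ultimately have "(\<lambda>n. (f (x + t n *\<^sub>R b) - f x) / t n) \<longlonglongrightarrow> D x \<bullet> b"
        by (rule filterlim_compose)
      then show "(\<lambda>n. s n x) \<longlonglongrightarrow> D x \<bullet> b" by (simp add: s_def add.commute)
    qed
    show "AE x in lborel. norm (s n x) \<le> (C * norm b) * indicator (cball 0 (R + norm b)) x" for n
    proof (intro AE_I2)
      fix x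
      show "norm (s n x) \<le> (C * norm b) * indicator (cball 0 (R + norm b)) x"
      proof (cases "x \<in> cball 0 (R + norm b)")
        case True
        obtain z where z: "f (x + t n *\<^sub>R b) - f (x + 0 *\<^sub>R b) = (t n - 0) * (D (x + z *\<^sub>R b) \<bullet> b)"
          using MVT2[OF t(1)[of n], where f="\<lambda>s. f (x + s *\<^sub>R b)" and f'="\<lambda>s. D (x + s *\<^sub>R b) \<bullet> b"] line[of x]
          by blast
        then have "s n x = D (x + z *\<^sub>R b) \<bullet> b" using t(1)[of n] by (simp add: s_def add.commute)
        also have "norm \<dots> \<le> norm (D (x + z *\<^sub>R b)) * norm b" by (simp add: Cauchy_Schwarz_ineq2)
        also have "\<dots> \<le> C * norm b" by (intro mult_right_mono C) auto
        finally show ?thesis using True by simp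
      next
        case False
        have "norm (t n *\<^sub>R b) \<le> norm b" using t[of n] by (simp add: mult_left_le_one_le)
        then have "norm (t n *\<^sub>R b + x) \<ge> R" "norm x \<ge> R"
          using False norm_triangle_ineq4[of "t n *\<^sub>R b + x" "t n *\<^sub>R b"] norm_ge_zero[of b]
          by (auto simp del: norm_ge_zero norm_scaleR)
        then show ?thesis using False supp(1) by (simp add: s_def)
      qed
    qed
    show "integrable lborel (\<lambda>x::'a. (C * norm b) * indicator (cball 0 (R + norm b)) x)"
      using emeasure_lborel_cball_finite[of "0::'a" "R + norm b"]
      by (intro integrable_mult_right) (auto simp: integrable_indicator_iff)
  qed (auto simp: s_def[abs_def])
  moreover have "(LBINT x. s n x) = 0" for n
    using integrable_lborel_shift[OF intf, of "t n *\<^sub>R b"] intf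
    by (simp add: s_def integral_lborel_shift)
  ultimately show ?thesis by (simp add: LIMSEQ_const_iff)
qed

subsection \<open>Convolution with a smooth kernel\<close>

lemma continuous_on_convolution:
  fixes k :: "'a::euclidean_space \<Rightarrow> 'b::euclidean_space" and U :: "'a \<Rightarrow> real"
  assumes U: "integrable lborel U" and k: "continuous_on UNIV k" and C: "\<And>z. norm (k z) \<le> C"
  shows "continuous_on UNIV (\<lambda>x. LBINT y. U y *\<^sub>R k (x - y))"
    and "integrable lborel (\<lambda>y. U y *\<^sub>R k (x - y))"
proof -
  have [measurable]: "k \<in> borel_measurable borel" "U \<in> borel_measurable borel"
    using k U by (auto intro: borel_measurable_continuous_onI)
  have "C \<ge> 0" using C[of 0] norm_ge_zero[of "k 0"] by linarith
  have b: "norm (U y *\<^sub>R k z) \<le> \<bar>U y\<bar> * C" for y z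
    by (auto intro!: mult_left_mono C)
  have Ui: "integrable lborel (\<lambda>y. \<bar>U y\<bar> * C)" using U by auto
  show "integrable lborel (\<lambda>y. U y *\<^sub>R k (x - y))"
    by (rule Bochner_Integration.integrable_bound[OF Ui])
      (use b \<open>C \<ge> 0\<close> in \<open>auto intro!: AE_I2 simp: abs_mult\<close>)
  show "continuous_on UNIV (\<lambda>x. LBINT y. U y *\<^sub>R k (x - y))"
  proof (rule continuous_on_sequentiallyI)
    fix u :: "nat \<Rightarrow> 'a" and a assume u: "u \<longlonglongrightarrow> a"
    show "(\<lambda>n. LBINT y. U y *\<^sub>R k (u n - y)) \<longlonglongrightarrow> (LBINT y. U y *\<^sub>R k (a - y))"
    proof (rule integral_dominated_convergence[OF _ _ Ui])
      show "AE y in lborel. (\<lambda>n. U y *\<^sub>R k (u n - y)) \<longlonglongrightarrow> U y *\<^sub>R k (a - y)"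
      proof (intro AE_I2 tendsto_intros)
        fix y
        have "(\<lambda>n. u n - y) \<longlonglongrightarrow> a - y" by (intro tendsto_intros u)
        then show "(\<lambda>n. k (u n - y)) \<longlonglongrightarrow> k (a - y)"
          by (intro continuous_on_tendsto_compose[OF k]) auto
      qed
    qed (use b in auto)
  qed
qed

text \<open>Differentiation under the integral sign: the difference quotients of \<open>k\<close> are bounded by the
  Lipschitz constant \<open>C\<close>. The kernel \<open>k\<close> may be unbounded, as is the regularised logarithm.\<close>

lemma GDERIV_convolution:
  fixes k :: "'a::euclidean_space \<Rightarrow> real" and U :: "'a \<Rightarrow> real"
  assumes U: "integrable lborel U" and G: "\<And>z. GDERIV k z :> G z"
    and cont: "continuous_on UNIV G" and C: "\<And>z. norm (G z) \<le> C"
    and int: "\<And>x. integrable lborel (\<lambda>y. U y * k (x - y))"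
  shows "GDERIV (\<lambda>x. LBINT y. U y * k (x - y)) x :> (LBINT y. U y *\<^sub>R G (x - y))"
proof -
  have kc: "continuous_on UNIV k"
    by (rule continuous_on_GDERIV[OF G])
  have [measurable]: "k \<in> borel_measurable borel" "G \<in> borel_measurable borel" "U \<in> borel_measurable borel"
    using kc cont U by (auto intro: borel_measurable_continuous_onI)
  have lip: "\<bar>k (z + h) - k z\<bar> \<le> C * norm h" for z h
  proof -
    have "norm (k (z + h) - k z) \<le> C * norm (z + h - z)"
    proof (rule differentiable_bound[of UNIV k "\<lambda>z h. h \<bullet> G z"])
      show "onorm (\<lambda>h. h \<bullet> G y) \<le> C" for y
      proof (rule onorm_le)
        fix h
        have "norm (h \<bullet> G y) \<le> norm h * norm (G y)" by (simp add: Cauchy_Schwarz_ineq2)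
        also have "\<dots> \<le> norm h * C" by (intro mult_left_mono C) auto
        finally show "norm (h \<bullet> G y) \<le> C * norm h" by (simp add: mult.commute)
      qed
    qed (use G in \<open>auto simp: gderiv_def\<close>)
    then show ?thesis by simp
  qed
  have Gi: "integrable lborel (\<lambda>y. U y *\<^sub>R G (x - y))"
    by (rule continuous_on_convolution(2)[OF U cont C])
  have inner: "h \<bullet> (LBINT y. U y *\<^sub>R G (x - y)) = (LBINT y. U y * (h \<bullet> G (x - y)))" for h
    using integral_inner_right[of h lborel "\<lambda>y. U y *\<^sub>R G (x - y)"] Gi by simp
  have Gi': "integrable lborel (\<lambda>y. U y * (h \<bullet> G (x - y)))" for h
    using integrable_inner_right[of h lborel "\<lambda>y. U y *\<^sub>R G (x - y)"] Gi by simp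
  define q where "q h y = (k (x - y + h) - k (x - y) - h \<bullet> G (x - y)) / norm h" for h y
  have qb: "\<bar>q h y\<bar> \<le> 2 * C" if "h \<noteq> 0" for h y
  proof -
    have "\<bar>h \<bullet> G (x - y)\<bar> \<le> norm h * norm (G (x - y))" by (simp add: Cauchy_Schwarz_ineq2)
    also have "\<dots> \<le> norm h * C" by (intro mult_left_mono C) auto
    finally have "\<bar>k (x - y + h) - k (x - y) - h \<bullet> G (x - y)\<bar> \<le> 2 * C * norm h"
      using lip[of "x - y" h] abs_triangle_ineq4[of "k (x - y + h) - k (x - y)" "h \<bullet> G (x - y)"]
      by (simp add: algebra_simps)
    then show ?thesis using that by (simp add: q_def divide_simps abs_divide)
  qed
  have "((\<lambda>h. norm ((LBINT y. U y * k (x + h - y)) - (LBINT y. U y * k (x - y))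
      - h \<bullet> (LBINT y. U y *\<^sub>R G (x - y))) / norm h) \<longlongrightarrow> 0) (at 0)"
    unfolding tendsto_at_iff_sequentially o_def
  proof (intro allI impI)
    fix X :: "nat \<Rightarrow> 'a" assume "\<forall>i. X i \<in> UNIV - {0}" and X: "X \<longlonglongrightarrow> 0"
    then have X0: "X i \<noteq> 0" for i by auto
    have "(\<lambda>n. LBINT y. U y * q (X n) y) \<longlonglongrightarrow> (\<integral>y. 0 \<partial>(lborel :: 'a measure))"
    proof (rule integral_dominated_convergence[where w="\<lambda>y. \<bar>U y\<bar> * (2 * C)"])
      show "AE y in lborel. (\<lambda>n. U y * q (X n) y) \<longlonglongrightarrow> 0"
      proof (intro AE_I2 tendsto_mult_right_zero)
        fix y
        have "((\<lambda>h. norm (k (x - y + h) - k (x - y) - h \<bullet> G (x - y)) / norm h) \<longlongrightarrow> 0) (at 0)"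
          using G[of "x - y"] by (simp add: gderiv_def has_derivative_at)
        then have "(\<lambda>n. norm (k (x - y + X n) - k (x - y) - X n \<bullet> G (x - y)) / norm (X n)) \<longlonglongrightarrow> 0"
          using X X0 unfolding tendsto_at_iff_sequentially o_def by blast
        then have "(\<lambda>n. \<bar>q (X n) y\<bar>) \<longlonglongrightarrow> 0" by (simp add: q_def abs_divide)
        then show "(\<lambda>n. q (X n) y) \<longlonglongrightarrow> 0" by (simp add: tendsto_rabs_zero_iff)
      qed
      show "AE y in lborel. norm (U y * q (X n) y) \<le> \<bar>U y\<bar> * (2 * C)" for n
        by (intro AE_I2) (auto simp: abs_mult intro!: mult_left_mono qb X0)
    qed (use U in \<open>auto simp: q_def[abs_def]\<close>)
    then have "(\<lambda>n. \<bar>\<integral>y. U y * q (X n) y \<partial>lborel\<bar>) \<longlonglongrightarrow> 0" by (auto intro: tendsto_rabs_zero)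
    moreover have "\<bar>\<integral>y. U y * q (X n) y \<partial>lborel\<bar> = norm ((LBINT y. U y * k (x + X n - y))
        - (LBINT y. U y * k (x - y)) - X n \<bullet> (LBINT y. U y *\<^sub>R G (x - y))) / norm (X n)" for n
    proof -
      have "(LBINT y. U y * q (X n) y) = (LBINT y. (U y * k (x + X n - y) - U y * k (x - y)
          - U y * (X n \<bullet> G (x - y))) / norm (X n))"
        by (intro Bochner_Integration.integral_cong) (auto simp: q_def field_simps algebra_simps)
      also have "\<dots> = ((LBINT y. U y * k (x + X n - y)) - (LBINT y. U y * k (x - y))
          - X n \<bullet> (LBINT y. U y *\<^sub>R G (x - y))) / norm (X n)"
        using int[of "x + X n"] int[of x] Gi'[of "X n"] unfolding inner by simp
      finally show ?thesis by (simp add: abs_divide)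
    qed
    ultimately show "(\<lambda>n. norm ((LBINT y. U y * k (x + X n - y)) - (LBINT y. U y * k (x - y))
        - X n \<bullet> (LBINT y. U y *\<^sub>R G (x - y))) / norm (X n)) \<longlonglongrightarrow> 0"
      by simp
  qed
  then show ?thesis
    unfolding gderiv_def has_derivative_at by (auto intro: bounded_linear_inner_left)
qed

section \<open>Mollification in the mean, and functions with vanishing gradient\<close>

context mollifier
begin

lemma bounded_r: obtains C where "C > 0" "\<And>z. \<bar>r z\<bar> \<le> C"
  using bounded_if_compact_support[OF cont(1) supp(1)] by auto

lemma bounded_G: obtains C where "C > 0" "\<And>z. norm (G z) \<le> C"
  using bounded_if_compact_support[OF cont(2) supp(2)] by auto

lemma bounded_H: obtains C where "C > 0" "\<And>z. norm (H b z) \<le> C"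
  using bounded_if_compact_support[OF cont(3) supp(3)] by auto

lemma measurable_r [measurable]: "r \<in> borel_measurable borel"
  using cont(1) by (rule borel_measurable_continuous_onI)

lemma integrable_conv_r:
  assumes "integrable lborel f"
  shows "integrable lborel (\<lambda>y. f y * r (x - y))"
proof -
  obtain C where "\<And>z. \<bar>r z\<bar> \<le> C" using bounded_r by blast
  then show ?thesis
    using continuous_on_convolution(2)[OF assms cont(1), of C x] by simp
qed

lemma continuous_conv_r:
  assumes "integrable lborel f"
  shows "continuous_on UNIV (\<lambda>x. LBINT y. f y * r (x - y))"
proof -
  obtain C where "\<And>z. \<bar>r z\<bar> \<le> C" using bounded_r by blast
  then show ?thesis
    using continuous_on_convolution(1)[OF assms cont(1), of C] by simp
qed

lemma GDERIV_conv_r: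
  assumes "integrable lborel f"
  shows "GDERIV (\<lambda>x. LBINT y. f y * r (x - y)) x :> (LBINT y. f y *\<^sub>R G (x - y))"
    and "continuous_on UNIV (\<lambda>x. LBINT y. f y *\<^sub>R G (x - y))"
    and "integrable lborel (\<lambda>y. f y *\<^sub>R G (x - y))"
proof -
  obtain C where C: "\<And>z. norm (G z) \<le> C" using bounded_G by blast
  show "GDERIV (\<lambda>x. LBINT y. f y * r (x - y)) x :> (LBINT y. f y *\<^sub>R G (x - y))"
    by (intro GDERIV_convolution[OF assms gderiv_r cont(2) C] integrable_conv_r assms)
  show "continuous_on UNIV (\<lambda>x. LBINT y. f y *\<^sub>R G (x - y))"
    "integrable lborel (\<lambda>y. f y *\<^sub>R G (x - y))"
    by (rule continuous_on_convolution[OF assms cont(2) C])+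
qed

text \<open>The mollification is an average of translates by vectors of length below \<open>\<epsilon>\<close>, so its distance
  from \<open>f\<close> is at most the average distance of these translates.\<close>

lemma L1_mollification:
  assumes f: "integrable lborel f" and e: "e \<ge> 0"
    and close: "\<And>h. norm h < \<epsilon> \<Longrightarrow> (LBINT x. \<bar>f (h + x) - f x\<bar>) \<le> e"
  shows "integrable lborel (\<lambda>x. (LBINT y. f y * r (x - y)) - f x)"
    and "(LBINT x. \<bar>(LBINT y. f y * r (x - y)) - f x\<bar>) \<le> e"
proof -
  have [measurable]: "f \<in> borel_measurable borel" using f by auto
  define w where "w x = (LBINT y. f y * r (x - y))" for x
  have [measurable]: "w \<in> borel_measurable borel"
    using continuous_conv_r[OF f] unfolding w_def by (rule borel_measurable_continuous_onI)
  have intr: "integrable lborel r" and r1: "(LBINT z. r z) = 1"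
    using has_integral_1 by (auto simp: has_bochner_integral_iff)
  have pt: "ennreal \<bar>w x - f x\<bar> \<le> (\<integral>\<^sup>+z. ennreal (r z * \<bar>f (x - z) - f x\<bar>) \<partial>lborel)" for x
  proof -
    have 1: "integrable lborel (\<lambda>z. f (x - z) * r z)"
      using integrable_lborel_reflect[OF integrable_conv_r[OF f, of x], of x] by simp
    have "w x = (LBINT z. f (x - z) * r z)"
      unfolding w_def by (subst integral_lborel_reflect[of _ x, symmetric]) auto
    then have "w x - f x = (LBINT z. f (x - z) * r z) - (LBINT z. f x * r z)"
      using r1 by simp
    also have "\<dots> = (LBINT z. r z * (f (x - z) - f x))"
      using 1 intr by (simp add: right_diff_distrib mult.commute)
    finally have "ennreal (norm (w x - f x)) \<le> (\<integral>\<^sup>+z. norm (r z * (f (x - z) - f x)) \<partial>lborel)"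
      using integral_norm_bound_ennreal[of lborel "\<lambda>z. r z * (f (x - z) - f x)"] 1 intr
      by (simp add: right_diff_distrib mult.commute)
    then show ?thesis by (simp add: abs_mult nonneg)
  qed
  have "(\<integral>\<^sup>+x. ennreal \<bar>w x - f x\<bar> \<partial>lborel) \<le> (\<integral>\<^sup>+x. \<integral>\<^sup>+z. ennreal (r z * \<bar>f (x - z) - f x\<bar>) \<partial>lborel \<partial>lborel)"
    by (intro nn_integral_mono pt)
  also have "\<dots> = (\<integral>\<^sup>+z. \<integral>\<^sup>+x. ennreal (r z * \<bar>f (x - z) - f x\<bar>) \<partial>lborel \<partial>lborel)"
    by (rule lborel_pair.Fubini') measurable
  also have "\<dots> \<le> (\<integral>\<^sup>+z. ennreal (e * r z) \<partial>lborel)"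
  proof (rule nn_integral_mono)
    fix z :: 'a
    show "(\<integral>\<^sup>+x. ennreal (r z * \<bar>f (x - z) - f x\<bar>) \<partial>lborel) \<le> ennreal (e * r z)"
    proof (cases "norm z < \<epsilon>")
      case True
      have i: "integrable lborel (\<lambda>x. \<bar>f (x - z) - f x\<bar>)"
        using integrable_lborel_shift[OF f, of "- z"] f by auto
      have "(\<integral>\<^sup>+x. ennreal (r z * \<bar>f (x - z) - f x\<bar>) \<partial>lborel) = ennreal (LBINT x. r z * \<bar>f (x - z) - f x\<bar>)"
        using i by (intro nn_integral_eq_integral) (auto simp: nonneg)
      also have "\<dots> = ennreal (r z * (LBINT x. \<bar>f (- z + x) - f x\<bar>))"
        by simp
      also have "\<dots> \<le> ennreal (r z * e)"
        using True by (intro ennreal_leI mult_left_mono close nonneg) auto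
      finally show ?thesis by (simp add: mult.commute)
    qed (simp add: supp)
  qed
  also have "\<dots> = ennreal e"
    using intr r1 by (subst nn_integral_eq_integral) (auto simp: nonneg e)
  finally have le: "(\<integral>\<^sup>+x. ennreal \<bar>w x - f x\<bar> \<partial>lborel) \<le> ennreal e" .
  then have *: "integrable lborel (\<lambda>x. w x - f x)"
    by (intro integrableI_bounded) (auto simp: le_less_trans ennreal_less_top)
  then show "integrable lborel (\<lambda>x. (LBINT y. f y * r (x - y)) - f x)"
    by (simp add: w_def)
  show "(LBINT x. \<bar>(LBINT y. f y * r (x - y)) - f x\<bar>) \<le> e"
    using le * e by (subst (asm) nn_integral_eq_integral) (auto simp: w_def)
qed

end

lemma integrable_on_cball:
  fixes f :: "'a::euclidean_space \<Rightarrow> 'b::{banach, second_countable_topology}"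
  assumes "continuous_on UNIV f"
  shows "integrable lborel (\<lambda>x. indicator (cball 0 R) x *\<^sub>R f x)"
  by (rule borel_integrable_compact) (auto intro: continuous_on_subset[OF assms])

lemma integrable_indicator_cball: "integrable lborel (indicator (cball (0::'a::euclidean_space) R) :: 'a \<Rightarrow> real)"
  using emeasure_lborel_cball_finite[of "0::'a" R] by (auto simp: integrable_indicator_iff)

lemma integrable_bounded_cball:
  fixes f :: "'a::euclidean_space \<Rightarrow> real"
  assumes [measurable]: "f \<in> borel_measurable borel" and "\<And>x. \<bar>f x\<bar> \<le> C"
  shows "integrable lborel (\<lambda>x. indicator (cball 0 R) x * f x)"
proof (rule Bochner_Integration.integrable_bound)
  show "integrable lborel (\<lambda>x. C * indicator (cball (0::'a) R) x)"
    by (intro integrable_mult_right integrable_indicator_cball)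
  show "(\<lambda>x. indicator (cball 0 R) x * f x) \<in> borel_measurable lborel"
    by (intro borel_measurable_times borel_measurable_indicator) auto
qed (use assms(2) order_trans[OF abs_ge_zero assms(2)] in \<open>auto split: split_indicator\<close>)

text \<open>If constants come arbitrarily close to \<open>P\<close> in the mean, then so does the mean value of \<open>P\<close>,
  which does not depend on the accuracy.\<close>

lemma constant_on_cball_if_close_to_constants:
  fixes P :: "'a::euclidean_space \<Rightarrow> real"
  assumes [measurable]: "P \<in> borel_measurable borel" and bound: "\<And>x. \<bar>P x\<bar> \<le> C" and "R > 0"
    and close: "\<And>e. e > 0 \<Longrightarrow> \<exists>c. (LBINT x. indicator (cball 0 R) x * \<bar>P x - c\<bar>) \<le> e"
  shows "\<exists>c. AE x in lborel. x \<in> cball 0 R \<longrightarrow> P x = c"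
proof -
  let ?I = "indicator (cball 0 R) :: 'a \<Rightarrow> real"
  define V where "V = measure lborel (cball (0::'a) R)"
  have V: "V > 0" using \<open>R > 0\<close> by (simp add: V_def)
  have IV: "(LBINT x. ?I x) = V" by (simp add: V_def)
  define m where "m = (LBINT x. ?I x * P x) / V"
  have int: "integrable lborel (\<lambda>x. ?I x * \<bar>P x - c\<bar>)" for c
    by (rule integrable_bounded_cball[of _ "C + \<bar>c\<bar>"]) (use bound in \<open>auto intro!: order_trans[OF abs_triangle_ineq4] add_mono\<close>)
  have int': "integrable lborel (\<lambda>x. ?I x * P x)"
    by (rule integrable_bounded_cball[OF _ bound]) auto
  have "(LBINT x. ?I x * \<bar>P x - m\<bar>) \<le> 0 + e" if "e > 0" for e
  proof -
    obtain c where c: "(LBINT x. ?I x * \<bar>P x - c\<bar>) \<le> e / 2"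
      using close[of "e / 2"] \<open>e > 0\<close> by auto
    have "(m - c) * V = (LBINT x. ?I x * P x) - (LBINT x. ?I x * c)"
      using V IV by (simp add: m_def field_simps)
    also have "\<dots> = (LBINT x. ?I x * (P x - c))"
      unfolding right_diff_distrib
      by (intro Bochner_Integration.integral_diff[symmetric] int' integrable_mult_left integrable_indicator_cball)
    also have "\<bar>\<dots>\<bar> \<le> (LBINT x. ?I x * \<bar>P x - c\<bar>)"
      by (rule order_trans[OF integral_abs_bound]) (simp add: abs_mult)
    finally have mc: "\<bar>m - c\<bar> * V \<le> e / 2" using c V by (simp add: abs_mult)
    have "(LBINT x. ?I x * \<bar>P x - m\<bar>) \<le> (LBINT x. ?I x * \<bar>P x - c\<bar> + ?I x * \<bar>m - c\<bar>)"
      using int integrable_indicator_cball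
      by (intro integral_mono Bochner_Integration.integrable_add integrable_mult_left)
        (auto split: split_indicator)
    also have "\<dots> = (LBINT x. ?I x * \<bar>P x - c\<bar>) + \<bar>m - c\<bar> * V"
      by (subst Bochner_Integration.integral_add)
        (use int integrable_indicator_cball IV in \<open>auto intro: integrable_mult_left\<close>)
    finally show ?thesis using c mc by simp
  qed
  then have "(LBINT x. ?I x * \<bar>P x - m\<bar>) \<le> 0" by (rule field_le_epsilon)
  then have "(LBINT x. ?I x * \<bar>P x - m\<bar>) = 0"
    by (intro antisym integral_nonneg_AE) auto
  then have "AE x in lborel. ?I x * \<bar>P x - m\<bar> = 0"
    using integral_nonneg_eq_0_iff_AE[OF int] by auto
  then have "AE x in lborel. x \<in> cball 0 R \<longrightarrow> P x = m"
    by eventually_elim (auto split: split_indicator_asm)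
  then show ?thesis by blast
qed

lemma constant_if_constant_on_cballs:
  fixes P :: "'a::euclidean_space \<Rightarrow> real"
  assumes "\<And>R. R > 0 \<Longrightarrow> \<exists>c. AE x in lborel. x \<in> cball 0 R \<longrightarrow> P x = c"
  shows "\<exists>c. AE x in lborel. P x = c"
proof -
  obtain m where m: "\<And>R. R > 0 \<Longrightarrow> AE x in lborel. x \<in> cball 0 R \<longrightarrow> P x = m R"
    using assms by metis
  have eq: "m R = m 1" if "R \<ge> 1" for R
  proof (rule ccontr)
    assume ne: "m R \<noteq> m 1"
    have "AE x in lborel. x \<in> cball 0 R \<longrightarrow> P x = m R" "AE x in lborel. x \<in> cball 0 1 \<longrightarrow> P x = m 1"
      using m that by auto
    then have "AE x::'a in lborel. x \<notin> cball 0 1"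
      by eventually_elim (use ne that in auto)
    then have "emeasure lborel (cball (0::'a) 1) = 0"
      by (subst (asm) AE_iff_null_sets[symmetric]) auto
    then show False
      using content_cball_gt_0_iff[of "0::'a" 1] by (simp add: measure_def)
  qed
  have "AE x in lborel. \<forall>n::nat. x \<in> cball 0 (real n + 1) \<longrightarrow> P x = m 1"
    unfolding AE_all_countable using m eq by (metis add.commute le_add_same_cancel1 of_nat_0_le_iff order_less_le_trans zero_less_one)
  then have "AE x in lborel. P x = m 1"
  proof eventually_elim
    case (elim x)
    obtain n :: nat where "norm x \<le> real n" using real_arch_simple by blast
    then have "x \<in> cball 0 (real n + 1)" by simp
    then show ?case using elim by blast
  qed
  then show ?thesis by blast
qed

text \<open>On a ball, the mollification of \<open>P\<close> has gradient 0, because the translates of the mollifier are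
  admissible in the hypothesis; so it is constant there, and it is close to \<open>P\<close> in the mean.\<close>

lemma weak_gradient_zero_imp_constant:
  fixes P :: "'a::euclidean_space \<Rightarrow> real"
  assumes [measurable]: "P \<in> borel_measurable borel" and bound: "\<And>x. \<bar>P x\<bar> \<le> 1"
    and weak: "\<And>\<psi> D R b. (\<And>x. GDERIV \<psi> x :> D x) \<Longrightarrow> continuous_on UNIV D \<Longrightarrow> R > 0 \<Longrightarrow>
      (\<And>x. norm x \<ge> R \<Longrightarrow> \<psi> x = 0) \<Longrightarrow> (\<And>x. norm x \<ge> R \<Longrightarrow> D x = 0) \<Longrightarrow>
      (LBINT x. P x * (D x \<bullet> b)) = 0"
  shows "\<exists>c. AE x in lborel. P x = c"
proof (intro constant_if_constant_on_cballs constant_on_cball_if_close_to_constants[OF _ bound])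
  fix R e :: real assume R: "R > 0" and e: "e > 0"
  define f where "f x = indicator (cball 0 (R + 2)) x * P x" for x
  have f: "integrable lborel f"
    unfolding f_def by (rule integrable_bounded_cball[OF _ bound]) simp
  obtain d where d: "d > 0" "\<And>h. norm h < d \<Longrightarrow> (LBINT x. \<bar>f (h + x) - f x\<bar>) < e"
    using L1_translation[OF f e] by blast
  define \<epsilon> where "\<epsilon> = min 1 d"
  obtain r :: "'a \<Rightarrow> real" and G H where "mollifier \<epsilon> r G H"
    using mollifier_exists[of \<epsilon>] d(1) by (auto simp: \<epsilon>_def)
  then interpret mollifier \<epsilon> r G H .
  define w where "w x = (LBINT y. f y * r (x - y))" for x
  have L1: "integrable lborel (\<lambda>x. w x - f x)" "(LBINT x. \<bar>w x - f x\<bar>) \<le> e"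
    using L1_mollification[OF f, of e] d(2) e unfolding w_def \<epsilon>_def by (auto intro: less_imp_le)
  have grad: "(LBINT y. f y *\<^sub>R G (x - y)) = 0" if x: "norm x \<le> R" for x
  proof (rule euclidean_eqI)
    fix b :: 'a assume "b \<in> Basis"
    have "(LBINT y. f y *\<^sub>R G (x - y)) \<bullet> b = (LBINT y. (f y *\<^sub>R G (x - y)) \<bullet> b)"
      by (intro integral_inner_left[symmetric] GDERIV_conv_r f)
    also have "\<dots> = - (LBINT y. P y * (- G (x - y) \<bullet> b))"
    proof -
      have "(f y *\<^sub>R G (x - y)) \<bullet> b = - (P y * (- G (x - y) \<bullet> b))" for y
      proof (cases "norm y \<le> R + 2")
        case False
        then have "norm (x - y) \<ge> \<epsilon>"
          using x norm_triangle_ineq4[of x "x - y"] by (auto simp: \<epsilon>_def)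
        then show ?thesis by (simp add: supp)
      qed (simp add: f_def)
      then have "(LBINT y. (f y *\<^sub>R G (x - y)) \<bullet> b) = (LBINT y. - (P y * (- G (x - y) \<bullet> b)))"
        by (intro Bochner_Integration.integral_cong refl)
      then show ?thesis by simp
    qed
    also have "(LBINT y. P y * (- G (x - y) \<bullet> b)) = 0"
    proof (rule weak)
      show "GDERIV (\<lambda>y. r (x - y)) y :> - G (x - y)" for y
        by (intro GDERIV_reflect gderiv_r)
      show "continuous_on UNIV (\<lambda>y. - G (x - y))"
        by (intro continuous_intros continuous_on_compose2[OF cont(2)]) auto
      have "norm (x - y) \<ge> \<epsilon>" if "norm y \<ge> R + 1" for y
        using that x norm_triangle_ineq4[of x "x - y"] by (auto simp: \<epsilon>_def)
      then show "norm y \<ge> R + 1 \<Longrightarrow> r (x - y) = 0" "norm y \<ge> R + 1 \<Longrightarrow> - G (x - y) = 0" for y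
        by (simp_all add: supp)
    qed (use R in simp)
    finally show "(LBINT y. f y *\<^sub>R G (x - y)) \<bullet> b = 0 \<bullet> b" by simp
  qed
  have "\<exists>c. \<forall>x\<in>cball 0 R. w x = c"
  proof (rule has_derivative_zero_constant)
    fix x :: 'a assume "x \<in> cball 0 R"
    then have "GDERIV w x :> 0"
      using GDERIV_conv_r(1)[OF f, of x] grad[of x] unfolding w_def by simp
    then show "(w has_derivative (\<lambda>h. 0)) (at x within cball 0 R)"
      by (auto simp: gderiv_def intro: has_derivative_at_withinI)
  qed auto
  then obtain c where c: "\<And>x. x \<in> cball 0 R \<Longrightarrow> w x = c" by blast
  have "(LBINT x. indicator (cball 0 R) x * \<bar>P x - c\<bar>) \<le> (LBINT x. \<bar>w x - f x\<bar>)"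
  proof (rule integral_mono)
    show "integrable lborel (\<lambda>x. indicator (cball 0 R) x * \<bar>P x - c\<bar>)"
      by (rule integrable_bounded_cball[of _ "1 + \<bar>c\<bar>"])
        (use bound in \<open>auto intro!: order_trans[OF abs_triangle_ineq4] add_mono\<close>)
    show "indicator (cball 0 R) x * \<bar>P x - c\<bar> \<le> \<bar>w x - f x\<bar>" for x
      using c[of x] by (auto simp: f_def split: split_indicator)
  qed (use L1 in auto)
  with L1(2) show "\<exists>c. (LBINT x. indicator (cball 0 R) x * \<bar>P x - c\<bar>) \<le> e"
    by (intro exI[of _ c]) simp
qed auto

text \<open>The hypothesis survives the passage to the weak gradient: integration by parts moves the
  derivative onto the approximation \<open>p\<close>, whose gradient is small in the square mean.\<close>

lemma constant_if_approximable_with_small_gradient: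
  fixes P :: "'a::euclidean_space \<Rightarrow> real"
  assumes [measurable]: "P \<in> borel_measurable borel" and bound: "\<And>x. \<bar>P x\<bar> \<le> 1"
    and approx: "\<And>R \<kappa>. R \<ge> 1 \<Longrightarrow> \<kappa> > 0 \<Longrightarrow> \<exists>p a. (\<forall>x. GDERIV p x :> a x) \<and> continuous_on UNIV a \<and>
      (LBINT x. indicator (cball 0 R) x * (norm (a x))\<^sup>2) \<le> \<kappa> \<and>
      (LBINT x. indicator (cball 0 R) x * \<bar>p x - P x\<bar>) \<le> \<kappa>"
  shows "\<exists>c. AE x in lborel. P x = c"
proof (rule weak_gradient_zero_imp_constant[OF _ bound])
  fix \<psi> :: "'a \<Rightarrow> real" and D and R0 :: real and b :: 'a
  assume D: "\<And>x. GDERIV \<psi> x :> D x" and contD: "continuous_on UNIV D"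
    and supp0: "\<And>x. norm x \<ge> R0 \<Longrightarrow> \<psi> x = 0" "\<And>x. norm x \<ge> R0 \<Longrightarrow> D x = 0"
  define R where "R = max R0 1"
  have R: "R \<ge> 1" and supp: "\<And>x. norm x \<ge> R \<Longrightarrow> \<psi> x = 0" "\<And>x. norm x \<ge> R \<Longrightarrow> D x = 0"
    using supp0 by (auto simp: R_def)
  have cont\<psi>: "continuous_on UNIV \<psi>"
    by (rule continuous_on_GDERIV[OF D])
  have [measurable]: "\<psi> \<in> borel_measurable borel" "D \<in> borel_measurable borel"
    using cont\<psi> contD by (auto intro: borel_measurable_continuous_onI)
  obtain C1 where C1: "C1 > 0" "\<And>x. norm (\<psi> x) \<le> C1"
    using bounded_if_compact_support[OF cont\<psi> supp(1)] by blast
  obtain C2 where C2: "C2 > 0" "\<And>x. norm (D x) \<le> C2"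
    using bounded_if_compact_support[OF contD supp(2)] by blast
  let ?I = "indicator (cball 0 R) :: 'a \<Rightarrow> real"
  define V where "V = measure lborel (cball (0::'a) R)"
  define K where "K = norm b * (C2 + C1 * (1 + V))"
  have V: "V \<ge> 0" by (simp add: V_def)
  have IV: "(LBINT x. ?I x) = V" by (simp add: V_def)
  have main: "\<bar>\<integral>x. P x * (D x \<bullet> b) \<partial>lborel\<bar> \<le> K * s" if s: "0 < s" "s \<le> 1" for s
  proof -
    have "s\<^sup>2 > 0" using s by simp
    then obtain p a where p: "\<And>x. GDERIV p x :> a x" and conta: "continuous_on UNIV a"
      and a2: "(LBINT x. ?I x * (norm (a x))\<^sup>2) \<le> s\<^sup>2"
      and pP: "(LBINT x. ?I x * \<bar>p x - P x\<bar>) \<le> s\<^sup>2"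
      using approx[OF R, of "s\<^sup>2"] by blast
    have contp: "continuous_on UNIV p"
      using p unfolding gderiv_def
      by (auto intro!: continuous_at_imp_continuous_on has_derivative_continuous)
    have [measurable]: "p \<in> borel_measurable borel" "a \<in> borel_measurable borel"
      using contp conta by (auto intro: borel_measurable_continuous_onI)
    have intP: "integrable lborel (\<lambda>x. ?I x * P x)"
      by (rule integrable_bounded_cball[OF _ bound]) simp
    have intp: "integrable lborel (\<lambda>x. ?I x * p x)"
      using integrable_on_cball[OF contp, of R] by simp
    have intpP: "integrable lborel (\<lambda>x. ?I x * \<bar>p x - P x\<bar>)"
    proof -
      have "integrable lborel (\<lambda>x. \<bar>?I x * p x - ?I x * P x\<bar>)" using intp intP by auto
      then show ?thesis by (simp add: right_diff_distrib[symmetric] abs_mult)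
    qed
    have inta2: "integrable lborel (\<lambda>x. ?I x * (norm (a x))\<^sup>2)"
      using integrable_on_cball[OF continuous_on_power[OF continuous_on_norm[OF conta]], of R 2] by simp
    have inta: "integrable lborel (\<lambda>x. ?I x * norm (a x))"
      using integrable_on_cball[OF continuous_on_norm[OF conta], of R] by simp
    have intpD: "integrable lborel (\<lambda>x. p x * (D x \<bullet> b))"
      by (rule integrable_if_compact_support[of _ R]) (auto intro!: continuous_intros contp contD simp: supp)
    have inta\<psi>: "integrable lborel (\<lambda>x. \<psi> x * (a x \<bullet> b))"
      by (rule integrable_if_compact_support[of _ R]) (auto intro!: continuous_intros cont\<psi> conta simp: supp)
    have Db: "\<bar>D x \<bullet> b\<bar> \<le> C2 * norm b" for x
      using Cauchy_Schwarz_ineq2[of "D x" b] mult_right_mono[OF C2(2)[of x], of "norm b"] by simp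
    have intPD: "integrable lborel (\<lambda>x. P x * (D x \<bullet> b))"
    proof -
      have "integrable lborel (\<lambda>x. ?I x * (P x * (D x \<bullet> b)))"
      proof (rule integrable_bounded_cball)
        show "\<bar>P x * (D x \<bullet> b)\<bar> \<le> 1 * (C2 * norm b)" for x
          unfolding abs_mult by (intro mult_mono bound Db) auto
      qed simp
      also have "(\<lambda>x. ?I x * (P x * (D x \<bullet> b))) = (\<lambda>x. P x * (D x \<bullet> b))"
        using supp by (auto simp: fun_eq_iff split: split_indicator)
      finally show ?thesis .
    qed
    have ibp: "(LBINT x. p x * (D x \<bullet> b)) = - (LBINT x. \<psi> x * (a x \<bullet> b))"
    proof -
      have "(LBINT x. (p x *\<^sub>R D x + \<psi> x *\<^sub>R a x) \<bullet> b) = 0"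
      proof (rule integral_directional_derivative_zero)
        show "GDERIV (\<lambda>x. p x * \<psi> x) x :> p x *\<^sub>R D x + \<psi> x *\<^sub>R a x" for x
          by (rule GDERIV_mult[OF p D])
        show "continuous_on UNIV (\<lambda>x. p x *\<^sub>R D x + \<psi> x *\<^sub>R a x)"
          by (intro continuous_intros contp contD conta cont\<psi>)
      qed (use supp in auto)
      then show ?thesis using intpD inta\<psi> by (simp add: inner_add_left)
    qed
    have 1: "\<bar>\<integral>x. \<psi> x * (a x \<bullet> b) \<partial>lborel\<bar> \<le> C1 * norm b * (s * (1 + V))"
    proof -
      have "\<bar>\<integral>x. \<psi> x * (a x \<bullet> b) \<partial>lborel\<bar> \<le> (LBINT x. C1 * norm b * (?I x * (norm (a x))\<^sup>2 / s + s * ?I x))"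
      proof (rule order_trans[OF integral_abs_bound], rule integral_mono)
        fix x
        show "\<bar>\<psi> x * (a x \<bullet> b)\<bar> \<le> C1 * norm b * (?I x * (norm (a x))\<^sup>2 / s + s * ?I x)"
        proof (cases "norm x \<le> R")
          case True
          have "norm (a x) * s \<le> (norm (a x))\<^sup>2 + s * s"
          proof -
            have "0 \<le> norm (a x) * s" using s by simp
            moreover have "2 * (norm (a x) * s) \<le> (norm (a x))\<^sup>2 + s * s"
              using sum_squares_bound[of "norm (a x)" s] by (simp add: power2_eq_square mult.assoc)
            ultimately show ?thesis by linarith
          qed
          then have as: "norm (a x) \<le> (norm (a x))\<^sup>2 / s + s"
            using s by (simp add: field_simps)
          have "\<bar>\<psi> x * (a x \<bullet> b)\<bar> \<le> C1 * (norm (a x) * norm b)"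
            unfolding abs_mult using C1 by (intro mult_mono Cauchy_Schwarz_ineq2) auto
          also have "\<dots> \<le> C1 * (((norm (a x))\<^sup>2 / s + s) * norm b)"
            using C1 as by (intro mult_left_mono mult_right_mono) auto
          finally show ?thesis using True by (simp add: mult_ac)
        next
          case False
          then show ?thesis using supp by simp
        qed
      qed (intro integrable_abs inta\<psi> integrable_mult_right Bochner_Integration.integrable_add
          integrable_divide inta2 integrable_indicator_cball)+
      also have "\<dots> = C1 * norm b * ((LBINT x. ?I x * (norm (a x))\<^sup>2) / s + s * V)"
      proof -
        have "(LBINT x. ?I x * (norm (a x))\<^sup>2 / s + s * ?I x)
            = (LBINT x. ?I x * (norm (a x))\<^sup>2 / s) + (LBINT x. s * ?I x)"
          by (intro Bochner_Integration.integral_add integrable_mult_right integrable_divide inta2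
              integrable_indicator_cball)
        then show ?thesis using IV by simp
      qed
      also have "\<dots> \<le> C1 * norm b * (s\<^sup>2 / s + s * V)"
        using C1 a2 s by (intro mult_left_mono add_right_mono divide_right_mono) auto
      finally show ?thesis using s by (simp add: power2_eq_square algebra_simps)
    qed
    have 2: "\<bar>(LBINT x. p x * (D x \<bullet> b)) - (LBINT x. P x * (D x \<bullet> b))\<bar> \<le> C2 * norm b * s"
    proof -
      have "\<bar>(LBINT x. p x * (D x \<bullet> b)) - (LBINT x. P x * (D x \<bullet> b))\<bar>
          = \<bar>\<integral>x. (p x - P x) * (D x \<bullet> b) \<partial>lborel\<bar>"
        using intpD intPD by (simp add: left_diff_distrib)
      also have "\<dots> \<le> (LBINT x. (?I x * \<bar>p x - P x\<bar>) * (C2 * norm b))"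
      proof (rule order_trans[OF integral_abs_bound], rule integral_mono)
        show "integrable lborel (\<lambda>x. \<bar>(p x - P x) * (D x \<bullet> b)\<bar>)"
          using intpD intPD by (auto simp: left_diff_distrib)
        fix x
        show "\<bar>(p x - P x) * (D x \<bullet> b)\<bar> \<le> (?I x * \<bar>p x - P x\<bar>) * (C2 * norm b)"
          using supp(2)[of x] Db[of x] by (cases "norm x \<le> R") (auto simp: abs_mult intro: mult_left_mono)
      qed (use intpP in auto)
      also have "\<dots> \<le> s\<^sup>2 * (C2 * norm b)"
        using pP C2 by (simp add: mult_right_mono)
      also have "\<dots> \<le> s * (C2 * norm b)"
        using s C2 by (intro mult_right_mono) (auto simp: power2_eq_square mult_left_le_one_le)
      finally show ?thesis by (simp add: mult_ac)
    qed
    have "K * s = C1 * norm b * (s * (1 + V)) + C2 * norm b * s"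
      by (simp add: K_def algebra_simps)
    then show ?thesis using 1 2 unfolding ibp by linarith
  qed
  have "\<bar>\<integral>x. P x * (D x \<bullet> b) \<partial>lborel\<bar> \<le> 0"
  proof (rule tendsto_lowerbound[of "\<lambda>s. K * s" _ "at_right 0"])
    have "((\<lambda>s. K * s) \<longlongrightarrow> K * 0) (at_right 0)" by (intro tendsto_intros)
    then show "((\<lambda>s. K * s) \<longlongrightarrow> 0) (at_right 0)" by simp
    show "\<forall>\<^sub>F s in at_right 0. \<bar>\<integral>x. P x * (D x \<bullet> b) \<partial>lborel\<bar> \<le> K * s"
      by (rule eventually_at_rightI[of 0 1]) (use main in auto)
  qed simp
  then show "(LBINT x. P x * (D x \<bullet> b)) = 0" by simp
qed auto

subsection \<open>Cutoff functions\<close>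

lemma max_0_square_has_derivative: "((\<lambda>t::real. (max 0 t)\<^sup>2) has_real_derivative 2 * max 0 t) (at t)"
proof -
  consider "t > 0" | "t < 0" | "t = 0" by linarith
  then show ?thesis
  proof cases
    case 1
    have "((\<lambda>s. s\<^sup>2) has_real_derivative 2 * max 0 t) (at t)"
      using 1 by (auto intro!: derivative_eq_intros)
    then show ?thesis
      by (rule has_field_derivative_transform_within_open[of _ _ _ "{0<..}"]) (use 1 in auto)
  next
    case 2
    have "((\<lambda>s. 0) has_real_derivative 2 * max 0 t) (at t)"
      using 2 by (auto intro!: derivative_eq_intros)
    then show ?thesis
      by (rule has_field_derivative_transform_within_open[of _ _ _ "{..<0}"]) (use 2 in auto)
  next
    case 3
    have "((\<lambda>h::real. max 0 h) \<longlongrightarrow> max 0 0) (at 0)" by (intro tendsto_intros)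
    moreover have "(max 0 h)\<^sup>2 / h = max 0 h" for h :: real
      by (cases "h > 0") (auto simp: power2_eq_square)
    ultimately show ?thesis using 3 by (simp add: DERIV_def)
  qed
qed

text \<open>The cutoff is \<open>m(1 - m(|x|\<^sup>2/R\<^sup>2 - 1))\<close> with \<open>m(t) = max(0, t)\<^sup>2\<close>, which is continuously differentiable;
  it already vanishes for \<open>|x|\<^sup>2 \<ge> 2 R\<^sup>2\<close>. What matters is that the bound on its gradient does not depend on \<open>R\<close>.\<close>

lemma cutoff_exists:
  fixes R :: real
  assumes "R \<ge> 1"
  obtains \<eta> :: "'a::euclidean_space \<Rightarrow> real" and D where
    "\<And>x. GDERIV \<eta> x :> D x" and "continuous_on UNIV D"
    and "\<And>x. 0 \<le> \<eta> x" and "\<And>x. \<eta> x \<le> 1"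
    and "\<And>x. norm x \<le> R \<Longrightarrow> \<eta> x = 1" and "\<And>x. norm x \<le> R \<Longrightarrow> D x = 0"
    and "\<And>x. norm x \<ge> 2 * R \<Longrightarrow> \<eta> x = 0" and "\<And>x. norm x \<ge> 2 * R \<Longrightarrow> D x = 0"
    and "\<And>x. norm (D x) \<le> 16"
proof -
  define q :: "'a \<Rightarrow> real" where "q x = x \<bullet> x / R\<^sup>2 - 1" for x
  define v where "v x = max 0 (q x)" for x
  define u where "u x = max 0 (1 - (v x)\<^sup>2)" for x
  define \<eta> where "\<eta> x = (u x)\<^sup>2" for x
  define D where "D x = (- 8 / R\<^sup>2 * u x * v x) *\<^sub>R x" for x
  have contq: "continuous_on UNIV q" unfolding q_def using assms by (intro continuous_intros) auto
  have gq: "GDERIV q x :> (2 / R\<^sup>2) *\<^sub>R x" for x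
    unfolding gderiv_def q_def using assms by (auto intro!: derivative_eq_intros simp: inner_commute field_simps)
  have gv: "GDERIV (\<lambda>x. 1 - (v x)\<^sup>2) x :> 0 - (2 * v x) *\<^sub>R (2 / R\<^sup>2) *\<^sub>R x" for x
    unfolding v_def by (intro GDERIV_diff GDERIV_const GDERIV_DERIV_compose[OF gq max_0_square_has_derivative])
  have "GDERIV \<eta> x :> (2 * u x) *\<^sub>R (0 - (2 * v x) *\<^sub>R (2 / R\<^sup>2) *\<^sub>R x)" for x
    unfolding \<eta>_def u_def by (intro GDERIV_DERIV_compose[OF gv max_0_square_has_derivative])
  then have 1: "GDERIV \<eta> x :> D x" for x by (simp add: D_def mult_ac)
  have 2: "continuous_on UNIV D" unfolding D_def u_def v_def by (intro continuous_intros contq)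
  have u: "0 \<le> u x" "u x \<le> 1" for x by (auto simp: u_def)
  have in0: "v x = 0" if "norm x \<le> R" for x
    using power_mono[OF that, of 2] assms by (auto simp: v_def q_def power2_norm_eq_inner field_simps)
  have out0: "u x = 0" if "norm x \<ge> 2 * R" for x
  proof -
    have "(2 * R)\<^sup>2 \<le> x \<bullet> x" using power_mono[OF that, of 2] assms by (simp add: power2_norm_eq_inner)
    then have "2 * R\<^sup>2 \<le> x \<bullet> x"
    proof -
      have "4 * R\<^sup>2 \<le> x \<bullet> x" using \<open>(2 * R)\<^sup>2 \<le> x \<bullet> x\<close> by (simp add: power_mult_distrib)
      then show ?thesis using zero_le_power2[of R] by linarith
    qed
    then have "q x \<ge> 1" using assms by (simp add: q_def field_simps)
    then have "v x \<ge> 1" by (simp add: v_def)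
    then have "(v x)\<^sup>2 \<ge> 1" by simp
    then show ?thesis by (simp add: u_def)
  qed
  have 9: "norm (D x) \<le> 16" for x
  proof (cases "u x = 0 \<or> v x = 0")
    case False
    then have "norm x \<le> 2 * R" using out0[of x] by linarith
    have "(v x)\<^sup>2 < 1" using False unfolding u_def by linarith
    then have "v x < 1" using power2_less_imp_less[of "v x" 1] by simp
    then have v: "0 \<le> v x" "v x \<le> 1" by (auto simp: v_def)
    have "norm (D x) = 8 / R\<^sup>2 * (u x * v x) * norm x"
      using u[of x] v by (simp add: D_def abs_mult)
    also have "\<dots> \<le> 8 / R\<^sup>2 * (1 * 1) * (2 * R)"
      using u v \<open>norm x \<le> 2 * R\<close> by (intro mult_mono) auto
    also have "\<dots> = 16 / R" using assms by (simp add: power2_eq_square)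
    also have "\<dots> \<le> 16" using assms by (simp add: field_simps)
    finally show ?thesis .
  qed (auto simp: D_def)
  show thesis
  proof (rule that[of \<eta> D])
    show "norm x \<le> R \<Longrightarrow> \<eta> x = 1" "norm x \<le> R \<Longrightarrow> D x = 0" for x using in0[of x] by (auto simp: \<eta>_def u_def D_def)
    show "norm x \<ge> 2 * R \<Longrightarrow> \<eta> x = 0" "norm x \<ge> 2 * R \<Longrightarrow> D x = 0" for x using out0[of x] by (auto simp: \<eta>_def D_def)
    show "0 \<le> \<eta> x" "\<eta> x \<le> 1" for x using u[of x] by (auto simp: \<eta>_def power_le_one)
  qed (use 1 2 9 in auto)
qed

section \<open>The logarithmic potential of a density\<close>

lemma power_powr: "(x::real) > 0 \<Longrightarrow> (x ^ n) powr a = (x powr a) ^ n"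
  by (induction n) (simp_all add: powr_mult)

text \<open>Dyadic shells: where \<open>2^-(k+1) < |z| \<le> 2^-k\<close> the integrand is at most \<open>\<alpha>^(k+1)\<close> with \<open>\<alpha> = 2^(15/8)\<close>,
  while the ball of radius \<open>2^-k\<close> has volume at most a constant times \<open>4^-k\<close>, as \<open>d \<ge> 2\<close>. The bounds
  form a geometric series with ratio \<open>\<alpha>/4 < 1\<close>.\<close>

lemma riesz_kernel_locally_integrable:
  assumes dim: "DIM('a::euclidean_space) \<ge> 2"
  shows "(\<integral>\<^sup>+z. ennreal (indicator (cball 0 1) z * norm (z::'a) powr (- (15/8))) \<partial>lborel) < \<infinity>"
proof -
  define \<alpha> :: real where "\<alpha> = (1/2) powr (- (15/8))"
  have \<alpha>: "\<alpha> > 0" "\<alpha> < 4"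
  proof -
    have "\<alpha> = 2 powr (15/8)" by (simp add: \<alpha>_def powr_minus powr_divide)
    also have "\<dots> < 2 powr 2" by (intro powr_less_mono) auto
    finally show "\<alpha> < 4" by simp
  qed (simp add: \<alpha>_def)
  define \<omega> where "\<omega> = unit_ball_vol (real DIM('a))"
  have \<omega>: "\<omega> \<ge> 0" by (simp add: \<omega>_def)
  have pt: "ennreal (indicator (cball 0 1) z * norm z powr (- (15/8)))
      \<le> (\<Sum>k. ennreal (\<alpha> ^ Suc k) * indicator (cball 0 ((1/2) ^ k)) z)" for z :: 'a
  proof (cases "z \<noteq> 0 \<and> norm z \<le> 1")
    case True
    obtain n :: nat where n: "(1/2) ^ n < norm z"
      using real_arch_pow_inv[of "norm z" "1/2"] True by auto
    define m where "m = (LEAST n. (1/2::real) ^ n < norm z)"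
    have m: "(1/2) ^ m < norm z" unfolding m_def using n by (rule LeastI)
    have "m \<noteq> 0" using m True by (intro notI) auto
    then obtain k where k: "m = Suc k" by (cases m) auto
    have "\<not> (1/2::real) ^ k < norm z"
      using not_less_Least[of k "\<lambda>n. (1/2::real) ^ n < norm z"] k by (simp add: m_def[symmetric])
    then have le: "norm z \<le> (1/2) ^ k" by simp
    have "norm z powr (- (15/8)) \<le> ((1/2) ^ Suc k) powr (- (15/8))"
      using m k by (intro powr_mono2') auto
    also have "\<dots> = \<alpha> ^ Suc k" unfolding \<alpha>_def by (rule power_powr) simp
    finally have "ennreal (indicator (cball 0 1) z * norm z powr (- (15/8)))
        \<le> ennreal (\<alpha> ^ Suc k) * indicator (cball 0 ((1/2) ^ k)) z"
      using True le by (simp add: ennreal_leI)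
    also have "\<dots> = (\<Sum>j\<in>{k}. ennreal (\<alpha> ^ Suc j) * indicator (cball 0 ((1/2) ^ j)) z)"
      by (simp only: sum.insert[OF finite.emptyI empty_iff[THEN iffD1, THEN notI]] sum.empty add_0_right)
    also have "\<dots> \<le> (\<Sum>j. ennreal (\<alpha> ^ Suc j) * indicator (cball 0 ((1/2) ^ j)) z)"
      by (intro sum_le_suminf) auto
    finally show ?thesis .
  qed auto
  have "(\<integral>\<^sup>+z. ennreal (indicator (cball 0 1) z * norm (z::'a) powr (- (15/8))) \<partial>lborel)
      \<le> (\<integral>\<^sup>+z. (\<Sum>k. ennreal (\<alpha> ^ Suc k) * indicator (cball 0 ((1/2) ^ k)) (z::'a)) \<partial>lborel)"
    by (intro nn_integral_mono pt)
  also have "\<dots> = (\<Sum>k. \<integral>\<^sup>+z. ennreal (\<alpha> ^ Suc k) * indicator (cball 0 ((1/2) ^ k)) (z::'a) \<partial>lborel)"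
    by (intro nn_integral_suminf borel_measurable_times_ennreal borel_measurable_indicator) auto
  also have "\<dots> = (\<Sum>k. ennreal (\<alpha> ^ Suc k) * ennreal (\<omega> * ((1/2) ^ k) ^ DIM('a)))"
    by (intro suminf_cong) (simp add: nn_integral_cmult_indicator emeasure_cball \<omega>_def
        del: power_Suc nn_integral_cmult)
  also have "\<dots> \<le> (\<Sum>k. ennreal (\<alpha> * \<omega> * (\<alpha> / 4) ^ k))"
  proof (intro suminf_le allI)
    fix k
    have "((1/2::real) ^ k) ^ DIM('a) \<le> ((1/2) ^ k)\<^sup>2"
      using dim by (intro power_decreasing) (auto simp: power_le_one)
    also have "\<dots> = (1/4) ^ k" by (simp add: power_mult[symmetric] mult.commute[of k] power_mult power_one_over)
    finally have "\<alpha> ^ Suc k * (\<omega> * ((1/2) ^ k) ^ DIM('a)) \<le> \<alpha> ^ Suc k * (\<omega> * (1/4) ^ k)"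
      using \<alpha> \<omega> by (intro mult_left_mono) auto
    also have "\<dots> = \<alpha> * \<omega> * (\<alpha> / 4) ^ k" by (simp add: power_divide)
    finally show "ennreal (\<alpha> ^ Suc k) * ennreal (\<omega> * ((1/2) ^ k) ^ DIM('a)) \<le> ennreal (\<alpha> * \<omega> * (\<alpha> / 4) ^ k)"
      using \<alpha> \<omega> by (subst ennreal_mult[symmetric]) (auto intro: ennreal_leI)
  qed auto
  also have "\<dots> = ennreal (\<Sum>k. \<alpha> * \<omega> * (\<alpha> / 4) ^ k)"
    using \<alpha> \<omega> by (intro suminf_ennreal2 summable_mult summable_geometric) auto
  finally show ?thesis by (simp add: le_less_trans ennreal_less_top)
qed

text \<open>A single singular kernel dominates everything that occurs below. The exponent \<open>3/2\<close> exceeds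
  the order 1 of the gradient of the logarithm, which leaves a positive power of the regularisation
  parameter \<open>\<delta>\<close> to spare; and the conjugate pair \<open>5/4\<close>, \<open>5\<close> turns it into the exponent
  \<open>3/2 * 5/4 = 15/8 < 2 \<le> d\<close>, which is locally integrable.\<close>

abbreviation riesz :: "'a::real_normed_vector \<Rightarrow> real" where
  "riesz z \<equiv> norm z powr (- (3/2))"

text \<open>Near the singularity this is Young's inequality for the exponents \<open>5/4\<close> and \<open>5\<close>, by comparing \<open>u\<close> with
  \<open>t = |z|^(-3/8)\<close>; elsewhere the kernel is at most 1.\<close>

lemma riesz_young:
  fixes z :: "'a::euclidean_space"
  assumes "u \<ge> 0"
  shows "u * riesz z \<le> indicator (cball 0 1) z * norm z powr (- (15/8)) + u ^ 5 + u"
proof (cases "norm z \<le> 1")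
  case True
  show ?thesis
  proof (cases "z = 0")
    case False
    define t where "t = norm z powr (- (3/8))"
    have t: "t > 0" using False by (simp add: t_def)
    have a: "riesz z = t ^ 4" "norm z powr (- (15/8)) = t ^ 5"
      using False by (simp_all add: t_def powr_power)
    have "u * t ^ 4 \<le> t ^ 5 + u ^ 5"
    proof (cases "u \<le> t")
      case True
      then have "u * t ^ 4 \<le> t * t ^ 4" using t by (intro mult_right_mono) auto
      moreover have "u ^ 5 \<ge> 0" using assms by simp
      ultimately show ?thesis by (simp add: power_eq_if)
    next
      case False
      then have "t ^ 4 \<le> u ^ 4" using t by (intro power_mono) auto
      then have "u * t ^ 4 \<le> u * u ^ 4" using assms by (intro mult_left_mono) auto
      moreover have "t ^ 5 \<ge> 0" using t by simp
      ultimately show ?thesis by (simp add: power_eq_if)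
    qed
    then show ?thesis using True assms unfolding a by simp
  qed (use assms in auto)
next
  case False
  then have "riesz z \<le> norm z powr 0" by (intro powr_mono) auto
  moreover have "norm z powr 0 = 1" using False by auto
  ultimately have "riesz z \<le> 1" by simp
  then have "u * riesz z \<le> u * 1" using False assms by (intro mult_left_mono) auto
  moreover have "u ^ 5 \<ge> 0" using assms by simp
  moreover have "indicator (cball 0 1) z = (0::real)" using False by simp
  ultimately show ?thesis by (simp only: mult_zero_left)
qed

lemma inverse_norm_le_riesz: "inverse (norm z) \<le> riesz z + 1"
proof (cases "norm z < 1")
  case True
  show ?thesis
  proof (cases "norm z = 0")
    case False
    have "norm z powr (- 1) \<le> riesz z" using True False by (intro powr_mono') auto
    moreover have "norm z powr (- 1) = inverse (norm z)" using False by (simp add: powr_minus)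
    ultimately show ?thesis by linarith
  qed simp
next
  case False
  then have "inverse (norm z) \<le> 1" by (intro inverse_le_1_iff[THEN iffD2]) auto
  then show ?thesis by (simp add: add_increasing)
qed

lemma ln_norm_ge: "- ln (norm z) \<le> riesz z"
proof (cases "norm z < 1 \<and> z \<noteq> 0")
  case True
  have "- ln (norm z) = ln (inverse (norm z))" using True by (simp add: ln_inverse)
  also have "\<dots> \<le> inverse (norm z) - 1" using True by (intro ln_le_minus_one) auto
  also have "\<dots> \<le> riesz z" using inverse_norm_le_riesz[of z] by simp
  finally show ?thesis .
next
  case False
  then have "ln (norm z) \<ge> 0" by (cases "z = 0") auto
  moreover have "0 \<le> riesz z" by simp
  ultimately show ?thesis by linarith
qed

text \<open>The regularised logarithm, equal to \<open>ln |z|\<close> for \<open>\<delta> = 0\<close>; there the convention \<open>ln 0 = 0\<close>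
  makes the agreement hold at the origin, too.\<close>

definition log_reg :: "real \<Rightarrow> 'a::euclidean_space \<Rightarrow> real" where
  "log_reg \<delta> z = ln (z \<bullet> z + \<delta>) / 2"

lemma log_reg_0: "log_reg 0 z = ln (norm z)"
proof (cases "z = 0")
  case False
  then have "ln (z \<bullet> z) = ln (norm z * norm z)" by (simp add: power2_norm_eq_inner[symmetric] power2_eq_square)
  then show ?thesis using False by (simp add: log_reg_def ln_mult)
qed (simp add: log_reg_def)

lemma log_reg_measurable [measurable]: "log_reg \<delta> \<in> borel_measurable borel"
  unfolding log_reg_def[abs_def] by measurable

lemma log_reg_mono:
  assumes "\<delta> \<ge> 0" "z \<noteq> 0" shows "log_reg 0 z \<le> log_reg \<delta> z"
proof -
  have "z \<bullet> z > 0" using assms by simp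
  then show ?thesis using assms(1) unfolding log_reg_def by (intro divide_right_mono) (auto simp del: inner_gt_zero_iff)
qed

lemma log_reg_diff_le:
  assumes "\<delta> \<ge> 0" "z \<noteq> 0"
  shows "log_reg \<delta> z - log_reg 0 z \<le> sqrt \<delta> * (riesz z + 1)"
proof -
  define s where "s = sqrt \<delta> / norm z"
  have s: "s \<ge> 0" using assms by (simp add: s_def)
  have "s\<^sup>2 = \<delta> / (z \<bullet> z)" using assms by (simp add: s_def power_divide power2_norm_eq_inner)
  then have "z \<bullet> z + \<delta> = (z \<bullet> z) * (1 + s\<^sup>2)" using assms by (simp add: field_simps)
  then have "log_reg \<delta> z - log_reg 0 z = ln (1 + s\<^sup>2) / 2"
  proof -
    have "1 + s\<^sup>2 > 0" by (simp add: add_pos_nonneg)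
    moreover have "z \<bullet> z > 0" using assms by simp
    ultimately have "ln (z \<bullet> z * (1 + s\<^sup>2)) = ln (z \<bullet> z) + ln (1 + s\<^sup>2)" by (rule ln_mult_pos[rotated])
    then have "ln (z \<bullet> z + \<delta>) = ln (z \<bullet> z) + ln (1 + s\<^sup>2)" using \<open>z \<bullet> z + \<delta> = _\<close> by (simp only:)
    then show ?thesis
      unfolding log_reg_def by (simp only: add_0_right add_divide_distrib add_diff_cancel_left')
  qed
  also have "\<dots> \<le> ln ((1 + s)\<^sup>2) / 2"
    using s by (intro divide_right_mono) (auto simp: power2_eq_square algebra_simps add_pos_nonneg)
  also have "\<dots> = ln (1 + s)" using s by (simp add: ln_realpow)
  also have "\<dots> \<le> s" using s by (rule ln_add_one_self_le_self)
  also have "\<dots> = sqrt \<delta> * inverse (norm z)" by (simp add: s_def divide_inverse)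
  also have "\<dots> \<le> sqrt \<delta> * (riesz z + 1)"
    using assms by (intro mult_left_mono inverse_norm_le_riesz) auto
  finally show ?thesis .
qed

lemma log_reg_le_norm:
  assumes "0 \<le> \<delta>" "\<delta> \<le> 1" shows "log_reg \<delta> z \<le> norm z"
proof (cases "z \<bullet> z + \<delta> = 0")
  case False
  then have "z \<bullet> z + \<delta> > 0" using assms by (simp add: order_le_neq_trans)
  then have "log_reg \<delta> z \<le> ln ((1 + norm z)\<^sup>2) / 2"
  proof -
    have "z \<bullet> z + \<delta> \<le> (1 + norm z)\<^sup>2"
      unfolding power2_norm_eq_inner[symmetric] power2_sum using assms add_increasing2[OF norm_ge_zero[of z] order_refl[of 1]] by (simp add: add_increasing2)
    then show ?thesis
      using \<open>z \<bullet> z + \<delta> > 0\<close> unfolding log_reg_def by (intro divide_right_mono ln_mono) auto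
  qed
  also have "\<dots> = ln (1 + norm z)" by (simp add: ln_realpow add_pos_nonneg)
  also have "\<dots> \<le> norm z" by (rule ln_add_one_self_le_self) simp
  finally show ?thesis .
qed (simp add: log_reg_def)

definition grad_log_reg :: "real \<Rightarrow> 'a::euclidean_space \<Rightarrow> 'a" where
  "grad_log_reg \<delta> z = z /\<^sub>R (z \<bullet> z + \<delta>)"

lemma grad_log_reg_measurable [measurable]: "grad_log_reg \<delta> \<in> borel_measurable borel"
  unfolding grad_log_reg_def[abs_def] by measurable

lemma GDERIV_log_reg:
  assumes "\<delta> > 0" shows "GDERIV (log_reg \<delta>) z :> grad_log_reg \<delta> z"
proof -
  have pos: "z \<bullet> z + \<delta> > 0" using assms by (simp add: add_nonneg_pos)
  have "GDERIV (\<lambda>z. z \<bullet> z + \<delta>) z :> 2 *\<^sub>R z"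
    unfolding gderiv_def by (auto intro!: derivative_eq_intros simp: inner_commute)
  moreover have "((\<lambda>t. ln t / 2) has_real_derivative inverse (z \<bullet> z + \<delta>) / 2) (at (z \<bullet> z + \<delta>))"
    by (rule DERIV_cdivide[OF DERIV_ln[OF pos]])
  ultimately have "GDERIV (\<lambda>z. ln (z \<bullet> z + \<delta>) / 2) z :> (inverse (z \<bullet> z + \<delta>) / 2) *\<^sub>R 2 *\<^sub>R z"
    by (rule GDERIV_DERIV_compose)
  then show ?thesis by (simp add: grad_log_reg_def log_reg_def[abs_def])
qed

lemma continuous_on_grad_log_reg:
  assumes "\<delta> > 0" shows "continuous_on UNIV (grad_log_reg \<delta> :: 'a::euclidean_space \<Rightarrow> 'a)"
proof -
  have "z \<bullet> z + \<delta> \<noteq> 0" for z :: 'a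
    using assms inner_ge_zero[of z] by linarith
  then show ?thesis unfolding grad_log_reg_def[abs_def] by (intro continuous_intros) auto
qed

lemma norm_grad_log_reg_le:
  assumes "\<delta> > 0" shows "norm (grad_log_reg \<delta> z) \<le> 1 + 1 / \<delta>"
proof -
  have pos: "z \<bullet> z + \<delta> > 0" using assms by (simp add: add_nonneg_pos)
  have "norm z \<le> 1 + z \<bullet> z"
  proof -
    have "2 * norm z \<le> (norm z)\<^sup>2 + 1" using sum_squares_bound[of "norm z" 1] by simp
    then show ?thesis using norm_ge_zero[of z] unfolding power2_norm_eq_inner[symmetric] by linarith
  qed
  also have "\<dots> \<le> (1 + 1 / \<delta>) * (z \<bullet> z + \<delta>)"
    using assms by (simp add: field_simps)
  finally show ?thesis using pos by (simp add: grad_log_reg_def pos_divide_le_eq inverse_eq_divide)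
qed

lemma norm_grad_log_reg_0: "norm (grad_log_reg 0 z) = inverse (norm z)"
proof (cases "z = 0")
  case False
  have "norm (grad_log_reg 0 z) = inverse (norm z * norm z) * norm z"
    by (simp add: grad_log_reg_def power2_eq_square[symmetric] power2_norm_eq_inner)
  then show ?thesis using False by simp
qed (simp add: grad_log_reg_def)

lemma inverse_square_shift:
  fixes n T d :: real
  assumes n: "n > 0" and T: "T > 0" and d: "d = T * n\<^sup>2"
  shows "\<bar>inverse (n\<^sup>2 + d) - inverse (n\<^sup>2)\<bar> * n = T / (1 + T) * inverse n"
proof -
  from T have T1: "1 + T > 0" by linarith
  have d': "n\<^sup>2 + d = n\<^sup>2 * (1 + T)" unfolding d by (simp add: algebra_simps)
  have "inverse (n\<^sup>2) - inverse (n\<^sup>2 + d) = inverse (n\<^sup>2) * (1 - inverse (1 + T))"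
    unfolding d' by (simp add: right_diff_distrib)
  also have "1 - inverse (1 + T) = T / (1 + T)" using T1 by (simp add: divide_simps)
  finally have *: "inverse (n\<^sup>2) - inverse (n\<^sup>2 + d) = inverse (n\<^sup>2) * (T / (1 + T))" .
  have "inverse (n\<^sup>2) * (T / (1 + T)) \<ge> 0" using T T1 by simp
  then have **: "\<bar>inverse (n\<^sup>2 + d) - inverse (n\<^sup>2)\<bar> = inverse (n\<^sup>2) * (T / (1 + T))"
    unfolding abs_minus_commute[of "inverse (n\<^sup>2 + d)"] * by (rule abs_of_nonneg)
  have "inverse (n\<^sup>2) * n = inverse n" using n by (simp add: power2_eq_square)
  then show ?thesis unfolding ** by (metis mult.commute mult.left_commute)
qed

lemma fourth_power_le: 
  fixes t :: real
  assumes "t > 0" shows "t ^ 4 / (1 + t ^ 4) \<le> t"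
proof -
  have "t ^ 4 \<le> t * (1 + t ^ 4)"
  proof (cases "t \<le> 1")
    case True
    have "t ^ 4 \<le> t ^ 1" using assms True by (intro power_decreasing) auto
    also have "\<dots> = t * 1" by simp
    also have "\<dots> \<le> t * (1 + t ^ 4)" using assms by (intro mult_left_mono) auto
    finally show ?thesis .
  next
    case False
    have "t ^ 4 = 1 * t ^ 4" by simp
    also have "\<dots> \<le> t * (1 + t ^ 4)" using assms False by (intro mult_mono) auto
    finally show ?thesis .
  qed
  then show ?thesis using assms by (simp add: pos_divide_le_eq add_pos_pos)
qed

text \<open>With \<open>t^4 = \<delta> / |z|\<^sup>2\<close> the difference has norm \<open>t^4 / (1 + t^4) / |z|\<close>, and \<open>t^4 / (1 + t^4) \<le> t\<close>.\<close>

lemma grad_log_reg_diff_le: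
  assumes "\<delta> \<ge> 0"
  shows "norm (grad_log_reg \<delta> z - grad_log_reg 0 z) \<le> \<delta> powr (1/4) * riesz z"
proof (cases "z = 0 \<or> \<delta> = 0")
  case False
  then have z: "norm z > 0" and d: "\<delta> > 0" using assms by auto
  define t where "t = \<delta> powr (1/4) / norm z powr (1/2)"
  have t: "t > 0" using z d by (simp add: t_def)
  have t4: "t ^ 4 = \<delta> / (norm z)\<^sup>2"
    using z d by (simp add: t_def power_divide powr_power)
  have "grad_log_reg \<delta> z - grad_log_reg 0 z = (inverse (z \<bullet> z + \<delta>) - inverse (z \<bullet> z)) *\<^sub>R z"
    by (simp add: grad_log_reg_def scaleR_left_diff_distrib)
  also have "norm \<dots> = \<bar>inverse ((norm z)\<^sup>2 + \<delta>) - inverse ((norm z)\<^sup>2)\<bar> * norm z"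
    by (simp add: power2_norm_eq_inner)
  also have "\<dots> = t ^ 4 / (1 + t ^ 4) * inverse (norm z)"
  proof (rule inverse_square_shift[OF z])
    show "0 < t ^ 4" using t by simp
    show "\<delta> = t ^ 4 * (norm z)\<^sup>2" unfolding t4 using z by simp
  qed
  also have "\<dots> \<le> t * inverse (norm z)"
    using z t by (intro mult_right_mono fourth_power_le) auto
  also have "\<dots> = \<delta> powr (1/4) * (norm z powr (- (1/2)) * norm z powr (- 1))"
  proof -
    have "norm z powr (- (1/2)) = inverse (norm z powr (1/2))" "norm z powr (- 1) = inverse (norm z)"
      using z by (simp_all add: powr_minus)
    then show ?thesis unfolding t_def by (simp only: divide_inverse mult.assoc)
  qed
  also have "norm z powr (- (1/2)) * norm z powr (- 1) = norm z powr (- (1/2) + (- 1))"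
    by (rule powr_add[symmetric])
  also have "- (1/2) + (- 1) = - (3/2 :: real)" by simp
  finally show ?thesis .
qed (auto simp: grad_log_reg_def)

text \<open>The fifth power enters through Young's inequality in \<open>riesz_young\<close>, the second moment through the
  logarithm and the drift at infinity.\<close>

locale density =
  fixes U :: "'a::euclidean_space \<Rightarrow> real"
  assumes dim: "DIM('a) \<ge> 2"
    and measurable_U [measurable]: "U \<in> borel_measurable borel"
    and U_nonneg: "U x \<ge> 0"
    and integrable_U: "integrable lborel U"
    and integrable_U5: "integrable lborel (\<lambda>x. U x ^ 5)"
    and integrable_second_moment: "integrable lborel (\<lambda>x. (norm x)\<^sup>2 * U x)"
begin

definition mass :: real where "mass = (LBINT y. U y)"

definition first_moment :: real where "first_moment = (LBINT y. norm y * U y)"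

definition riesz_bound :: real where
  "riesz_bound = (LBINT z. indicator (cball 0 1) z * norm (z::'a) powr (- (15/8)))
    + (LBINT y. U y ^ 5) + mass"

lemma mass_nonneg: "mass \<ge> 0"
  unfolding mass_def by (intro integral_nonneg_AE) (auto simp: U_nonneg)

lemma integrable_first_moment: "integrable lborel (\<lambda>y. norm y * U y)"
proof (rule Bochner_Integration.integrable_bound)
  show "integrable lborel (\<lambda>x. U x + (norm x)\<^sup>2 * U x)"
    by (intro Bochner_Integration.integrable_add integrable_U integrable_second_moment)
  show "AE x in lborel. norm (norm x * U x) \<le> norm (U x + (norm x)\<^sup>2 * U x)"
  proof (intro AE_I2)
    fix x :: 'a
    have "norm x \<le> 1 + (norm x)\<^sup>2"
    proof -
      have "2 * norm x \<le> (norm x)\<^sup>2 + 1" using sum_squares_bound[of "norm x" 1] by simp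
      then show ?thesis using norm_ge_zero[of x] by linarith
    qed
    then have "norm x * U x \<le> (1 + (norm x)\<^sup>2) * U x" by (intro mult_right_mono U_nonneg)
    then show "norm (norm x * U x) \<le> norm (U x + (norm x)\<^sup>2 * U x)"
      using U_nonneg[of x] by (simp add: distrib_right)
  qed
qed measurable

text \<open>The bound is uniform in \<open>x\<close> because only translations of the locally integrable kernel occur.\<close>

lemma riesz_potential:
  shows "integrable lborel (\<lambda>y. U y * riesz (x - y))"
    and "(LBINT y. U y * riesz (x - y)) \<le> riesz_bound"
proof -
  define K where "K z = indicator (cball 0 1) z * norm (z::'a) powr (- (15/8))" for z
  have [measurable]: "K \<in> borel_measurable borel"
    unfolding K_def[abs_def] by (intro borel_measurable_times borel_measurable_indicator) auto
  have K: "integrable lborel K"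
    using riesz_kernel_locally_integrable[OF dim]
    by (intro integrableI_nonneg) (auto simp: K_def)
  note Kx = integrable_lborel_reflect[OF K, of x]
  have dom: "integrable lborel (\<lambda>y. K (x - y) + U y ^ 5 + U y)"
    by (intro Bochner_Integration.integrable_add Kx integrable_U5 integrable_U)
  have le: "U y * riesz (x - y) \<le> K (x - y) + U y ^ 5 + U y" for y
    unfolding K_def by (rule riesz_young[OF U_nonneg])
  have nn: "0 \<le> U y * riesz (x - y)" for y
    using U_nonneg by simp
  show int: "integrable lborel (\<lambda>y. U y * riesz (x - y))"
  proof (rule Bochner_Integration.integrable_bound[OF dom])
    show "AE y in lborel. norm (U y * riesz (x - y)) \<le> norm (K (x - y) + U y ^ 5 + U y)"
      using le nn by (intro AE_I2) (metis abs_of_nonneg order_trans real_norm_def)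
  qed measurable
  have "(LBINT y. U y * riesz (x - y)) \<le> (LBINT y. K (x - y) + U y ^ 5 + U y)"
    by (intro integral_mono int dom le)
  also have "\<dots> = (LBINT y. K (x - y)) + (LBINT y. U y ^ 5) + mass"
    using Kx integrable_U5 integrable_U by (simp add: mass_def)
  also have "(LBINT y. K (x - y)) = (LBINT y. K y)"
    by (rule integral_lborel_reflect) measurable
  finally show "(LBINT y. U y * riesz (x - y)) \<le> riesz_bound"
    by (simp add: riesz_bound_def K_def[symmetric])
qed

lemma riesz_bound_nonneg: "riesz_bound \<ge> 0"
  using riesz_potential(2)[of 0] by (rule order_trans[rotated]) (auto intro!: integral_nonneg_AE simp: U_nonneg)

lemma integrable_U_norm_diff: "integrable lborel (\<lambda>y. U y * norm (x - y))"
proof (rule Bochner_Integration.integrable_bound)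
  show "integrable lborel (\<lambda>y. norm x * U y + norm y * U y)"
    by (intro Bochner_Integration.integrable_add integrable_mult_right integrable_U integrable_first_moment)
  show "AE y in lborel. norm (U y * norm (x - y)) \<le> norm (norm x * U y + norm y * U y)"
  proof (intro AE_I2)
    fix y
    have "U y * norm (x - y) \<le> U y * (norm x + norm y)"
      by (intro mult_left_mono norm_triangle_ineq4 U_nonneg)
    then show "norm (U y * norm (x - y)) \<le> norm (norm x * U y + norm y * U y)"
      using U_nonneg[of y] by (simp add: algebra_simps)
  qed
qed measurable

text \<open>This is \<open>- K * U\<close> for the kernel \<open>K = - ln |z|\<close>, regularised if \<open>\<delta> > 0\<close>.\<close>

definition log_pot :: "real \<Rightarrow> 'a \<Rightarrow> real" where
  "log_pot \<delta> x = (LBINT y. U y * log_reg \<delta> (x - y))"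

lemma integrable_log_reg:
  assumes "\<delta> \<ge> 0" shows "integrable lborel (\<lambda>y. U y * log_reg \<delta> (x - y))"
proof (rule Bochner_Integration.integrable_bound)
  let ?r = "\<lambda>y. riesz (x - y)"
  show "integrable lborel (\<lambda>y. (1 + sqrt \<delta>) * (U y * ?r y) + U y * norm (x - y) + sqrt \<delta> * U y)"
    by (intro Bochner_Integration.integrable_add integrable_mult_right riesz_potential integrable_U
        integrable_U_norm_diff)
  show "AE y in lborel. norm (U y * log_reg \<delta> (x - y))
      \<le> norm ((1 + sqrt \<delta>) * (U y * ?r y) + U y * norm (x - y) + sqrt \<delta> * U y)"
    using AE_lborel_singleton[of x]
  proof eventually_elim
    case (elim y)
    then have ne: "x - y \<noteq> 0" by simp
    let ?b = "(1 + sqrt \<delta>) * ?r y + norm (x - y) + sqrt \<delta>"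
    have s: "sqrt \<delta> \<ge> 0" "?r y \<ge> 0" "sqrt \<delta> * ?r y \<ge> 0" using assms by auto
    have "log_reg 0 (x - y) \<le> norm (x - y)" by (rule log_reg_le_norm) auto
    moreover have "- log_reg 0 (x - y) \<le> ?r y" unfolding log_reg_0 by (rule ln_norm_ge)
    moreover have "log_reg 0 (x - y) \<le> log_reg \<delta> (x - y)" by (rule log_reg_mono[OF assms ne])
    moreover have "log_reg \<delta> (x - y) - log_reg 0 (x - y) \<le> sqrt \<delta> * ?r y + sqrt \<delta>"
      using log_reg_diff_le[OF assms ne] by (simp only: distrib_left mult_1_right)
    moreover have "?b = ?r y + sqrt \<delta> * ?r y + norm (x - y) + sqrt \<delta>"
      by (simp add: distrib_right)
    ultimately have "\<bar>log_reg \<delta> (x - y)\<bar> \<le> ?b"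
      using s norm_ge_zero[of "x - y"] by linarith
    then have "U y * \<bar>log_reg \<delta> (x - y)\<bar> \<le> U y * ?b" by (intro mult_left_mono U_nonneg)
    also have "\<dots> = (1 + sqrt \<delta>) * (U y * ?r y) + U y * norm (x - y) + sqrt \<delta> * U y"
      by (simp add: algebra_simps)
    finally have "U y * \<bar>log_reg \<delta> (x - y)\<bar> \<le> \<dots>" .
    moreover have "\<bar>U y * log_reg \<delta> (x - y)\<bar> = U y * \<bar>log_reg \<delta> (x - y)\<bar>"
      using U_nonneg[of y] by (simp add: abs_mult)
    ultimately show ?case unfolding real_norm_def by linarith
  qed
qed measurable

lemma log_pot_mono:
  assumes "\<delta> \<ge> 0" shows "log_pot 0 x \<le> log_pot \<delta> x"
  unfolding log_pot_def
proof (rule integral_mono_AE)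
  show "AE y in lborel. U y * log_reg 0 (x - y) \<le> U y * log_reg \<delta> (x - y)"
    using AE_lborel_singleton[of x]
    by eventually_elim (intro mult_left_mono log_reg_mono U_nonneg assms, auto)
qed (use assms in \<open>auto intro: integrable_log_reg\<close>)

lemma log_pot_diff_le:
  assumes "\<delta> \<ge> 0" shows "log_pot \<delta> x - log_pot 0 x \<le> sqrt \<delta> * (riesz_bound + mass)"
proof -
  let ?r = "\<lambda>y. riesz (x - y)"
  have "log_pot \<delta> x - log_pot 0 x = (LBINT y. U y * log_reg \<delta> (x - y) - U y * log_reg 0 (x - y))"
    unfolding log_pot_def using assms
    by (intro Bochner_Integration.integral_diff[symmetric] integrable_log_reg) auto
  also have "\<dots> \<le> (LBINT y. sqrt \<delta> * (U y * ?r y + U y))"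
  proof (rule integral_mono_AE)
    show "AE y in lborel. U y * log_reg \<delta> (x - y) - U y * log_reg 0 (x - y) \<le> sqrt \<delta> * (U y * ?r y + U y)"
      using AE_lborel_singleton[of x]
    proof eventually_elim
      case (elim y)
      have "U y * (log_reg \<delta> (x - y) - log_reg 0 (x - y)) \<le> U y * (sqrt \<delta> * (?r y + 1))"
        using elim by (intro mult_left_mono log_reg_diff_le U_nonneg assms) auto
      then show ?case by (simp add: algebra_simps)
    qed
  qed (use assms in \<open>auto intro!: Bochner_Integration.integrable_diff integrable_log_reg integrable_mult_right
      Bochner_Integration.integrable_add riesz_potential integrable_U\<close>)
  also have "\<dots> = sqrt \<delta> * ((LBINT y. U y * ?r y) + mass)"
    using riesz_potential(1)[of x] integrable_U by (simp add: mass_def)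
  also have "\<dots> \<le> sqrt \<delta> * (riesz_bound + mass)"
    using assms by (intro mult_left_mono add_right_mono riesz_potential) auto
  finally show ?thesis .
qed

lemma log_pot_le:
  assumes "0 \<le> \<delta>" "\<delta> \<le> 1" shows "log_pot \<delta> x \<le> mass * norm x + first_moment"
proof -
  have "log_pot \<delta> x \<le> (LBINT y. norm x * U y + norm y * U y)"
    unfolding log_pot_def
  proof (rule integral_mono)
    fix y
    have "U y * log_reg \<delta> (x - y) \<le> U y * (norm x + norm y)"
      using log_reg_le_norm[OF assms, of "x - y"] norm_triangle_ineq4[of x y]
      by (intro mult_left_mono U_nonneg) linarith
    then show "U y * log_reg \<delta> (x - y) \<le> norm x * U y + norm y * U y"
      by (simp add: algebra_simps)
  qed (use assms in \<open>auto intro!: integrable_log_reg Bochner_Integration.integrable_add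
      integrable_mult_right integrable_U integrable_first_moment\<close>)
  also have "\<dots> = mass * norm x + first_moment"
    using integrable_U integrable_first_moment by (simp add: mass_def first_moment_def mult.commute)
  finally show ?thesis .
qed

lemma log_pot_0_ge: "- riesz_bound \<le> log_pot 0 x"
proof -
  have "- log_pot 0 x = (LBINT y. - (U y * log_reg 0 (x - y)))"
    by (simp add: log_pot_def)
  also have "\<dots> \<le> (LBINT y. U y * riesz (x - y))"
  proof (rule integral_mono)
    fix y
    have "U y * (- log_reg 0 (x - y)) \<le> U y * riesz (x - y)"
      unfolding log_reg_0 by (intro mult_left_mono U_nonneg ln_norm_ge)
    then show "- (U y * log_reg 0 (x - y)) \<le> U y * riesz (x - y)" by simp
  qed (auto intro!: integrable_log_reg riesz_potential Bochner_Integration.integrable_minus)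
  also have "\<dots> \<le> riesz_bound" by (rule riesz_potential)
  finally show ?thesis by simp
qed

lemma measurable_log_pot [measurable]: "log_pot \<delta> \<in> borel_measurable borel"
proof -
  have "(\<lambda>x. LBINT y. U y * log_reg \<delta> (x - y)) \<in> borel_measurable borel"
    by (rule lborel.borel_measurable_lebesgue_integral) measurable
  then show ?thesis by (simp add: log_pot_def[abs_def])
qed

subsection \<open>The drift and the Gibbs density\<close>

text \<open>For \<open>\<delta> = 0\<close> the drift is \<open>grad V\<close> with \<open>V = |x|\<^sup>2/4 + K * U\<close>; the Gibbs density is \<open>exp (- V)\<close>.\<close>

definition drift :: "real \<Rightarrow> 'a \<Rightarrow> 'a" where
  "drift \<delta> x = x /\<^sub>R 2 - (LBINT y. U y *\<^sub>R grad_log_reg \<delta> (x - y))"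

definition gibbs :: "real \<Rightarrow> 'a \<Rightarrow> real" where
  "gibbs \<delta> x = exp (log_pot \<delta> x - (norm x)\<^sup>2 / 4)"

lemma gibbs_pos: "gibbs \<delta> x > 0"
  by (simp add: gibbs_def)

lemma measurable_gibbs [measurable]: "gibbs \<delta> \<in> borel_measurable borel"
  unfolding gibbs_def[abs_def] by measurable

lemma measurable_drift [measurable]: "drift \<delta> \<in> borel_measurable borel"
proof -
  have "(\<lambda>x. LBINT y. U y *\<^sub>R grad_log_reg \<delta> (x - y)) \<in> borel_measurable borel"
    by (rule lborel.borel_measurable_lebesgue_integral) measurable
  then show ?thesis by (simp add: drift_def[abs_def])
qed

lemma integrable_grad_log_reg_0: "integrable lborel (\<lambda>y. U y *\<^sub>R grad_log_reg 0 (x - y))"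
proof (rule Bochner_Integration.integrable_bound)
  show "integrable lborel (\<lambda>y. U y * riesz (x - y) + U y)"
    by (intro Bochner_Integration.integrable_add riesz_potential integrable_U)
  show "AE y in lborel. norm (U y *\<^sub>R grad_log_reg 0 (x - y)) \<le> norm (U y * riesz (x - y) + U y)"
  proof (intro AE_I2)
    fix y
    have "U y * inverse (norm (x - y)) \<le> U y * (riesz (x - y) + 1)"
      by (intro mult_left_mono inverse_norm_le_riesz U_nonneg)
    then show "norm (U y *\<^sub>R grad_log_reg 0 (x - y)) \<le> norm (U y * riesz (x - y) + U y)"
      using U_nonneg[of y] by (simp add: norm_grad_log_reg_0 distrib_left)
  qed
qed measurable

lemma integrable_grad_log_reg:
  assumes "\<delta> > 0"
  shows "integrable lborel (\<lambda>y. U y *\<^sub>R grad_log_reg \<delta> (x - y))"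
    and "continuous_on UNIV (\<lambda>x. LBINT y. U y *\<^sub>R grad_log_reg \<delta> (x - y))"
  using continuous_on_convolution[OF integrable_U continuous_on_grad_log_reg[OF assms] norm_grad_log_reg_le[OF assms]]
  by auto

lemma drift_diff_le:
  assumes "\<delta> > 0" shows "norm (drift 0 x - drift \<delta> x) \<le> \<delta> powr (1/4) * riesz_bound"
proof -
  have "drift 0 x - drift \<delta> x = (LBINT y. U y *\<^sub>R grad_log_reg \<delta> (x - y) - U y *\<^sub>R grad_log_reg 0 (x - y))"
    unfolding drift_def
    using integrable_grad_log_reg_0[of x] integrable_grad_log_reg(1)[OF assms, of x] by simp
  also have "norm \<dots> \<le> (LBINT y. norm (U y *\<^sub>R grad_log_reg \<delta> (x - y) - U y *\<^sub>R grad_log_reg 0 (x - y)))"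
    by (rule integral_norm_bound)
  also have "\<dots> \<le> (LBINT y. \<delta> powr (1/4) * (U y * riesz (x - y)))"
  proof (rule integral_mono)
    show "integrable lborel (\<lambda>y. norm (U y *\<^sub>R grad_log_reg \<delta> (x - y) - U y *\<^sub>R grad_log_reg 0 (x - y)))"
      using integrable_grad_log_reg_0[of x] integrable_grad_log_reg(1)[OF assms, of x] by auto
    show "integrable lborel (\<lambda>y. \<delta> powr (1/4) * (U y * riesz (x - y)))"
      by (intro integrable_mult_right riesz_potential)
    fix y
    have "norm (U y *\<^sub>R grad_log_reg \<delta> (x - y) - U y *\<^sub>R grad_log_reg 0 (x - y))
        = U y * norm (grad_log_reg \<delta> (x - y) - grad_log_reg 0 (x - y))"
      using U_nonneg[of y] by (simp add: scaleR_right_diff_distrib[symmetric])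
    also have "\<dots> \<le> U y * (\<delta> powr (1/4) * riesz (x - y))"
      using assms by (intro mult_left_mono grad_log_reg_diff_le U_nonneg) auto
    finally show "norm (U y *\<^sub>R grad_log_reg \<delta> (x - y) - U y *\<^sub>R grad_log_reg 0 (x - y))
        \<le> \<delta> powr (1/4) * (U y * riesz (x - y))" by (simp add: mult_ac)
  qed
  also have "\<dots> = \<delta> powr (1/4) * (LBINT y. U y * riesz (x - y))"
    by simp
  also have "\<dots> \<le> \<delta> powr (1/4) * riesz_bound"
    by (intro mult_left_mono riesz_potential) auto
  finally show ?thesis .
qed

lemma continuous_drift:
  assumes "\<delta> > 0" shows "continuous_on UNIV (drift \<delta>)"
  unfolding drift_def[abs_def] by (intro continuous_intros integrable_grad_log_reg[OF assms])

lemma norm_drift_0_le: "norm (drift 0 x) \<le> norm x / 2 + (riesz_bound + mass)"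
proof -
  have "norm (LBINT y. U y *\<^sub>R grad_log_reg 0 (x - y)) \<le> (LBINT y. norm (U y *\<^sub>R grad_log_reg 0 (x - y)))"
    by (rule integral_norm_bound)
  also have "\<dots> \<le> (LBINT y. U y * riesz (x - y) + U y)"
  proof (rule integral_mono)
    fix y
    have "U y * inverse (norm (x - y)) \<le> U y * (riesz (x - y) + 1)"
      by (intro mult_left_mono inverse_norm_le_riesz U_nonneg)
    then show "norm (U y *\<^sub>R grad_log_reg 0 (x - y)) \<le> U y * riesz (x - y) + U y"
      using U_nonneg[of y] by (simp add: norm_grad_log_reg_0 distrib_left)
  qed (intro Bochner_Integration.integrable_add riesz_potential integrable_U
      integrable_norm integrable_grad_log_reg_0)+
  also have "\<dots> = (LBINT y. U y * riesz (x - y)) + mass"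
    using riesz_potential(1)[of x] integrable_U by (simp add: mass_def)
  also have "\<dots> \<le> riesz_bound + mass" using riesz_potential(2)[of x] by simp
  finally show ?thesis
    unfolding drift_def using norm_triangle_ineq4[of "x /\<^sub>R 2" "\<integral>y. U y *\<^sub>R grad_log_reg 0 (x - y) \<partial>lborel"]
    by simp
qed

lemma integrable_U_drift: "integrable lborel (\<lambda>y. U y *\<^sub>R drift 0 y)"
proof (rule Bochner_Integration.integrable_bound)
  show "integrable lborel (\<lambda>y. norm y * U y + (riesz_bound + mass) * U y)"
    by (intro Bochner_Integration.integrable_add integrable_mult_right integrable_U integrable_first_moment)
  show "AE y in lborel. norm (U y *\<^sub>R drift 0 y) \<le> norm (norm y * U y + (riesz_bound + mass) * U y)"
  proof (intro AE_I2)
    fix y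
    have "norm (drift 0 y) \<le> norm y + (riesz_bound + mass)"
      using norm_drift_0_le[of y] norm_ge_zero[of y] by linarith
    then have "U y * norm (drift 0 y) \<le> U y * (norm y + (riesz_bound + mass))"
      by (intro mult_left_mono U_nonneg)
    also have "\<dots> = norm y * U y + (riesz_bound + mass) * U y" by (simp add: algebra_simps)
    finally have "U y * norm (drift 0 y) \<le> norm y * U y + (riesz_bound + mass) * U y" .
    moreover have "norm (U y *\<^sub>R drift 0 y) = U y * norm (drift 0 y)" using U_nonneg[of y] by simp
    ultimately show "norm (U y *\<^sub>R drift 0 y) \<le> norm (norm y * U y + (riesz_bound + mass) * U y)"
      unfolding real_norm_def by linarith
  qed
qed measurable

lemma GDERIV_gibbs:
  assumes "\<delta> > 0" shows "GDERIV (gibbs \<delta>) x :> (- gibbs \<delta> x) *\<^sub>R drift \<delta> x"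
proof -
  have "GDERIV (log_pot \<delta>) x :> (LBINT y. U y *\<^sub>R grad_log_reg \<delta> (x - y))"
    unfolding log_pot_def[abs_def] using assms
    by (intro GDERIV_convolution[OF integrable_U GDERIV_log_reg continuous_on_grad_log_reg norm_grad_log_reg_le]
        integrable_log_reg) auto
  moreover have "GDERIV (\<lambda>x. (norm x)\<^sup>2 / 4) x :> x /\<^sub>R 2"
    unfolding gderiv_def power2_norm_eq_inner by (auto intro!: derivative_eq_intros simp: inner_commute)
  ultimately have "GDERIV (\<lambda>x. log_pot \<delta> x - (norm x)\<^sup>2 / 4) x :> (- drift \<delta> x)"
    using GDERIV_diff by (fastforce simp: drift_def)
  from GDERIV_DERIV_compose[OF this DERIV_exp] show ?thesis
    by (simp add: gibbs_def[abs_def])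
qed

lemma continuous_gibbs:
  assumes "\<delta> > 0" shows "continuous_on UNIV (gibbs \<delta>)"
  by (rule continuous_on_GDERIV[OF GDERIV_gibbs[OF assms]])

text \<open>The logarithmic potential grows at most linearly, so half of the quadratic exponent survives,
  uniformly in \<open>\<delta>\<close>.\<close>

lemma gibbs_le:
  assumes "0 \<le> \<delta>" "\<delta> \<le> 1"
  shows "gibbs \<delta> x \<le> exp (2 * mass\<^sup>2 + first_moment) * exp (- (norm x)\<^sup>2 / 8)"
proof -
  have "0 \<le> (2 * mass - norm x / 2)\<^sup>2" by simp
  also have "\<dots> = 4 * mass\<^sup>2 + (norm x)\<^sup>2 / 4 - 2 * (mass * norm x)"
    by (simp add: power2_diff power_mult_distrib power_divide)
  finally have "mass * norm x \<le> 2 * mass\<^sup>2 + (norm x)\<^sup>2 / 8" by simp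
  then have "log_pot \<delta> x - (norm x)\<^sup>2 / 4 \<le> (2 * mass\<^sup>2 + first_moment) + (- (norm x)\<^sup>2 / 8)"
    using log_pot_le[OF assms, of x] by simp
  then show ?thesis unfolding gibbs_def exp_add[symmetric] by simp
qed

lemma gibbs_0_ge: "exp (- riesz_bound - (norm x)\<^sup>2 / 4) \<le> gibbs 0 x"
  unfolding gibbs_def using log_pot_0_ge[of x] by simp

lemma gibbs_mono: "\<delta> \<ge> 0 \<Longrightarrow> gibbs 0 x \<le> gibbs \<delta> x"
  unfolding gibbs_def using log_pot_mono[of \<delta> x] by simp

lemma gibbs_diff_le:
  assumes "0 \<le> \<delta>"
  shows "gibbs \<delta> x - gibbs 0 x \<le> gibbs \<delta> x * (sqrt \<delta> * (riesz_bound + mass))"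
proof -
  let ?s = "sqrt \<delta> * (riesz_bound + mass)"
  have "1 - ?s \<le> exp (- ?s)" using exp_ge_add_one_self[of "- ?s"] by simp
  then have "gibbs \<delta> x * (1 - ?s) \<le> gibbs \<delta> x * exp (- ?s)"
    using gibbs_pos[of \<delta> x] by (intro mult_left_mono) auto
  also have "\<dots> \<le> gibbs 0 x"
    unfolding gibbs_def exp_add[symmetric] using log_pot_diff_le[OF assms, of x] by simp
  finally show ?thesis by (simp add: right_diff_distrib)
qed

end

section \<open>Stationary densities are Gibbs densities\<close>

text \<open>The flux \<open>J\<close> is tested with \<open>\<eta>\<^sup>2 P\<close>, whose gradient is \<open>\<eta>\<^sup>2 a + 2 \<eta> P v\<close> for \<open>a = grad P\<close> and
  \<open>v = grad \<eta>\<close>. In terms of \<open>A = |a| / P\<close> the main part contributes \<open>- E \<eta>\<^sup>2 A\<^sup>2\<close>. The mixed term and the defect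
  \<open>m\<close> each consume a quarter of it, and \<open>|a| \<le> A\<close> since \<open>P \<le> 1\<close>. The bound on \<open>m\<close> matches a flux
  defect \<open>\<omega> w\<close>, because \<open>w \<le> E + w = E / P\<close>.\<close>

lemma caccioppoli_pointwise:
  fixes a v J m :: "'a::real_inner" and E P \<eta> \<omega> :: real
  assumes E: "E > 0" and P: "0 < P" "P \<le> 1" and \<eta>: "\<eta> \<ge> 0" and \<omega>: "\<omega> \<ge> 0"
    and m: "norm m \<le> \<omega> * (E / P)" and J: "J = m - (E / P\<^sup>2) *\<^sub>R a"
  shows "J \<bullet> (\<eta>\<^sup>2 *\<^sub>R a + (2 * \<eta> * P) *\<^sub>R v)
    \<le> E * (5 * (norm v)\<^sup>2 + 2 * \<omega>\<^sup>2 * \<eta>\<^sup>2) - E * (\<eta>\<^sup>2 * (norm a)\<^sup>2) / 2"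
proof -
  define A where "A = norm a / P"
  define n where "n = norm v"
  have A: "A \<ge> 0" "norm a = P * A" and n: "n \<ge> 0" using P by (auto simp: A_def n_def)
  have "norm a = P * A" by fact
  also have "\<dots> \<le> A" using P A by (simp add: mult_left_le_one_le)
  finally have aA: "(norm a)\<^sup>2 \<le> A\<^sup>2" by (rule power_mono) simp
  have split: "J \<bullet> (\<eta>\<^sup>2 *\<^sub>R a + (2 * \<eta> * P) *\<^sub>R v)
      = m \<bullet> (\<eta>\<^sup>2 *\<^sub>R a + (2 * \<eta> * P) *\<^sub>R v) - E / P\<^sup>2 * \<eta>\<^sup>2 * (a \<bullet> a) - E / P\<^sup>2 * (2 * \<eta> * P) * (a \<bullet> v)"
    unfolding J by (simp add: inner_diff_left inner_add_right algebra_simps)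
  have "m \<bullet> (\<eta>\<^sup>2 *\<^sub>R a + (2 * \<eta> * P) *\<^sub>R v) \<le> norm m * norm (\<eta>\<^sup>2 *\<^sub>R a + (2 * \<eta> * P) *\<^sub>R v)"
    by (rule norm_cauchy_schwarz)
  also have "\<dots> \<le> (\<omega> * (E / P)) * (\<eta>\<^sup>2 * norm a + (2 * \<eta> * P) * n)"
  proof (rule mult_mono[OF m])
    show "norm (\<eta>\<^sup>2 *\<^sub>R a + (2 * \<eta> * P) *\<^sub>R v) \<le> \<eta>\<^sup>2 * norm a + (2 * \<eta> * P) * n"
      using norm_triangle_ineq[of "\<eta>\<^sup>2 *\<^sub>R a" "(2 * \<eta> * P) *\<^sub>R v"] \<eta> P by (simp add: n_def abs_mult)
  qed (use \<omega> E P in auto)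
  also have "\<dots> = E * (\<omega> * \<eta>\<^sup>2 * A + 2 * \<omega> * \<eta> * n)"
    using P unfolding A(2) by (simp add: field_simps)
  finally have 1: "m \<bullet> (\<eta>\<^sup>2 *\<^sub>R a + (2 * \<eta> * P) *\<^sub>R v) \<le> E * (\<omega> * \<eta>\<^sup>2 * A + 2 * \<omega> * \<eta> * n)" .
  have "E / P\<^sup>2 * \<eta>\<^sup>2 * (a \<bullet> a) = E / P\<^sup>2 * \<eta>\<^sup>2 * (P * A)\<^sup>2"
    by (simp only: power2_norm_eq_inner[symmetric] A(2))
  then have 2: "E / P\<^sup>2 * \<eta>\<^sup>2 * (a \<bullet> a) = E * (\<eta>\<^sup>2 * A\<^sup>2)"
    using P by (simp add: power_mult_distrib)
  have "- (a \<bullet> v) \<le> norm a * n"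
    using norm_cauchy_schwarz[of "- a" v] by (simp add: n_def)
  then have "E / P\<^sup>2 * (2 * \<eta> * P) * (- (a \<bullet> v)) \<le> E / P\<^sup>2 * (2 * \<eta> * P) * (norm a * n)"
    using E P \<eta> by (intro mult_left_mono) auto
  also have "\<dots> = E * (2 * \<eta> * A * n)"
    using P unfolding A(2) by (simp add: power2_eq_square)
  finally have 3: "- (E / P\<^sup>2 * (2 * \<eta> * P) * (a \<bullet> v)) \<le> E * (2 * \<eta> * A * n)" by simp
  have "2 * (\<eta> * A / 2) * (2 * n) \<le> (\<eta> * A / 2)\<^sup>2 + (2 * n)\<^sup>2" by (rule sum_squares_bound)
  then have i: "2 * \<eta> * A * n \<le> \<eta>\<^sup>2 * A\<^sup>2 / 4 + 4 * n\<^sup>2" by (simp add: power_mult_distrib power_divide)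
  have "2 * (\<eta> * A / 2) * (\<omega> * \<eta>) \<le> (\<eta> * A / 2)\<^sup>2 + (\<omega> * \<eta>)\<^sup>2" by (rule sum_squares_bound)
  then have ii: "\<omega> * \<eta>\<^sup>2 * A \<le> \<eta>\<^sup>2 * A\<^sup>2 / 4 + \<omega>\<^sup>2 * \<eta>\<^sup>2"
    by (simp add: power_mult_distrib power_divide power2_eq_square mult_ac)
  have "2 * (\<omega> * \<eta>) * n \<le> (\<omega> * \<eta>)\<^sup>2 + n\<^sup>2" by (rule sum_squares_bound)
  then have iii: "2 * \<omega> * \<eta> * n \<le> \<omega>\<^sup>2 * \<eta>\<^sup>2 + n\<^sup>2" by (simp add: power_mult_distrib mult.assoc)
  have iv: "\<eta>\<^sup>2 * (norm a)\<^sup>2 \<le> \<eta>\<^sup>2 * A\<^sup>2" using aA by (intro mult_left_mono) auto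
  have "J \<bullet> (\<eta>\<^sup>2 *\<^sub>R a + (2 * \<eta> * P) *\<^sub>R v)
      \<le> E * (\<omega> * \<eta>\<^sup>2 * A + 2 * \<omega> * \<eta> * n) - E * (\<eta>\<^sup>2 * A\<^sup>2) + E * (2 * \<eta> * A * n)"
    unfolding split using 1 2 3 by linarith
  also have "\<dots> = E * (\<omega> * \<eta>\<^sup>2 * A + 2 * \<omega> * \<eta> * n - \<eta>\<^sup>2 * A\<^sup>2 + 2 * \<eta> * A * n)"
    by (simp add: algebra_simps)
  also have "\<dots> \<le> E * (5 * n\<^sup>2 + 2 * (\<omega>\<^sup>2 * \<eta>\<^sup>2) - \<eta>\<^sup>2 * (norm a)\<^sup>2 / 2)"
    using E i ii iii iv by (intro mult_left_mono) linarith+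
  finally show ?thesis by (simp add: n_def algebra_simps)
qed

text \<open>The quotient rule for \<open>E / N\<close> with \<open>N = E + W\<close>, when \<open>grad E = - E d\<close> and \<open>grad W = g\<close>.\<close>

lemma quotient_gradient:
  fixes d g :: "'a::real_vector" and E N W :: real
  assumes N: "N \<noteq> 0" and W: "W = N - E"
  shows "E *\<^sub>R (- (inverse N)\<^sup>2 *\<^sub>R ((- E) *\<^sub>R d + g)) + inverse N *\<^sub>R ((- E) *\<^sub>R d)
    = - (E / N\<^sup>2) *\<^sub>R (g + W *\<^sub>R d)"
proof -
  have c: "E * (inverse N)\<^sup>2 * E - inverse N * E = - (E / N\<^sup>2 * W)"
    using N by (simp add: W power2_eq_square field_simps)
  have "E *\<^sub>R (- (inverse N)\<^sup>2 *\<^sub>R ((- E) *\<^sub>R d + g)) + inverse N *\<^sub>R ((- E) *\<^sub>R d)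
      = (E * (inverse N)\<^sup>2 * E - inverse N * E) *\<^sub>R d - (E * (inverse N)\<^sup>2) *\<^sub>R g"
    by (simp add: scaleR_right_distrib scaleR_diff_left scaleR_right_diff_distrib mult.assoc)
  also have "E * (inverse N)\<^sup>2 * E - inverse N * E = - (E / N\<^sup>2 * W)" by (rule c)
  also have "E * (inverse N)\<^sup>2 = E / N\<^sup>2" by (simp add: divide_inverse power_inverse)
  finally show ?thesis by (simp add: scaleR_right_distrib)
qed

locale stationary_density = density U for U :: "'a::euclidean_space \<Rightarrow> real" +
  assumes weak: "test_function \<phi> \<Longrightarrow>
    (LBINT \<xi>. U \<xi> * laplacian \<phi> \<xi>) - (LBINT \<xi>. U \<xi> * (drift 0 \<xi> \<bullet> gradient \<phi> \<xi>)) = 0"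

locale mollified_density = stationary_density U + mollifier \<epsilon> r G H
  for U :: "'a::euclidean_space \<Rightarrow> real" and \<epsilon> and r :: "'a \<Rightarrow> real" and G H
begin

text \<open>The mollified equation says that the flux \<open>grad w + (U grad V) * r\<close> is divergence free; \<open>grad_flux b\<close>
  is the gradient of its component in the direction \<open>b\<close>.\<close>

definition w :: "'a \<Rightarrow> real" where "w x = (LBINT y. U y * r (x - y))"

definition grad_w :: "'a \<Rightarrow> 'a" where "grad_w x = (LBINT y. U y *\<^sub>R G (x - y))"

definition transport :: "'a \<Rightarrow> 'a" where
  "transport x = (LBINT y. r (x - y) *\<^sub>R (U y *\<^sub>R drift 0 y))"

definition flux :: "'a \<Rightarrow> 'a" where "flux x = grad_w x + transport x"

definition grad_flux :: "'a \<Rightarrow> 'a \<Rightarrow> 'a" where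
  "grad_flux b x = (LBINT y. U y *\<^sub>R H b (x - y)) + (LBINT y. (U y * (drift 0 y \<bullet> b)) *\<^sub>R G (x - y))"

lemma w_nonneg: "w x \<ge> 0"
  unfolding w_def by (intro integral_nonneg_AE) (auto simp: U_nonneg nonneg)

lemma GDERIV_w: "GDERIV w x :> grad_w x" and continuous_grad_w: "continuous_on UNIV grad_w"
  and continuous_w: "continuous_on UNIV w"
  unfolding w_def[abs_def] grad_w_def[abs_def]
  using GDERIV_conv_r[OF integrable_U] continuous_conv_r[OF integrable_U] by auto

lemma integrable_U_drift_inner: "integrable lborel (\<lambda>y. U y * (drift 0 y \<bullet> b))"
  using integrable_inner_left[of b lborel "\<lambda>y. U y *\<^sub>R drift 0 y"] integrable_U_drift by simp

lemma integrable_transport: "integrable lborel (\<lambda>y. r (x - y) *\<^sub>R (U y *\<^sub>R drift 0 y))"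
proof -
  obtain C where C: "C > 0" "\<And>z. \<bar>r z\<bar> \<le> C" using bounded_r by blast
  show ?thesis
  proof (rule Bochner_Integration.integrable_bound)
    show "integrable lborel (\<lambda>y. C *\<^sub>R (U y *\<^sub>R drift 0 y))"
      by (intro integrable_scaleR_right integrable_U_drift)
    show "AE y in lborel. norm (r (x - y) *\<^sub>R (U y *\<^sub>R drift 0 y)) \<le> norm (C *\<^sub>R (U y *\<^sub>R drift 0 y))"
      using C by (intro AE_I2) (auto simp: abs_mult intro!: mult_right_mono)
  qed measurable
qed

lemma flux_inner: "flux x \<bullet> b = grad_w x \<bullet> b + (LBINT y. (U y * (drift 0 y \<bullet> b)) * r (x - y))"
proof -
  have "transport x \<bullet> b = (LBINT y. (r (x - y) *\<^sub>R (U y *\<^sub>R drift 0 y)) \<bullet> b)"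
    unfolding transport_def by (rule integral_inner_left[symmetric]) (rule integrable_transport)
  then show ?thesis by (simp add: flux_def inner_add_left mult_ac)
qed

lemma grad_w_inner: "grad_w x \<bullet> b = (LBINT y. U y * (G (x - y) \<bullet> b))"
  unfolding grad_w_def
  by (subst integral_inner_left[symmetric]) (auto intro: GDERIV_conv_r[OF integrable_U])

lemma GDERIV_flux: "GDERIV (\<lambda>x. flux x \<bullet> b) x :> grad_flux b x"
  and continuous_grad_flux: "continuous_on UNIV (grad_flux b)"
proof -
  obtain C where C: "\<And>z. norm (H b z) \<le> C" using bounded_H[of b] by blast
  obtain C' where C': "\<And>z. norm (G z) \<le> C'" using bounded_G by blast
  have Gb: "norm (G z \<bullet> b) \<le> C' * norm b" for z
    using Cauchy_Schwarz_ineq2[of "G z" b] mult_right_mono[OF C'[of z], of "norm b"] by simp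
  have "integrable lborel (\<lambda>y. U y * (G (x - y) \<bullet> b))" for x
  proof -
    have "continuous_on UNIV (\<lambda>z. G z \<bullet> b)" by (intro continuous_intros cont)
    from continuous_on_convolution(2)[OF integrable_U this Gb] show ?thesis by simp
  qed
  then have "GDERIV (\<lambda>x. grad_w x \<bullet> b) x :> (LBINT y. U y *\<^sub>R H b (x - y))"
    unfolding grad_w_inner by (intro GDERIV_convolution[OF integrable_U gderiv_G cont(3) C])
  moreover have "GDERIV (\<lambda>x. LBINT y. (U y * (drift 0 y \<bullet> b)) * r (x - y)) x :>
      (LBINT y. (U y * (drift 0 y \<bullet> b)) *\<^sub>R G (x - y))"
    by (rule GDERIV_conv_r[OF integrable_U_drift_inner])
  ultimately show "GDERIV (\<lambda>x. flux x \<bullet> b) x :> grad_flux b x"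
    unfolding flux_inner grad_flux_def by (rule GDERIV_add)
  show "continuous_on UNIV (grad_flux b)"
    unfolding grad_flux_def[abs_def]
    by (intro continuous_on_add continuous_on_convolution(1)[OF integrable_U cont(3) C]
        GDERIV_conv_r(2)[OF integrable_U_drift_inner])
qed

text \<open>The divergence at \<open>x\<close> is the weak formulation evaluated on the test function \<open>r(x - y)\<close> of \<open>y\<close>; the
  reflection accounts for the sign of the first-order term.\<close>

lemma divergence_flux: "(\<Sum>b\<in>Basis. grad_flux b x \<bullet> b) = 0"
proof -
  have Hint: "integrable lborel (\<lambda>y. U y *\<^sub>R H b (x - y))" for b
  proof -
    obtain C where C: "\<And>z. norm (H b z) \<le> C" using bounded_H[of b] by blast
    show ?thesis by (rule continuous_on_convolution(2)[OF integrable_U cont(3) C])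
  qed
  have Hint': "integrable lborel (\<lambda>y. U y * (H b (x - y) \<bullet> b))" for b
    using integrable_inner_left[of b lborel "\<lambda>y. U y *\<^sub>R H b (x - y)"] Hint[of b] by simp
  have 1: "(\<Sum>b\<in>Basis. (LBINT y. U y *\<^sub>R H b (x - y)) \<bullet> b)
      = (LBINT y. U y * laplacian (\<lambda>y. r (x - y)) y)"
  proof -
    have "(\<Sum>b\<in>Basis. (LBINT y. U y *\<^sub>R H b (x - y)) \<bullet> b) = (\<Sum>b\<in>Basis. \<integral>y. U y * (H b (x - y) \<bullet> b) \<partial>lborel)"
      by (intro sum.cong refl, subst integral_inner_left[symmetric]) (use Hint in auto)
    also have "\<dots> = (LBINT y. (\<Sum>b\<in>Basis. U y * (H b (x - y) \<bullet> b)))"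
      using Hint' by (intro Bochner_Integration.integral_sum[symmetric]) auto
    finally show ?thesis by (simp add: laplacian_test sum_distrib_left)
  qed
  have Gint: "integrable lborel (\<lambda>y. (U y * (drift 0 y \<bullet> b)) *\<^sub>R G (x - y))" for b
    by (rule GDERIV_conv_r(3)[OF integrable_U_drift_inner])
  have Gint': "integrable lborel (\<lambda>y. (U y * (drift 0 y \<bullet> b)) * (G (x - y) \<bullet> b))" for b
    using integrable_inner_left[of b lborel "\<lambda>y. (U y * (drift 0 y \<bullet> b)) *\<^sub>R G (x - y)"] Gint[of b] by simp
  have 2: "(\<Sum>b\<in>Basis. (LBINT y. (U y * (drift 0 y \<bullet> b)) *\<^sub>R G (x - y)) \<bullet> b)
      = - (LBINT y. U y * (drift 0 y \<bullet> gradient (\<lambda>y. r (x - y)) y))"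
  proof -
    have "(\<Sum>b\<in>Basis. (LBINT y. (U y * (drift 0 y \<bullet> b)) *\<^sub>R G (x - y)) \<bullet> b)
        = (\<Sum>b\<in>Basis. \<integral>y. (U y * (drift 0 y \<bullet> b)) * (G (x - y) \<bullet> b) \<partial>lborel)"
      by (intro sum.cong refl, subst integral_inner_left[symmetric]) (use Gint in auto)
    also have "\<dots> = (LBINT y. (\<Sum>b\<in>Basis. (U y * (drift 0 y \<bullet> b)) * (G (x - y) \<bullet> b)))"
      using Gint' by (intro Bochner_Integration.integral_sum[symmetric]) auto
    also have "(\<lambda>y. \<Sum>b\<in>Basis. (U y * (drift 0 y \<bullet> b)) * (G (x - y) \<bullet> b))
        = (\<lambda>y. U y * (drift 0 y \<bullet> G (x - y)))"
      unfolding euclidean_inner[of "drift 0 y" "G (x - y)" for y] by (simp add: sum_distrib_left mult.assoc)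
    finally show ?thesis by (simp add: gradient_test)
  qed
  have "(\<Sum>b\<in>Basis. grad_flux b x \<bullet> b)
      = (LBINT y. U y * laplacian (\<lambda>y. r (x - y)) y)
        - (LBINT y. U y * (drift 0 y \<bullet> gradient (\<lambda>y. r (x - y)) y))"
    unfolding grad_flux_def by (simp add: inner_add_left sum.distrib 1 2)
  also have "\<dots> = 0" by (rule weak[OF test])
  finally show ?thesis .
qed

lemma continuous_flux: "continuous_on UNIV flux"
proof -
  have "continuous_on UNIV (\<lambda>x. flux x \<bullet> b)" for b
    by (rule continuous_on_GDERIV[OF GDERIV_flux[of b]])
  then have "continuous_on UNIV (\<lambda>x. \<Sum>b\<in>Basis. (flux x \<bullet> b) *\<^sub>R b)"
    by (intro continuous_on_sum continuous_on_scaleR continuous_on_const)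
  then show ?thesis by (simp add: euclidean_representation)
qed

lemma integral_flux_gradient:
  assumes \<psi>: "\<And>x. GDERIV \<psi> x :> D x" and contD: "continuous_on UNIV D"
    and supp\<psi>: "\<And>x. norm x \<ge> R \<Longrightarrow> \<psi> x = 0" "\<And>x. norm x \<ge> R \<Longrightarrow> D x = 0"
  shows "(LBINT x. flux x \<bullet> D x) = 0"
proof -
  have cont\<psi>: "continuous_on UNIV \<psi>"
    by (rule continuous_on_GDERIV[OF \<psi>])
  note int = integrable_if_compact_support[where R="R" and 'a='a]
  have 0: "(LBINT x. (\<psi> x *\<^sub>R grad_flux b x + (flux x \<bullet> b) *\<^sub>R D x) \<bullet> b) = 0" for b
  proof (rule integral_directional_derivative_zero)
    show "GDERIV (\<lambda>x. \<psi> x * (flux x \<bullet> b)) x :> \<psi> x *\<^sub>R grad_flux b x + (flux x \<bullet> b) *\<^sub>R D x" for x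
      by (rule GDERIV_mult[OF \<psi> GDERIV_flux])
    show "continuous_on UNIV (\<lambda>x. \<psi> x *\<^sub>R grad_flux b x + (flux x \<bullet> b) *\<^sub>R D x)"
      by (intro continuous_intros cont\<psi> continuous_grad_flux continuous_flux contD)
  qed (use supp\<psi> in auto)
  have int1: "integrable lborel (\<lambda>x. (\<psi> x *\<^sub>R grad_flux b x + (flux x \<bullet> b) *\<^sub>R D x) \<bullet> b)" for b
    by (rule int) (auto intro!: continuous_intros cont\<psi> continuous_grad_flux continuous_flux contD simp: supp\<psi>)
  have "(LBINT x. (\<Sum>b\<in>Basis. (\<psi> x *\<^sub>R grad_flux b x + (flux x \<bullet> b) *\<^sub>R D x) \<bullet> b)) = 0"
    using 0 int1 by (subst Bochner_Integration.integral_sum) auto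
  moreover have "(\<Sum>b\<in>Basis. (\<psi> x *\<^sub>R grad_flux b x + (flux x \<bullet> b) *\<^sub>R D x) \<bullet> b) = flux x \<bullet> D x" for x
  proof -
    have "(\<Sum>b\<in>Basis. (\<psi> x *\<^sub>R grad_flux b x + (flux x \<bullet> b) *\<^sub>R D x) \<bullet> b)
        = \<psi> x * (\<Sum>b\<in>Basis. grad_flux b x \<bullet> b) + (\<Sum>b\<in>Basis. (flux x \<bullet> b) * (D x \<bullet> b))"
      by (simp add: inner_add_left sum.distrib sum_distrib_left)
    then show ?thesis by (simp add: divergence_flux euclidean_inner[of "flux x" "D x", symmetric])
  qed
  ultimately show ?thesis by simp
qed

text \<open>Averaging \<open>U\<close> times the drift and multiplying \<open>w\<close> by the drift at the centre differ only by the
  oscillation of the drift, weighted with \<open>U r \<ge> 0\<close>. The error is thus a multiple of \<open>w\<close> itself, which is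
  what \<open>caccioppoli_pointwise\<close> can absorb.\<close>

lemma transport_close:
  assumes "\<And>y. norm (x - y) < \<epsilon> \<Longrightarrow> norm (drift 0 y - b) \<le> \<omega>"
  shows "norm (transport x - w x *\<^sub>R b) \<le> \<omega> * w x"
proof -
  have i: "integrable lborel (\<lambda>y. U y * r (x - y))" by (rule integrable_conv_r[OF integrable_U])
  have ib: "integrable lborel (\<lambda>y. (U y * r (x - y)) *\<^sub>R b)" using i by (rule integrable_scaleR_left)
  have "transport x - w x *\<^sub>R b = (LBINT y. r (x - y) *\<^sub>R (U y *\<^sub>R drift 0 y)) - (LBINT y. (U y * r (x - y)) *\<^sub>R b)"
    unfolding transport_def w_def using i by simp
  also have "\<dots> = (LBINT y. r (x - y) *\<^sub>R (U y *\<^sub>R drift 0 y) - (U y * r (x - y)) *\<^sub>R b)"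
    by (rule Bochner_Integration.integral_diff[symmetric, OF integrable_transport ib])
  also have "norm \<dots> \<le> (LBINT y. norm (r (x - y) *\<^sub>R (U y *\<^sub>R drift 0 y) - (U y * r (x - y)) *\<^sub>R b))"
    by (rule integral_norm_bound)
  also have "\<dots> \<le> (LBINT y. \<omega> * (U y * r (x - y)))"
  proof (rule integral_mono)
    show "integrable lborel (\<lambda>y. norm (r (x - y) *\<^sub>R (U y *\<^sub>R drift 0 y) - (U y * r (x - y)) *\<^sub>R b))"
      by (intro integrable_norm Bochner_Integration.integrable_diff integrable_transport ib)
    show "integrable lborel (\<lambda>y. \<omega> * (U y * r (x - y)))" using i by simp
    fix y
    show "norm (r (x - y) *\<^sub>R (U y *\<^sub>R drift 0 y) - (U y * r (x - y)) *\<^sub>R b) \<le> \<omega> * (U y * r (x - y))"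
    proof (cases "norm (x - y) < \<epsilon>")
      case True
      have "r (x - y) *\<^sub>R (U y *\<^sub>R drift 0 y) - (U y * r (x - y)) *\<^sub>R b = (U y * r (x - y)) *\<^sub>R (drift 0 y - b)"
        by (simp add: scaleR_right_diff_distrib mult.commute)
      also have "norm \<dots> = U y * r (x - y) * norm (drift 0 y - b)"
        using U_nonneg[of y] nonneg[of "x - y"] by simp
      also have "\<dots> \<le> U y * r (x - y) * \<omega>"
        using U_nonneg[of y] nonneg[of "x - y"] by (intro mult_left_mono assms True) auto
      finally show ?thesis by (simp add: mult_ac)
    qed (simp add: supp)
  qed
  also have "\<dots> = \<omega> * w x" by (simp add: w_def)
  finally show ?thesis .
qed

text \<open>With \<open>f = w / gibbs \<delta>\<close> this is the bounded function \<open>1 / (1 + f)\<close>.\<close>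

definition ratio :: "real \<Rightarrow> 'a \<Rightarrow> real" where
  "ratio \<delta> x = gibbs \<delta> x / (gibbs \<delta> x + w x)"

definition grad_ratio :: "real \<Rightarrow> 'a \<Rightarrow> 'a" where
  "grad_ratio \<delta> x = - (gibbs \<delta> x / (gibbs \<delta> x + w x)\<^sup>2) *\<^sub>R (grad_w x + w x *\<^sub>R drift \<delta> x)"

lemma denominator_pos: "gibbs \<delta> x + w x > 0"
  using gibbs_pos[of \<delta> x] w_nonneg[of x] by linarith

lemma GDERIV_ratio:
  assumes "\<delta> > 0" shows "GDERIV (ratio \<delta>) x :> grad_ratio \<delta> x"
proof -
  let ?E = "gibbs \<delta> x" and ?N = "gibbs \<delta> x + w x"
  have N: "?N \<noteq> 0" using denominator_pos[of \<delta> x] by simp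
  have "GDERIV (\<lambda>x. gibbs \<delta> x * inverse (gibbs \<delta> x + w x)) x :>
      ?E *\<^sub>R (- (inverse ?N)\<^sup>2 *\<^sub>R ((- ?E) *\<^sub>R drift \<delta> x + grad_w x)) + inverse ?N *\<^sub>R ((- ?E) *\<^sub>R drift \<delta> x)"
    by (intro GDERIV_mult GDERIV_inverse GDERIV_add GDERIV_gibbs[OF assms] GDERIV_w N)
  moreover have "?E *\<^sub>R (- (inverse ?N)\<^sup>2 *\<^sub>R ((- ?E) *\<^sub>R drift \<delta> x + grad_w x)) + inverse ?N *\<^sub>R ((- ?E) *\<^sub>R drift \<delta> x)
      = grad_ratio \<delta> x"
    unfolding grad_ratio_def by (rule quotient_gradient[OF N]) simp
  ultimately show ?thesis by (simp add: ratio_def[abs_def] divide_inverse)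
qed

lemma continuous_grad_ratio:
  assumes "\<delta> > 0" shows "continuous_on UNIV (grad_ratio \<delta>)"
proof -
  have "(gibbs \<delta> x + w x)\<^sup>2 \<noteq> 0" for x using denominator_pos[of \<delta> x] by simp
  then show ?thesis
    unfolding grad_ratio_def[abs_def]
    by (intro continuous_intros continuous_gibbs[OF assms] continuous_w continuous_grad_w continuous_drift[OF assms]) auto
qed

lemma continuous_ratio:
  assumes "\<delta> > 0" shows "continuous_on UNIV (ratio \<delta>)"
  by (rule continuous_on_GDERIV[OF GDERIV_ratio[OF assms]])

lemma ratio_bounds: "0 < ratio \<delta> x" "ratio \<delta> x \<le> 1"
  using gibbs_pos[of \<delta> x] w_nonneg[of x] denominator_pos[of \<delta> x]
  by (auto simp: ratio_def pos_divide_le_eq)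

lemma energy_estimate:
  assumes \<delta>: "\<delta> > 0" and \<omega>: "\<omega> \<ge> 0"
    and close: "\<And>x y. norm x \<le> R \<Longrightarrow> norm (x - y) < \<epsilon> \<Longrightarrow> norm (drift 0 y - drift \<delta> x) \<le> \<omega>"
    and \<eta>: "\<And>x. GDERIV \<eta> x :> D x" and contD: "continuous_on UNIV D" and \<eta>0: "\<And>x. 0 \<le> \<eta> x"
    and supp\<eta>: "\<And>x. norm x \<ge> R \<Longrightarrow> \<eta> x = 0" "\<And>x. norm x \<ge> R \<Longrightarrow> D x = 0"
  shows "(LBINT x. gibbs \<delta> x * ((\<eta> x)\<^sup>2 * (norm (grad_ratio \<delta> x))\<^sup>2))
    \<le> (LBINT x. gibbs \<delta> x * (10 * (norm (D x))\<^sup>2 + 4 * \<omega>\<^sup>2 * (\<eta> x)\<^sup>2))"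
proof -
  let ?E = "gibbs \<delta>" and ?P = "ratio \<delta>" and ?a = "grad_ratio \<delta>"
  have cont\<eta>: "continuous_on UNIV \<eta>"
    by (rule continuous_on_GDERIV[OF \<eta>])
  note conts = cont\<eta> contD continuous_gibbs[OF \<delta>] continuous_grad_ratio[OF \<delta>] continuous_ratio[OF \<delta>] continuous_flux
  note int = integrable_if_compact_support[where R="R" and 'a='a]
  define D\<psi> where "D\<psi> x = (\<eta> x)\<^sup>2 *\<^sub>R ?a x + (2 * \<eta> x * ?P x) *\<^sub>R D x" for x
  have "GDERIV (\<lambda>x. (\<eta> x * \<eta> x) * ?P x) x :> (\<eta> x * \<eta> x) *\<^sub>R ?a x + ?P x *\<^sub>R (\<eta> x *\<^sub>R D x + \<eta> x *\<^sub>R D x)" for x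
    by (intro GDERIV_mult \<eta> GDERIV_ratio[OF \<delta>])
  moreover have "(\<eta> x * \<eta> x) *\<^sub>R ?a x + ?P x *\<^sub>R (\<eta> x *\<^sub>R D x + \<eta> x *\<^sub>R D x) = D\<psi> x" for x
    unfolding scaleR_2[symmetric] scaleR_scaleR D\<psi>_def power2_eq_square by (simp only: mult_ac)
  ultimately have g: "GDERIV (\<lambda>x. (\<eta> x * \<eta> x) * ?P x) x :> D\<psi> x" for x by simp
  have cont\<psi>: "continuous_on UNIV D\<psi>"
    unfolding D\<psi>_def[abs_def] by (intro continuous_intros conts)
  have zero: "(LBINT x. flux x \<bullet> D\<psi> x) = 0"
    by (rule integral_flux_gradient[OF g cont\<psi>, of R]) (auto simp: D\<psi>_def supp\<eta>)
  let ?rhs = "\<lambda>x. ?E x * (5 * (norm (D x))\<^sup>2 + 2 * \<omega>\<^sup>2 * (\<eta> x)\<^sup>2)" and ?lhs = "\<lambda>x. ?E x * ((\<eta> x)\<^sup>2 * (norm (?a x))\<^sup>2) / 2"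
  have irhs: "integrable lborel ?rhs"
    by (rule int) (auto intro!: continuous_intros conts simp: supp\<eta>)
  have ilhs: "integrable lborel ?lhs"
    by (rule int) (auto intro!: continuous_intros conts simp: supp\<eta>)
  have pt: "flux x \<bullet> D\<psi> x \<le> ?rhs x - ?lhs x" for x
  proof (cases "norm x \<ge> R")
    case False
    let ?m = "transport x - w x *\<^sub>R drift \<delta> x"
    let ?N = "?E x + w x"
    have N: "?N > 0" by (rule denominator_pos)
    have PN: "?E x / ?P x = ?N" using N gibbs_pos[of \<delta> x] by (simp add: ratio_def)
    have "norm ?m \<le> \<omega> * w x"
      by (rule transport_close) (use close False in auto)
    also have "\<dots> \<le> \<omega> * (?E x / ?P x)"
      unfolding PN using \<omega> gibbs_pos[of \<delta> x] by (intro mult_left_mono) auto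
    finally have m: "norm ?m \<le> \<omega> * (?E x / ?P x)" .
    \<comment> \<open>the gradient of the ratio recovers the flux up to the defect ?m\<close>
    have "?E x / (?P x)\<^sup>2 * (?E x / ?N\<^sup>2) = 1"
      using N gibbs_pos[of \<delta> x] by (simp add: ratio_def power_divide power2_eq_square)
    then have "(?E x / (?P x)\<^sup>2) *\<^sub>R ?a x = - (grad_w x + w x *\<^sub>R drift \<delta> x)"
      unfolding grad_ratio_def scaleR_scaleR mult_minus_right by (simp only: scaleR_minus_left scaleR_one)
    then have "flux x = ?m - (?E x / (?P x)\<^sup>2) *\<^sub>R ?a x"
      by (simp add: flux_def)
    from caccioppoli_pointwise[OF gibbs_pos ratio_bounds \<eta>0 \<omega> m this, of x "D x"]
    show ?thesis unfolding D\<psi>_def .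
  qed (simp add: D\<psi>_def supp\<eta>)
  have "0 \<le> (LBINT x. ?rhs x - ?lhs x)"
    unfolding zero[symmetric]
  proof (rule integral_mono)
    show "integrable lborel (\<lambda>x. flux x \<bullet> D\<psi> x)"
      by (rule int) (auto intro!: continuous_intros conts cont\<psi> simp: D\<psi>_def supp\<eta>)
    show "integrable lborel (\<lambda>x. ?rhs x - ?lhs x)" by (rule Bochner_Integration.integrable_diff[OF irhs ilhs])
  qed (rule pt)
  also have "\<dots> = (LBINT x. ?rhs x) - (LBINT x. ?lhs x)"
    by (rule Bochner_Integration.integral_diff[OF irhs ilhs])
  finally have "2 * (LBINT x. ?lhs x) \<le> 2 * (LBINT x. ?rhs x)" by simp
  moreover have "2 * (LBINT x. ?lhs x) = (LBINT x. ?E x * ((\<eta> x)\<^sup>2 * (norm (?a x))\<^sup>2))" by simp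
  moreover have "2 * (LBINT x. ?rhs x) = (LBINT x. 2 * ?rhs x)"
    by (rule integral_mult_right_zero[symmetric])
  moreover have "(\<lambda>x. 2 * ?rhs x) = (\<lambda>x. ?E x * (10 * (norm (D x))\<^sup>2 + 4 * \<omega>\<^sup>2 * (\<eta> x)\<^sup>2))"
    by (simp add: fun_eq_iff algebra_simps)
  ultimately show ?thesis by simp
qed

text \<open>The difference of two quotients \<open>E / (E + U)\<close> is linear in the differences of \<open>E\<close> and of \<open>U\<close>, with
  coefficients that the denominators keep bounded.\<close>

lemma ratio_close:
  assumes "\<delta> \<ge> 0"
  shows "\<bar>ratio \<delta> x - gibbs 0 x / (gibbs 0 x + U x)\<bar>
    \<le> sqrt \<delta> * (riesz_bound + mass) + \<bar>w x - U x\<bar> / gibbs 0 x"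
proof -
  let ?E = "gibbs \<delta> x" and ?F = "gibbs 0 x"
  have pos: "?E > 0" "?F > 0" "?E + w x > 0" "?F + U x > 0"
    by (simp_all add: add_pos_nonneg gibbs_pos w_nonneg U_nonneg)
  have E: "?F \<le> ?E" by (rule gibbs_mono[OF assms])
  have "ratio \<delta> x - ?F / (?F + U x) = ((?E - ?F) * U x + ?F * (U x - w x)) / ((?E + w x) * (?F + U x))"
    using pos by (simp add: ratio_def diff_frac_eq algebra_simps)
  also have "\<bar>\<dots>\<bar> = \<bar>(?E - ?F) * U x + ?F * (U x - w x)\<bar> / ((?E + w x) * (?F + U x))"
    using pos by simp
  also have "\<dots> \<le> ((?E - ?F) * U x + ?F * \<bar>U x - w x\<bar>) / ((?E + w x) * (?F + U x))"
  proof (rule divide_right_mono)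
    show "\<bar>(?E - ?F) * U x + ?F * (U x - w x)\<bar> \<le> (?E - ?F) * U x + ?F * \<bar>U x - w x\<bar>"
      using abs_triangle_ineq[of "(?E - ?F) * U x" "?F * (U x - w x)"] E U_nonneg[of x] pos
      by (simp add: abs_mult)
  qed (use pos in auto)
  also have "\<dots> = (?E - ?F) / (?E + w x) * (U x / (?F + U x)) + (?F / (?F + U x)) * (\<bar>U x - w x\<bar> / (?E + w x))"
    by (simp add: add_divide_distrib)
  also have "\<dots> \<le> (?E - ?F) / ?E * 1 + 1 * (\<bar>U x - w x\<bar> / ?F)"
    using pos E U_nonneg[of x] w_nonneg[of x]
    by (intro add_mono mult_mono divide_left_mono) (auto simp: divide_le_eq_1_pos)
  also have "(?E - ?F) / ?E \<le> sqrt \<delta> * (riesz_bound + mass)"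
    using gibbs_diff_le[OF assms, of x] pos by (simp add: pos_divide_le_eq mult.commute)
  finally show ?thesis by (simp add: abs_minus_commute)
qed

end

lemma small_parameter_exists:
  fixes b c s t :: real
  assumes "b \<ge> 0" "c \<ge> 0" "s > 0" "t > 0"
  obtains \<delta> where "0 < \<delta>" "\<delta> \<le> 1" "\<delta> powr (1/4) * b \<le> s" "sqrt \<delta> * c \<le> t"
proof -
  define q where "q = min 1 (min (s / (b + 1)) (t / (c + 1)))"
  have q: "q > 0" "q \<le> 1" "q \<le> s / (b + 1)" "q \<le> t / (c + 1)"
    using assms by (auto simp: q_def)
  have "q * b \<le> s / (b + 1) * (b + 1)" using q assms by (intro mult_mono) auto
  then have 1: "q * b \<le> s" using assms by simp
  have "q * c \<le> t / (c + 1) * (c + 1)" using q assms by (intro mult_mono) auto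
  then have 2: "q * c \<le> t" using assms by simp
  have 3: "(q ^ 4) powr (1/4) = q"
    using q powr_powr[of q 4 "1/4"] by simp
  have "sqrt (q ^ 4) = sqrt ((q\<^sup>2)\<^sup>2)" by simp
  also have "\<dots> = q\<^sup>2" by (rule real_sqrt_unique) auto
  also have "\<dots> \<le> q" using q by (simp add: power2_eq_square mult_left_le_one_le)
  finally have "sqrt (q ^ 4) * c \<le> q * c" using assms by (intro mult_right_mono) auto
  with 1 2 3 q show thesis by (intro that[of "q ^ 4"]) (auto simp: power_le_one)
qed

lemma gaussian_times_volume_tendsto_0:
  "((\<lambda>R. exp (- R\<^sup>2 / 8) * measure lborel (cball (0::'a::euclidean_space) (2 * R))) \<longlongrightarrow> 0) at_top"
proof -
  let ?d = "DIM('a)"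
  define K where "K = unit_ball_vol (real ?d) * 16 ^ ?d"
  have "filterlim (\<lambda>R::real. (1/8) * R\<^sup>2) at_top at_top"
    by (rule filterlim_tendsto_pos_mult_at_top[OF tendsto_const]) (simp_all add: filterlim_pow_at_top filterlim_ident)
  then have sq: "filterlim (\<lambda>R::real. R\<^sup>2 / 8) at_top at_top" by simp
  have "((\<lambda>R::real. (R\<^sup>2 / 8) ^ ?d / exp (R\<^sup>2 / 8)) \<longlongrightarrow> 0) at_top"
    by (rule filterlim_compose[OF tendsto_power_div_exp_0 sq])
  then have "((\<lambda>R::real. K * ((R\<^sup>2 / 8) ^ ?d / exp (R\<^sup>2 / 8))) \<longlongrightarrow> K * 0) at_top"
    by (intro tendsto_intros)
  then have lim: "((\<lambda>R::real. K * ((R\<^sup>2 / 8) ^ ?d / exp (R\<^sup>2 / 8))) \<longlongrightarrow> 0) at_top" by simp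
  have K: "unit_ball_vol (real ?d) \<ge> 0" by simp
  show ?thesis
  proof (rule tendsto_sandwich[OF _ _ tendsto_const lim])
    show "\<forall>\<^sub>F R in at_top. exp (- R\<^sup>2 / 8) * measure lborel (cball (0::'a) (2 * R)) \<le> K * ((R\<^sup>2 / 8) ^ ?d / exp (R\<^sup>2 / 8))"
      using eventually_ge_at_top[of 1]
    proof eventually_elim
      case (elim R)
      have "2 * R \<le> 16 * (R\<^sup>2 / 8)" using elim by (simp add: power2_eq_square)
      then have "(2 * R) ^ ?d \<le> (16 * (R\<^sup>2 / 8)) ^ ?d" using elim by (intro power_mono) auto
      also have "\<dots> = 16 ^ ?d * (R\<^sup>2 / 8) ^ ?d" by (rule power_mult_distrib)
      finally have "unit_ball_vol (real ?d) * (2 * R) ^ ?d \<le> unit_ball_vol (real ?d) * (16 ^ ?d * (R\<^sup>2 / 8) ^ ?d)"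
        by (intro mult_left_mono K)
      then have "measure lborel (cball (0::'a) (2 * R)) \<le> K * (R\<^sup>2 / 8) ^ ?d"
        using elim by (simp only: content_cball K_def mult.assoc)
      then have "exp (- R\<^sup>2 / 8) * measure lborel (cball (0::'a) (2 * R)) \<le> exp (- R\<^sup>2 / 8) * (K * (R\<^sup>2 / 8) ^ ?d)"
        by (rule mult_left_mono) simp
      moreover have "exp (- R\<^sup>2 / 8) = inverse (exp (R\<^sup>2 / 8))" by (simp add: exp_minus[symmetric])
      ultimately show ?case by (simp only: divide_inverse mult_ac)
    qed
  qed auto
qed

context stationary_density
begin

text \<open>The parameters are chosen in the order radius, defect, regularisation, mollification: each may depend
  on the ones before, and the bounds used for the earlier ones are uniform in the later ones.\<close>

lemma approximating_ratio:
  assumes R: "R \<ge> 1" and \<kappa>: "\<kappa> > 0"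
  shows "\<exists>p a. (\<forall>x. GDERIV p x :> a x) \<and> continuous_on UNIV a \<and>
      (LBINT x. indicator (cball 0 R) x * (norm (a x))\<^sup>2) \<le> \<kappa> \<and>
      (LBINT x. indicator (cball 0 R) x * \<bar>p x - gibbs 0 x / (gibbs 0 x + U x)\<bar>) \<le> \<kappa>"
proof -
  define vol where "vol R = measure lborel (cball (0::'a) R)" for R
  have vol: "vol R \<ge> 0" for R by (simp add: vol_def)
  define e0 where "e0 = exp (- riesz_bound - R\<^sup>2 / 4)"
  have e0: "e0 > 0" by (simp add: e0_def)
  have e0_le: "e0 \<le> gibbs 0 x" if "norm x \<le> R" for x
  proof -
    have "(norm x)\<^sup>2 \<le> R\<^sup>2" using that by (intro power_mono) auto
    then have "e0 \<le> exp (- riesz_bound - (norm x)\<^sup>2 / 4)" by (simp add: e0_def)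
    also have "\<dots> \<le> gibbs 0 x" by (rule gibbs_0_ge)
    finally show ?thesis .
  qed
  define C0 where "C0 = exp (2 * mass\<^sup>2 + first_moment)"
  have C0: "C0 > 0" by (simp add: C0_def)
  \<comment> \<open>the cutoff is placed so far out that the Gaussian tail outweighs its gradient\<close>
  define \<tau> where "\<tau> = \<kappa> * e0 / (2 * 2560 * C0)"
  have \<tau>: "\<tau> > 0" using \<kappa> e0 C0 by (simp add: \<tau>_def)
  have "\<forall>\<^sub>F R' in at_top. exp (- R'\<^sup>2 / 8) * measure lborel (cball (0::'a) (2 * R')) < \<tau>"
    by (rule order_tendstoD(2)[OF gaussian_times_volume_tendsto_0 \<tau>])
  then have "\<forall>\<^sub>F R' in at_top. exp (- R'\<^sup>2 / 8) * vol (2 * R') < \<tau> \<and> R' \<ge> R"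
    using eventually_ge_at_top[of R] by eventually_elim (simp add: vol_def)
  then obtain R' where R': "exp (- R'\<^sup>2 / 8) * vol (2 * R') < \<tau>" "R' \<ge> R"
    by (auto dest: eventually_happens)
  obtain \<eta> :: "'a \<Rightarrow> real" and D where \<eta>: "\<And>x. GDERIV \<eta> x :> D x" and contD: "continuous_on UNIV D"
    and \<eta>0: "\<And>x. 0 \<le> \<eta> x" and \<eta>1: "\<And>x. \<eta> x \<le> 1"
    and in\<eta>: "\<And>x. norm x \<le> R' \<Longrightarrow> \<eta> x = 1" "\<And>x. norm x \<le> R' \<Longrightarrow> D x = 0"
    and out\<eta>: "\<And>x. norm x \<ge> 2 * R' \<Longrightarrow> \<eta> x = 0" "\<And>x. norm x \<ge> 2 * R' \<Longrightarrow> D x = 0"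
    and D16: "\<And>x. norm (D x) \<le> 16"
    by (rule cutoff_exists[OF order_trans[OF R R'(2)]]) (rule that, assumption+)
  have cont\<eta>: "continuous_on UNIV \<eta>"
    by (rule continuous_on_GDERIV[OF \<eta>])
  \<comment> \<open>the admissible defect of the drift; adding 1 keeps the denominator positive\<close>
  define V where "V = vol (2 * R')"
  have V: "V \<ge> 0" using vol by (simp add: V_def)
  define q where "q = 4 * (C0 * V)"
  have q: "q \<ge> 0" using C0 V by (simp add: q_def)
  define \<omega> where "\<omega> = sqrt (\<kappa> * e0 / (2 * (q + 1)))"
  have \<omega>: "\<omega> > 0" using \<kappa> e0 q by (simp add: \<omega>_def)
  have "\<omega>\<^sup>2 * q \<le> \<kappa> * e0 / 2"
  proof -
    have "\<omega>\<^sup>2 = \<kappa> * e0 / (2 * (q + 1))"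
      unfolding \<omega>_def using \<kappa> e0 q by (intro real_sqrt_pow2) auto
    then have "\<omega>\<^sup>2 * q = \<kappa> * e0 / 2 * (q / (q + 1))" by simp
    also have "\<dots> \<le> \<kappa> * e0 / 2 * 1"
      using \<kappa> e0 q by (intro mult_left_mono) (auto simp: divide_le_eq_1_pos)
    finally show ?thesis by simp
  qed
  then have \<omega>2: "4 * \<omega>\<^sup>2 * (C0 * V) \<le> \<kappa> * e0 / 2" by (simp add: q_def mult_ac)
  \<comment> \<open>half of the defect is spent on regularising the kernel\<close>
  have rb: "riesz_bound + mass \<ge> 0" using riesz_bound_nonneg mass_nonneg by simp
  have "(riesz_bound + mass) * vol R \<ge> 0" "\<omega> / 2 > 0" "\<kappa> / 2 > 0" using rb vol[of R] \<omega> \<kappa> by auto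
  then obtain \<delta> where \<delta>: "0 < \<delta>" "\<delta> \<le> 1" "\<delta> powr (1/4) * riesz_bound \<le> \<omega> / 2"
      "sqrt \<delta> * ((riesz_bound + mass) * vol R) \<le> \<kappa> / 2"
    using small_parameter_exists[OF riesz_bound_nonneg] by metis
  \<comment> \<open>the other half is spent on the oscillation of the regularised drift at the mollification scale\<close>
  have "uniformly_continuous_on (cball 0 (2 * R' + 1)) (drift \<delta>)"
    by (intro compact_uniformly_continuous continuous_on_subset[OF continuous_drift[OF \<delta>(1)]]) auto
  then obtain d1 where d1: "d1 > 0" "\<And>x y. x \<in> cball 0 (2 * R' + 1) \<Longrightarrow> y \<in> cball 0 (2 * R' + 1) \<Longrightarrow>
      dist y x < d1 \<Longrightarrow> dist (drift \<delta> y) (drift \<delta> x) < \<omega> / 2"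
    unfolding uniformly_continuous_on_def using \<omega> by (meson half_gt_zero)
  have "\<kappa> * e0 / 2 > 0" using \<kappa> e0 by simp
  then obtain d2 where d2: "d2 > 0" "\<And>h. norm h < d2 \<Longrightarrow> (LBINT x. \<bar>U (h + x) - U x\<bar>) < \<kappa> * e0 / 2"
    using L1_translation[OF integrable_U] by blast
  define \<epsilon> where "\<epsilon> = min 1 (min d1 d2)"
  have \<epsilon>: "\<epsilon> > 0" using d1 d2 by (simp add: \<epsilon>_def)
  obtain r :: "'a \<Rightarrow> real" and G H where "mollifier \<epsilon> r G H"
    using mollifier_exists[OF \<epsilon>] by blast
  then interpret mollifier \<epsilon> r G H .
  interpret mollified_density U \<epsilon> r G H ..
  have close: "norm (drift 0 y - drift \<delta> x) \<le> \<omega>" if "norm x \<le> 2 * R'" "norm (x - y) < \<epsilon>" for x y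
  proof -
    have "norm y \<le> norm x + norm (x - y)" using norm_triangle_ineq4[of x "x - y"] by simp
    then have "dist (drift \<delta> y) (drift \<delta> x) < \<omega> / 2"
      using that by (intro d1) (auto simp: \<epsilon>_def dist_norm norm_minus_commute)
    moreover have "norm (drift 0 y - drift \<delta> y) \<le> \<omega> / 2"
      using drift_diff_le[OF \<delta>(1), of y] \<delta>(3) by simp
    ultimately show ?thesis
      using norm_triangle_ineq[of "drift 0 y - drift \<delta> y" "drift \<delta> y - drift \<delta> x"] by (simp add: dist_norm)
  qed
  let ?E = "gibbs \<delta>" and ?a = "grad_ratio \<delta>" and ?I = "\<lambda>R. indicator (cball 0 R) :: 'a \<Rightarrow> real"
  note conts = cont\<eta> contD continuous_gibbs[OF \<delta>(1)] continuous_grad_ratio[OF \<delta>(1)] continuous_ratio[OF \<delta>(1)]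
  note int = integrable_if_compact_support[where R="2 * R'" and 'a='a]
  have Eup: "?E x \<le> C0 * exp (- (norm x)\<^sup>2 / 8)" for x
    unfolding C0_def using \<delta> by (intro gibbs_le) auto
  have 1: "(LBINT x. ?I R x * (norm (?a x))\<^sup>2) \<le> \<kappa>"
  proof -
    have "e0 * (LBINT x. ?I R x * (norm (?a x))\<^sup>2) = (LBINT x. e0 * (?I R x * (norm (?a x))\<^sup>2))"
      by (rule integral_mult_right_zero[symmetric])
    also have "\<dots> \<le> (LBINT x. ?E x * ((\<eta> x)\<^sup>2 * (norm (?a x))\<^sup>2))"
    proof (rule integral_mono)
      show "integrable lborel (\<lambda>x. e0 * (?I R x * (norm (?a x))\<^sup>2))"
        using integrable_on_cball[OF continuous_on_power[OF continuous_on_norm[OF conts(4)]], of R 2] by simp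
      show "integrable lborel (\<lambda>x. ?E x * ((\<eta> x)\<^sup>2 * (norm (?a x))\<^sup>2))"
        by (rule int) (auto intro!: continuous_intros conts simp: out\<eta>)
      fix x
      show "e0 * (?I R x * (norm (?a x))\<^sup>2) \<le> ?E x * ((\<eta> x)\<^sup>2 * (norm (?a x))\<^sup>2)"
      proof (cases "norm x \<le> R")
        case True
        have "e0 \<le> ?E x" using e0_le[OF True] gibbs_mono[of \<delta> x] \<delta> by linarith
        then have "e0 * (norm (?a x))\<^sup>2 \<le> ?E x * (norm (?a x))\<^sup>2" by (intro mult_right_mono) auto
        then show ?thesis using True in\<eta>[of x] R' by simp
      next
        case False
        then show ?thesis using gibbs_pos[of \<delta> x] by simp
      qed
    qed
    also have "\<dots> \<le> (LBINT x. ?E x * (10 * (norm (D x))\<^sup>2 + 4 * \<omega>\<^sup>2 * (\<eta> x)\<^sup>2))"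
      by (rule energy_estimate[OF \<delta>(1) _ close \<eta> contD \<eta>0 out\<eta>]) (use \<omega> in auto)
    also have "\<dots> \<le> (LBINT x. (2560 * C0 * exp (- R'\<^sup>2 / 8) + 4 * \<omega>\<^sup>2 * C0) * ?I (2 * R') x)"
    proof (rule integral_mono)
      show "integrable lborel (\<lambda>x. ?E x * (10 * (norm (D x))\<^sup>2 + 4 * \<omega>\<^sup>2 * (\<eta> x)\<^sup>2))"
        by (rule int) (auto intro!: continuous_intros conts simp: out\<eta>)
      show "integrable lborel (\<lambda>x. (2560 * C0 * exp (- R'\<^sup>2 / 8) + 4 * \<omega>\<^sup>2 * C0) * ?I (2 * R') x)"
        by (intro integrable_mult_right integrable_indicator_cball)
      fix x
      show "?E x * (10 * (norm (D x))\<^sup>2 + 4 * \<omega>\<^sup>2 * (\<eta> x)\<^sup>2)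
          \<le> (2560 * C0 * exp (- R'\<^sup>2 / 8) + 4 * \<omega>\<^sup>2 * C0) * ?I (2 * R') x"
      proof (cases "norm x \<le> 2 * R'")
        case True
        have a: "?E x * (10 * (norm (D x))\<^sup>2) \<le> 2560 * C0 * exp (- R'\<^sup>2 / 8)"
        proof (cases "norm x \<le> R'")
          case True
          then show ?thesis using in\<eta>[of x] C0 by simp
        next
          case False
          then have "R'\<^sup>2 \<le> (norm x)\<^sup>2" using R R'(2) by (intro power_mono) auto
          then have "C0 * exp (- (norm x)\<^sup>2 / 8) \<le> C0 * exp (- R'\<^sup>2 / 8)" using C0 by simp
          then have E: "?E x \<le> C0 * exp (- R'\<^sup>2 / 8)" using Eup[of x] by linarith
          have "(norm (D x))\<^sup>2 \<le> 16\<^sup>2" by (intro power_mono D16) auto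
          then have "?E x * (10 * (norm (D x))\<^sup>2) \<le> (C0 * exp (- R'\<^sup>2 / 8)) * 2560"
            using E C0 by (intro mult_mono) auto
          then show ?thesis by (simp add: mult_ac)
        qed
        have "exp (- (norm x)\<^sup>2 / 8) \<le> 1" by simp
        then have "C0 * exp (- (norm x)\<^sup>2 / 8) \<le> C0 * 1" using C0 by (intro mult_left_mono) auto
        then have E: "?E x \<le> C0" using Eup[of x] by linarith
        have "(\<eta> x)\<^sup>2 \<le> 1" using \<eta>0 \<eta>1 by (intro power_le_one) auto
        then have \<eta>2: "4 * \<omega>\<^sup>2 * (\<eta> x)\<^sup>2 \<le> 4 * \<omega>\<^sup>2 * 1" by (intro mult_left_mono) auto
        have "?E x * (4 * \<omega>\<^sup>2 * (\<eta> x)\<^sup>2) \<le> C0 * (4 * \<omega>\<^sup>2 * 1)"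
          by (rule mult_mono[OF E \<eta>2]) (use C0 in auto)
        also have "\<dots> = 4 * \<omega>\<^sup>2 * C0" by simp
        finally have "?E x * (10 * (norm (D x))\<^sup>2) + ?E x * (4 * \<omega>\<^sup>2 * (\<eta> x)\<^sup>2)
            \<le> 2560 * C0 * exp (- R'\<^sup>2 / 8) + 4 * \<omega>\<^sup>2 * C0"
          using a by (rule add_mono[rotated])
        then show ?thesis using True by (simp only: distrib_left) simp
      next
        case False
        then show ?thesis using out\<eta>[of x] by simp
      qed
    qed
    also have "\<dots> = (2560 * C0 * exp (- R'\<^sup>2 / 8) + 4 * \<omega>\<^sup>2 * C0) * V"
      by (simp add: V_def vol_def)
    also have "\<dots> = 2560 * C0 * (exp (- R'\<^sup>2 / 8) * V) + 4 * \<omega>\<^sup>2 * (C0 * V)"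
      by (simp only: distrib_right mult.assoc)
    also have "\<dots> \<le> 2560 * C0 * \<tau> + \<kappa> * e0 / 2"
    proof (rule add_mono[OF _ \<omega>2])
      have "exp (- R'\<^sup>2 / 8) * V \<le> \<tau>" using R'(1) unfolding V_def by simp
      then show "2560 * C0 * (exp (- R'\<^sup>2 / 8) * V) \<le> 2560 * C0 * \<tau>"
        using C0 by (intro mult_left_mono) auto
    qed
    also have "\<dots> = e0 * \<kappa>" using C0 by (simp add: \<tau>_def)
    finally show ?thesis using e0 by (simp only: mult_le_cancel_left_pos)
  qed
  have L1: "integrable lborel (\<lambda>x. w x - U x)" "(LBINT x. \<bar>w x - U x\<bar>) \<le> \<kappa> * e0 / 2"
    using L1_mollification[OF integrable_U, of "\<kappa> * e0 / 2"] d2(2) \<kappa> e0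
    unfolding w_def by (simp_all add: \<epsilon>_def less_imp_le)
  have 2: "(LBINT x. ?I R x * \<bar>ratio \<delta> x - gibbs 0 x / (gibbs 0 x + U x)\<bar>) \<le> \<kappa>"
  proof -
    let ?s = "sqrt \<delta> * (riesz_bound + mass)"
    have "(LBINT x. ?I R x * \<bar>ratio \<delta> x - gibbs 0 x / (gibbs 0 x + U x)\<bar>)
        \<le> (LBINT x. ?s * ?I R x + \<bar>w x - U x\<bar> / e0)"
    proof (rule integral_mono)
      have [measurable]: "ratio \<delta> \<in> borel_measurable borel"
        using conts(5) by (rule borel_measurable_continuous_onI)
      show "integrable lborel (\<lambda>x. ?I R x * \<bar>ratio \<delta> x - gibbs 0 x / (gibbs 0 x + U x)\<bar>)"
      proof (rule integrable_bounded_cball)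
        fix x
        have "0 \<le> gibbs 0 x / (gibbs 0 x + U x)" "gibbs 0 x / (gibbs 0 x + U x) \<le> 1"
          using gibbs_pos[of 0 x] U_nonneg[of x] by (auto simp: divide_le_eq_1)
        then show "\<bar>\<bar>ratio \<delta> x - gibbs 0 x / (gibbs 0 x + U x)\<bar>\<bar> \<le> 1"
          using ratio_bounds[of \<delta> x] by linarith
      qed measurable
      show "integrable lborel (\<lambda>x. ?s * ?I R x + \<bar>w x - U x\<bar> / e0)"
        by (intro Bochner_Integration.integrable_add integrable_mult_right integrable_indicator_cball
            integrable_divide integrable_abs L1)
      fix x
      show "?I R x * \<bar>ratio \<delta> x - gibbs 0 x / (gibbs 0 x + U x)\<bar> \<le> ?s * ?I R x + \<bar>w x - U x\<bar> / e0"
      proof (cases "norm x \<le> R")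
        case True
        have "\<bar>w x - U x\<bar> / gibbs 0 x \<le> \<bar>w x - U x\<bar> / e0"
          using e0 e0_le[OF True] by (intro divide_left_mono) (auto intro: mult_pos_pos gibbs_pos)
        then show ?thesis using True ratio_close[of \<delta> x] \<delta> by simp
      next
        case False
        then show ?thesis using e0 by simp
      qed
    qed
    also have "\<dots> = (LBINT x. ?s * ?I R x) + (LBINT x. \<bar>w x - U x\<bar> / e0)"
      by (intro Bochner_Integration.integral_add integrable_mult_right integrable_indicator_cball
            integrable_divide integrable_abs L1)
    also have "\<dots> = sqrt \<delta> * ((riesz_bound + mass) * vol R) + (LBINT x. \<bar>w x - U x\<bar>) / e0"
      by (simp add: vol_def mult_ac)
    also have "\<dots> \<le> \<kappa> / 2 + (\<kappa> * e0 / 2) / e0"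
      using \<delta>(4) L1(2) e0 by (intro add_mono divide_right_mono) auto
    also have "\<dots> = \<kappa>" using e0 by simp
    finally show ?thesis .
  qed
  show ?thesis
    by (intro exI[of _ "ratio \<delta>"] exI[of _ ?a] conjI allI GDERIV_ratio[OF \<delta>(1)]
        continuous_grad_ratio[OF \<delta>(1)] 1 2)
qed

lemma stationary_density_is_gibbs: "\<exists>k. AE x in lborel. U x = k * gibbs 0 x"
proof -
  define P where "P x = gibbs 0 x / (gibbs 0 x + U x)" for x
  have [measurable]: "P \<in> borel_measurable borel" unfolding P_def[abs_def] by measurable
  have bound: "\<bar>P x\<bar> \<le> 1" for x
  proof -
    have "0 \<le> P x" "P x \<le> 1"
      using gibbs_pos[of 0 x] U_nonneg[of x] by (auto simp: P_def divide_le_eq_1)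
    then show ?thesis by simp
  qed
  have "\<exists>c. AE x in lborel. P x = c"
  proof (rule constant_if_approximable_with_small_gradient[OF _ bound])
    show "P \<in> borel_measurable borel" by measurable
  qed (unfold P_def, rule approximating_ratio)
  then obtain c where "AE x in lborel. P x = c" by blast
  then have "AE x in lborel. U x = (1 / c - 1) * gibbs 0 x"
  proof eventually_elim
    case (elim x)
    have pos: "gibbs 0 x > 0" "gibbs 0 x + U x > 0" by (simp_all add: gibbs_pos U_nonneg add_pos_nonneg)
    then have "1 / c = (gibbs 0 x + U x) / gibbs 0 x" unfolding elim[symmetric] P_def by simp
    then show ?case using pos by (simp add: field_simps)
  qed
  then show ?thesis by blast
qed

end

section \<open>The logarithmic energy of neutral charges\<close>

text \<open>Fubini: a mixture of kernels with nonnegative energy has nonnegative energy. It is applied twice, to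
  write a Gaussian as a convolution square and to write the logarithm as a mixture of Gaussians.\<close>

lemma quadratic_form_mixture_nonneg:
  fixes m :: "'p::euclidean_space \<Rightarrow> real" and \<kappa> :: "'b::euclidean_space \<Rightarrow> 'p \<Rightarrow> real"
  assumes [measurable]: "m \<in> borel_measurable borel" "(\<lambda>(p, t). \<kappa> t p) \<in> borel_measurable (borel \<Otimes>\<^sub>M borel)"
    and int: "\<And>p. integrable lborel (\<lambda>t. \<kappa> t p)"
    and abs: "integrable lborel (\<lambda>p. m p * (LBINT t. \<bar>\<kappa> t p\<bar>))"
    and pos: "\<And>t. 0 \<le> (LBINT p. m p * \<kappa> t p)"
  shows "0 \<le> (LBINT p. m p * (LBINT t. \<kappa> t p))"
proof -
  have \<kappa>m [measurable]: "(\<lambda>x. \<kappa> (snd x) (fst x)) \<in> borel_measurable (borel \<Otimes>\<^sub>M borel)"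
    using assms(2) by (simp add: case_prod_beta)
  have "integrable (lborel \<Otimes>\<^sub>M lborel) (\<lambda>x. m (fst x) * \<kappa> (snd x) (fst x))"
  proof (rule lborel_pair.Fubini_integrable)
    have "(\<lambda>x. m (fst x) * \<kappa> (snd x) (fst x)) \<in> borel_measurable (borel \<Otimes>\<^sub>M borel)" by measurable
    then show "(\<lambda>x. m (fst x) * \<kappa> (snd x) (fst x)) \<in> borel_measurable (lborel \<Otimes>\<^sub>M lborel)"
      by (simp cong: measurable_cong_sets sets_pair_measure_cong)
    have "(LBINT t. norm (m p * \<kappa> t p)) = norm (m p * (LBINT t. \<bar>\<kappa> t p\<bar>))" for p
    proof -
      have "(LBINT t. \<bar>\<kappa> t p\<bar>) \<ge> 0" by (intro integral_nonneg_AE) auto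
      then show ?thesis by (simp add: abs_mult)
    qed
    then show "integrable lborel (\<lambda>p. LBINT t. norm (m (fst (p, t)) * \<kappa> (snd (p, t)) (fst (p, t))))"
      using integrable_norm[OF abs] by simp
    show "AE p in lborel. integrable lborel (\<lambda>t. m (fst (p, t)) * \<kappa> (snd (p, t)) (fst (p, t)))"
      using int by (intro AE_I2) simp
  qed
  then have "integrable (lborel \<Otimes>\<^sub>M lborel) (\<lambda>(p, t). m p * \<kappa> t p)"
    by (simp add: case_prod_unfold)
  from lborel_pair.Fubini_integral[OF this]
  have "(LBINT p. m p * (LBINT t. \<kappa> t p)) = (LBINT t. (LBINT p. m p * \<kappa> t p))"
    by simp
  also have "\<dots> \<ge> 0" by (intro integral_nonneg_AE AE_I2 pos)
  finally show ?thesis .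
qed

lemma integrable_tensor:
  fixes f g :: "'a::euclidean_space \<Rightarrow> real"
  assumes f: "integrable lborel f" and g: "integrable lborel g"
  shows "integrable lborel (\<lambda>p::'a \<times> 'a. f (fst p) * g (snd p))"
    and "(\<integral>p. f (fst p) * g (snd p) \<partial>(lborel :: ('a \<times> 'a) measure)) = (LBINT x. f x) * (LBINT x. g x)"
proof -
  have [measurable]: "f \<in> borel_measurable borel" "g \<in> borel_measurable borel" using f g by auto
  have i: "integrable (lborel \<Otimes>\<^sub>M lborel) (\<lambda>p. f (fst p) * g (snd p))"
  proof (rule lborel_pair.Fubini_integrable)
    show "(\<lambda>p. f (fst p) * g (snd p)) \<in> borel_measurable (lborel \<Otimes>\<^sub>M lborel)" by measurable
    show "integrable lborel (\<lambda>x. LBINT y. norm (f (fst (x, y)) * g (snd (x, y))))"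
      using f by (simp add: abs_mult)
    show "AE x in lborel. integrable lborel (\<lambda>y. f (fst (x, y)) * g (snd (x, y)))"
      using g by (intro AE_I2) simp
  qed
  then show "integrable lborel (\<lambda>p::'a \<times> 'a. f (fst p) * g (snd p))" by (simp add: lborel_prod)
  show "(\<integral>p. f (fst p) * g (snd p) \<partial>(lborel :: ('a \<times> 'a) measure)) = (LBINT x. f x) * (LBINT x. g x)"
    using lborel_pair.integral_fst'[OF i] by (simp add: lborel_prod)
qed

lemma AE_lborel_off_diagonal: "AE p in (lborel :: ('a::euclidean_space \<times> 'a) measure). fst p \<noteq> snd p"
proof -
  have "AE p in (lborel :: 'a measure) \<Otimes>\<^sub>M lborel. fst p \<noteq> snd p"
  proof (rule lborel_pair.AE_pair_measure)
    have "{p :: 'a \<times> 'a. fst p \<noteq> snd p} \<in> sets borel"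
      by (intro borel_open open_Collect_neq continuous_intros)
    then show "{p \<in> space (lborel \<Otimes>\<^sub>M lborel). fst p \<noteq> snd (p :: 'a \<times> 'a)} \<in> sets (lborel \<Otimes>\<^sub>M lborel)"
      unfolding lborel_prod by simp
    show "AE x in lborel. AE y in lborel. fst (x, y) \<noteq> (snd (x, y) :: 'a)"
    proof (rule AE_I2)
      fix x :: 'a
      show "AE y in lborel. fst (x, y) \<noteq> (snd (x, y) :: 'a)"
        using AE_lborel_singleton[of x] by eventually_elim auto
    qed
  qed
  then show ?thesis unfolding lborel_prod .
qed

subsection \<open>Gaussian kernels\<close>

lemma integrable_gaussian:
  assumes s: "s > 0"
  shows "integrable lborel (\<lambda>z::'a::euclidean_space. exp (- s * (z \<bullet> z)))"
proof (rule integrableI_nonneg)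
  have one: "(\<integral>\<^sup>+t. ennreal (exp (- s * t\<^sup>2)) \<partial>lborel) < \<infinity>"
  proof -
    define \<sigma> where "\<sigma> = 1 / sqrt (2 * s)"
    have \<sigma>: "\<sigma> > 0" "2 * \<sigma>\<^sup>2 = 1 / s" using s by (auto simp: \<sigma>_def power_divide)
    have eq: "exp (- s * t\<^sup>2) = sqrt (2 * pi * \<sigma>\<^sup>2) * normal_density 0 \<sigma> t" for t
    proof -
      have "- (t - 0)\<^sup>2 / (2 * \<sigma>\<^sup>2) = - s * t\<^sup>2" unfolding \<sigma>(2) using s by simp
      moreover have "sqrt (2 * pi * \<sigma>\<^sup>2) \<noteq> 0" using \<sigma>(1) by simp
      ultimately show ?thesis unfolding normal_density_def by simp
    qed
    have "integrable lborel (\<lambda>t. exp (- s * t\<^sup>2))"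
      unfolding eq using \<sigma> by (intro integrable_mult_right integrable_normal_density)
    then show ?thesis by (simp add: integrable_iff_bounded)
  qed
  have "(\<integral>\<^sup>+z. ennreal (exp (- s * (z \<bullet> z))) \<partial>(lborel :: 'a measure))
      = (\<integral>\<^sup>+z. (\<Prod>b\<in>Basis. ennreal (exp (- s * (z \<bullet> b)\<^sup>2))) \<partial>(lborel :: 'a measure))"
  proof (rule nn_integral_cong)
    fix z :: 'a
    have "z \<bullet> z = (\<Sum>b\<in>Basis. (z \<bullet> b)\<^sup>2)" by (subst euclidean_inner) (simp add: power2_eq_square)
    then have "exp (- s * (z \<bullet> z)) = (\<Prod>b\<in>Basis. exp (- s * (z \<bullet> b)\<^sup>2))"
      by (simp add: sum_distrib_left exp_sum[symmetric] sum_negf)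
    then show "ennreal (exp (- s * (z \<bullet> z))) = (\<Prod>b\<in>Basis. ennreal (exp (- s * (z \<bullet> b)\<^sup>2)))"
      by (simp add: prod_ennreal)
  qed
  also have "\<dots> = (\<Prod>b\<in>(Basis :: 'a set). \<integral>\<^sup>+t. ennreal (exp (- s * t\<^sup>2)) \<partial>lborel)"
    by (rule nn_integral_lborel_prod) auto
  also have "\<dots> < \<infinity>"
    using one by (simp add: power_less_top_ennreal)
  finally show "(\<integral>\<^sup>+z. ennreal (exp (- s * (z \<bullet> z))) \<partial>(lborel :: 'a measure)) < \<infinity>" .
qed auto

text \<open>Up to the factor \<open>c\<close>, the Gaussian \<open>exp (- s |x - y|\<^sup>2)\<close> is the integral over \<open>z\<close> of \<open>\<phi>(x - z) \<phi>(y - z)\<close>, so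
  the energy is the integral of the square of a convolution.\<close>

lemma gaussian_energy_nonneg:
  fixes \<rho> :: "'a::euclidean_space \<Rightarrow> real"
  assumes \<rho>: "integrable lborel \<rho>" and s: "s > 0"
  shows "0 \<le> (LBINT p. (\<rho> (fst p) * \<rho> (snd p)) * exp (- s * ((fst p - snd p) \<bullet> (fst p - snd p))))"
proof -
  have [measurable]: "\<rho> \<in> borel_measurable borel" using \<rho> by auto
  define \<phi> :: "'a \<Rightarrow> real" where "\<phi> u = exp (- (2 * s) * (u \<bullet> u))" for u
  define \<kappa> where "\<kappa> z p = \<phi> (fst p - z) * \<phi> (snd p - z)" for z :: 'a and p :: "'a \<times> 'a"
  define c where "c = (\<integral>z. exp (- (4 * s) * (z \<bullet> z)) \<partial>(lborel :: 'a measure))"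
  define E where "E p = exp (- s * ((fst p - snd p) \<bullet> (fst p - snd p)))" for p :: "'a \<times> 'a"
  have \<phi>m [measurable]: "\<phi> \<in> borel_measurable borel" unfolding \<phi>_def[abs_def] by measurable
  have gi: "integrable lborel (\<lambda>z::'a. exp (- (4 * s) * (z \<bullet> z)))" using s by (intro integrable_gaussian) auto
  have eq: "\<kappa> z p = E p * exp (- (4 * s) * ((- ((1/2) *\<^sub>R (fst p + snd p)) + z) \<bullet> (- ((1/2) *\<^sub>R (fst p + snd p)) + z)))" for z p
  proof -
    obtain x y where p: "p = (x, y)" by (cases p)
    \<comment> \<open>completing the square around the midpoint of x and y\<close>
    have "2 * ((x - z) \<bullet> (x - z)) + 2 * ((y - z) \<bullet> (y - z))
        = (x - y) \<bullet> (x - y) + 4 * ((- ((1/2) *\<^sub>R (x + y)) + z) \<bullet> (- ((1/2) *\<^sub>R (x + y)) + z))"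
      by (simp add: inner_diff_left inner_diff_right inner_add_left inner_add_right inner_commute algebra_simps)
    then have "- (2 * s) * ((x - z) \<bullet> (x - z)) + - (2 * s) * ((y - z) \<bullet> (y - z))
        = - s * ((x - y) \<bullet> (x - y)) + - (4 * s) * ((- ((1/2) *\<^sub>R (x + y)) + z) \<bullet> (- ((1/2) *\<^sub>R (x + y)) + z))"
      by (simp add: algebra_simps)
    then show ?thesis by (simp only: p \<kappa>_def \<phi>_def E_def fst_conv snd_conv exp_add[symmetric])
  qed
  have int: "integrable lborel (\<lambda>z. \<kappa> z p)" for p
    unfolding eq by (intro integrable_mult_right integrable_lborel_shift[OF gi])
  have val: "(LBINT z. \<kappa> z p) = c * E p" for p
  proof -
    have "(LBINT z. exp (- (4 * s) * ((m + z) \<bullet> (m + z)))) = c" for m :: 'a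
      unfolding c_def by (rule integral_lborel_shift[of "\<lambda>z. exp (- (4 * s) * (z \<bullet> z))"]) measurable
    then show ?thesis unfolding eq integral_mult_right_zero by (simp only: mult.commute)
  qed
  have \<kappa>0: "\<kappa> z p \<ge> 0" for z p by (simp add: \<kappa>_def \<phi>_def)
  have "0 \<le> (LBINT p. (\<rho> (fst p) * \<rho> (snd p)) * (LBINT z. \<kappa> z p))"
  proof (rule quadratic_form_mixture_nonneg)
    show "(\<lambda>p. \<rho> (fst p) * \<rho> (snd p)) \<in> borel_measurable borel"
      using borel_measurable_integrable[OF integrable_tensor(1)[OF \<rho> \<rho>]] by simp
    have "(\<lambda>(p, z). \<kappa> z p) \<in> borel_measurable ((borel \<Otimes>\<^sub>M borel) \<Otimes>\<^sub>M borel)"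
      unfolding \<kappa>_def by measurable
    then show "(\<lambda>(p, z). \<kappa> z p) \<in> borel_measurable (borel \<Otimes>\<^sub>M borel)"
      by (simp add: borel_prod)
    show "integrable lborel (\<lambda>z. \<kappa> z p)" for p by (rule int)
    have [measurable]: "E \<in> borel_measurable borel"
      unfolding E_def[abs_def] by (intro borel_measurable_continuous_onI continuous_intros)
    show "integrable lborel (\<lambda>p. (\<rho> (fst p) * \<rho> (snd p)) * (LBINT z. \<bar>\<kappa> z p\<bar>))"
    proof (rule Bochner_Integration.integrable_bound)
      show "integrable lborel (\<lambda>p::'a \<times> 'a. c * (\<rho> (fst p) * \<rho> (snd p)))"
        by (intro integrable_mult_right integrable_tensor \<rho>)
      have E1: "0 \<le> E p" "E p \<le> 1" for p using s by (auto simp: E_def)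
      have c0: "c \<ge> 0" unfolding c_def by (intro integral_nonneg_AE) auto
      show "(\<lambda>p. (\<rho> (fst p) * \<rho> (snd p)) * (LBINT z. \<bar>\<kappa> z p\<bar>)) \<in> borel_measurable lborel"
        using borel_measurable_integrable[OF integrable_tensor(1)[OF \<rho> \<rho>]] by (simp add: \<kappa>0 val)
      show "AE p in lborel. norm ((\<rho> (fst p) * \<rho> (snd p)) * (LBINT z. \<bar>\<kappa> z p\<bar>))
          \<le> norm (c * (\<rho> (fst p) * \<rho> (snd p)))"
      proof (intro AE_I2)
        fix p :: "'a \<times> 'a"
        have "\<bar>\<rho> (fst p) * \<rho> (snd p)\<bar> * (c * E p) \<le> \<bar>\<rho> (fst p) * \<rho> (snd p)\<bar> * (c * 1)"
          using E1[of p] c0 by (intro mult_left_mono) auto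
        then show "norm ((\<rho> (fst p) * \<rho> (snd p)) * (LBINT z. \<bar>\<kappa> z p\<bar>)) \<le> norm (c * (\<rho> (fst p) * \<rho> (snd p)))"
          using E1[of p] c0 by (simp add: \<kappa>0 val abs_mult mult_ac)
      qed
    qed
    fix z :: 'a
    have f: "integrable lborel (\<lambda>x. \<rho> x * \<phi> (x - z))"
    proof (rule Bochner_Integration.integrable_bound[OF \<rho>])
      have "0 \<le> \<phi> u" "\<phi> u \<le> 1" for u using s by (auto simp: \<phi>_def)
      then show "AE x in lborel. norm (\<rho> x * \<phi> (x - z)) \<le> norm (\<rho> x)"
        by (intro AE_I2) (simp add: abs_mult mult_left_le)
    qed measurable
    have "(LBINT p. (\<rho> (fst p) * \<rho> (snd p)) * \<kappa> z p)
        = (LBINT p. (\<rho> (fst p) * \<phi> (fst p - z)) * (\<rho> (snd p) * \<phi> (snd p - z)))"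
      by (simp add: \<kappa>_def mult_ac)
    also have "\<dots> = (LBINT x. \<rho> x * \<phi> (x - z))\<^sup>2"
      using integrable_tensor(2)[OF f f] by (simp add: power2_eq_square)
    finally show "0 \<le> (LBINT p. (\<rho> (fst p) * \<rho> (snd p)) * \<kappa> z p)" by simp
  qed
  also have "\<dots> = c * (LBINT p. (\<rho> (fst p) * \<rho> (snd p)) * E p)"
    unfolding val by (simp add: mult.left_commute)
  finally have *: "0 \<le> c * (LBINT p. (\<rho> (fst p) * \<rho> (snd p)) * E p)" .
  have "c > 0"
  proof -
    have "c \<noteq> 0"
    proof
      assume "c = 0"
      then have "AE z in (lborel :: 'a measure). exp (- (4 * s) * (z \<bullet> z)) = 0"
        unfolding c_def using integral_nonneg_eq_0_iff_AE[OF gi] by auto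
      then have "AE z in (lborel :: 'a measure). False" by eventually_elim simp
      then have "UNIV \<in> null_sets (lborel :: 'a measure)"
        by (subst AE_iff_null_sets) auto
      then show False by (auto simp: null_sets_def emeasure_lborel_UNIV)
    qed
    moreover have "c \<ge> 0" unfolding c_def by (intro integral_nonneg_AE) auto
    ultimately show ?thesis by simp
  qed
  with * show ?thesis unfolding E_def by (simp add: zero_le_mult_iff)
qed

subsection \<open>Frullani's integral\<close>

text \<open>The integrand is the integral of \<open>exp (- t s)\<close> over \<open>a \<le> s \<le> b\<close>; interchanging the order of integration
  leaves \<open>1 / s\<close>.\<close>

lemma frullani_nn_integral:
  fixes a b :: real
  assumes "0 < a" "a \<le> b"
  shows "(\<integral>\<^sup>+t. ennreal (indicator {0<..} t * ((exp (- t * a) - exp (- t * b)) / t)) \<partial>lborel) = ennreal (ln b - ln a)"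
proof -
  have "(\<integral>\<^sup>+t. ennreal (indicator {0<..} t * ((exp (- t * a) - exp (- t * b)) / t)) \<partial>lborel)
      = (\<integral>\<^sup>+t. (\<integral>\<^sup>+s. ennreal (exp (- t * s)) * indicator {a..b} s * indicator {0<..} t \<partial>lborel) \<partial>lborel)"
  proof (rule nn_integral_cong)
    fix t :: real
    show "ennreal (indicator {0<..} t * ((exp (- t * a) - exp (- t * b)) / t))
        = (\<integral>\<^sup>+s. ennreal (exp (- t * s)) * indicator {a..b} s * indicator {0<..} t \<partial>lborel)"
    proof (cases "t > 0")
      case True
      have "(\<integral>\<^sup>+s. ennreal (exp (- t * s)) * indicator {a..b} s \<partial>lborel)
          = ennreal (- exp (- t * b) / t - (- exp (- t * a) / t))"
        using True assms
        by (intro nn_integral_FTC_Icc) (auto intro!: derivative_eq_intros simp: has_real_derivative_iff_has_vector_derivative[symmetric])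
      also have "- exp (- t * b) / t - (- exp (- t * a) / t) = (exp (- t * a) - exp (- t * b)) / t"
        by (simp add: diff_divide_distrib)
      finally show ?thesis using True by simp
    qed simp
  qed
  also have "\<dots> = (\<integral>\<^sup>+s. (\<integral>\<^sup>+t. ennreal (exp (- t * s)) * indicator {a..b} s * indicator {0<..} t \<partial>lborel) \<partial>lborel)"
    by (rule lborel_pair.Fubini'[symmetric]) measurable
  also have "\<dots> = (\<integral>\<^sup>+s. ennreal (1 / s) * indicator {a..b} s \<partial>lborel)"
  proof (rule nn_integral_cong)
    fix s :: real
    show "(\<integral>\<^sup>+t. ennreal (exp (- t * s)) * indicator {a..b} s * indicator {0<..} t \<partial>lborel)
        = ennreal (1 / s) * indicator {a..b} s"
    proof (cases "s \<in> {a..b}")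
      case True
      then have s: "s > 0" using assms by auto
      have "(\<integral>\<^sup>+t. ennreal (exp (- t * s)) * indicator {0<..} t \<partial>lborel)
          = (\<integral>\<^sup>+t. ennreal (exp (- t * s)) * indicator {0..} t \<partial>lborel)"
        by (rule nn_integral_cong_AE) (use AE_lborel_singleton[of "0::real"] in \<open>auto split: split_indicator\<close>)
      also have "\<dots> = ennreal (0 - (- exp (- 0 * s) / s))"
      proof (rule nn_integral_FTC_atLeast)
        show "((\<lambda>t. - exp (- t * s) / s) has_real_derivative exp (- x * s)) (at x)" for x
          using s by (auto intro!: derivative_eq_intros)
        have "filterlim (\<lambda>t. t * s) at_top at_top"
          using s by (intro filterlim_at_top_mult_tendsto_pos[OF tendsto_const] filterlim_ident) auto
        then have "filterlim (\<lambda>t. - (t * s)) at_bot at_top"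
          by (simp add: filterlim_uminus_at_top)
        then have "((\<lambda>t. exp (- (t * s))) \<longlongrightarrow> 0) at_top"
          by (rule filterlim_compose[OF exp_at_bot])
        then have "((\<lambda>t. - exp (- (t * s)) / s) \<longlongrightarrow> - 0 / s) at_top"
          using s by (intro tendsto_intros) auto
        then show "((\<lambda>t. - exp (- t * s) / s) \<longlongrightarrow> 0) at_top" by simp
      qed auto
      finally show ?thesis using True by simp
    qed simp
  qed
  also have "\<dots> = ennreal (ln b - ln a)"
    using assms by (intro nn_integral_FTC_Icc) (auto intro!: derivative_eq_intros
        simp: has_real_derivative_iff_has_vector_derivative[symmetric])
  finally show ?thesis .
qed

text \<open>For \<open>z = 0\<close> Frullani's integral diverges. Setting the kernel to 0 there makes its integral agree
  with \<open>- 2 ln |z|\<close> everywhere, under the convention \<open>ln 0 = 0\<close>.\<close>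

definition frullani_kernel :: "real \<Rightarrow> 'a::real_inner \<Rightarrow> real" where
  "frullani_kernel t z = indicator {0<..} t * indicator {0<..} (z \<bullet> z) * ((exp (- t * (z \<bullet> z)) - exp (- t)) / t)"

lemma frullani_kernel_integral:
  fixes z :: "'a::euclidean_space"
  shows "integrable lborel (\<lambda>t. frullani_kernel t z)"
    and "(LBINT t. frullani_kernel t z) = - 2 * ln (norm z)"
    and "(LBINT t. \<bar>frullani_kernel t z\<bar>) = 2 * \<bar>ln (norm z)\<bar>"
proof -
  have m [measurable]: "(\<lambda>t. frullani_kernel t z) \<in> borel_measurable lborel"
    unfolding frullani_kernel_def by measurable
  have "integrable lborel (\<lambda>t. frullani_kernel t z) \<and> (LBINT t. frullani_kernel t z) = - 2 * ln (norm z) \<and>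
      (LBINT t. \<bar>frullani_kernel t z\<bar>) = 2 * \<bar>ln (norm z)\<bar>"
  proof (cases "z = 0")
    case False
    define a where "a = z \<bullet> z"
    have a: "a > 0" using False by (simp add: a_def)
    have lna: "ln a = 2 * ln (norm z)"
      using log_reg_0[of z] by (simp add: log_reg_def a_def)
    show ?thesis
    proof (cases "a \<le> 1")
      case True
      have nn: "frullani_kernel t z \<ge> 0" for t
        using True by (auto simp: frullani_kernel_def a_def[symmetric] indicator_def mult_left_le)
      have "(\<integral>\<^sup>+t. ennreal (frullani_kernel t z) \<partial>lborel) = ennreal (ln 1 - ln a)"
        using frullani_nn_integral[OF a True] a by (simp add: frullani_kernel_def a_def)
      then have hb: "has_bochner_integral lborel (\<lambda>t. frullani_kernel t z) (- ln a)"
        using nn a True by (intro has_bochner_integral_nn_integral) auto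
      have "ln a \<le> 0" using a True by simp
      with hb nn lna show ?thesis by (simp add: has_bochner_integral_iff)
    next
      case False
      have nn: "frullani_kernel t z \<le> 0" for t
        using False by (auto simp: frullani_kernel_def a_def[symmetric] indicator_def divide_le_0_iff)
      have "(\<integral>\<^sup>+t. ennreal (- frullani_kernel t z) \<partial>lborel) = ennreal (ln a - ln 1)"
      proof -
        have "- frullani_kernel t z = indicator {0<..} t * ((exp (- t * 1) - exp (- t * a)) / t)" for t
          using a by (simp add: frullani_kernel_def a_def[symmetric] indicator_def diff_divide_distrib)
        then show ?thesis using frullani_nn_integral[of 1 a] False by simp
      qed
      then have hb: "has_bochner_integral lborel (\<lambda>t. - frullani_kernel t z) (ln a)"
        using nn a False by (intro has_bochner_integral_nn_integral) auto
      have "ln a \<ge> 0" using False by simp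
      moreover have "\<bar>frullani_kernel t z\<bar> = - frullani_kernel t z" for t using nn[of t] by simp
      ultimately show ?thesis using hb lna by (simp add: has_bochner_integral_iff)
    qed
  qed (simp add: frullani_kernel_def)
  then show "integrable lborel (\<lambda>t. frullani_kernel t z)"
    and "(LBINT t. frullani_kernel t z) = - 2 * ln (norm z)"
    and "(LBINT t. \<bar>frullani_kernel t z\<bar>) = 2 * \<bar>ln (norm z)\<bar>" by auto
qed

subsection \<open>The logarithmic energy\<close>

text \<open>In the Frullani representation, the constant \<open>exp (- t)\<close> drops out by neutrality, and
  what remains is \<open>1 / t\<close> times a Gaussian energy.\<close>

lemma log_energy_nonpos:
  fixes \<rho> :: "'a::euclidean_space \<Rightarrow> real"
  assumes \<rho>: "integrable lborel \<rho>" and neutral: "(LBINT x. \<rho> x) = 0"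
    and int: "integrable lborel (\<lambda>p. (\<rho> (fst p) * \<rho> (snd p)) * ln (norm (fst p - snd p)))"
  shows "(LBINT p. (\<rho> (fst p) * \<rho> (snd p)) * ln (norm (fst p - snd p))) \<le> 0"
proof -
  have [measurable]: "\<rho> \<in> borel_measurable borel" using \<rho> by auto
  have rr: "integrable lborel (\<lambda>p::'a \<times> 'a. \<rho> (fst p) * \<rho> (snd p))"
      "(\<integral>p. \<rho> (fst p) * \<rho> (snd p) \<partial>(lborel :: ('a \<times> 'a) measure)) = 0"
    using integrable_tensor[OF \<rho> \<rho>] neutral by auto
  have mm: "(\<lambda>p::'a \<times> 'a. \<rho> (fst p) * \<rho> (snd p)) \<in> borel_measurable borel"
    using borel_measurable_integrable[OF rr(1)] by simp
  define \<kappa> where "\<kappa> t p = frullani_kernel t (fst p - snd p)" for t and p :: "'a \<times> 'a"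
  have "0 \<le> (LBINT p. (\<rho> (fst p) * \<rho> (snd p)) * (LBINT t. \<kappa> t p))"
  proof (rule quadratic_form_mixture_nonneg[OF mm])
    have "(\<lambda>(p, t). \<kappa> t p) \<in> borel_measurable ((borel \<Otimes>\<^sub>M borel) \<Otimes>\<^sub>M borel)"
      unfolding \<kappa>_def frullani_kernel_def by measurable
    then show "(\<lambda>(p, t). \<kappa> t p) \<in> borel_measurable (borel \<Otimes>\<^sub>M borel)"
      by (simp add: borel_prod)
    show "integrable lborel (\<lambda>t. \<kappa> t p)" for p
      unfolding \<kappa>_def by (rule frullani_kernel_integral)
    show "integrable lborel (\<lambda>p. (\<rho> (fst p) * \<rho> (snd p)) * (LBINT t. \<bar>\<kappa> t p\<bar>))"
    proof (rule Bochner_Integration.integrable_bound)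
      show "integrable lborel (\<lambda>p. 2 * ((\<rho> (fst p) * \<rho> (snd p)) * ln (norm (fst p - snd p))))"
        using int by simp
      have "(\<lambda>p::'a \<times> 'a. ln (norm (fst p - snd p))) \<in> borel_measurable (borel \<Otimes>\<^sub>M borel)" by measurable
      then have [measurable]: "(\<lambda>p::'a \<times> 'a. ln (norm (fst p - snd p))) \<in> borel_measurable borel"
        by (simp add: borel_prod)
      show "(\<lambda>p. (\<rho> (fst p) * \<rho> (snd p)) * (LBINT t. \<bar>\<kappa> t p\<bar>)) \<in> borel_measurable lborel"
      proof -
        have "(\<lambda>p::'a \<times> 'a. 2 * \<bar>ln (norm (fst p - snd p))\<bar>) \<in> borel_measurable borel" by measurable
        from borel_measurable_times[OF mm this] show ?thesis
          unfolding \<kappa>_def frullani_kernel_integral by simp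
      qed
    qed (auto simp: \<kappa>_def frullani_kernel_integral abs_mult)
    fix t :: real
    show "0 \<le> (LBINT p. (\<rho> (fst p) * \<rho> (snd p)) * \<kappa> t p)"
    proof (cases "t > 0")
      case True
      let ?E = "\<lambda>p::'a \<times> 'a. exp (- t * ((fst p - snd p) \<bullet> (fst p - snd p)))"
      have Em [measurable]: "?E \<in> borel_measurable borel"
        by (intro borel_measurable_continuous_onI continuous_intros)
      have iE: "integrable lborel (\<lambda>p. (\<rho> (fst p) * \<rho> (snd p)) * ?E p)"
      proof (rule Bochner_Integration.integrable_bound[OF rr(1)])
        show "(\<lambda>p. (\<rho> (fst p) * \<rho> (snd p)) * ?E p) \<in> borel_measurable lborel"
          using borel_measurable_times[OF mm Em] by simp
        show "AE p in lborel. norm ((\<rho> (fst p) * \<rho> (snd p)) * ?E p) \<le> norm (\<rho> (fst p) * \<rho> (snd p))"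
        proof (intro AE_I2)
          fix p :: "'a \<times> 'a"
          have "\<bar>\<rho> (fst p) * \<rho> (snd p)\<bar> * ?E p \<le> \<bar>\<rho> (fst p) * \<rho> (snd p)\<bar> * 1"
            using True by (intro mult_left_mono) auto
          then show "norm ((\<rho> (fst p) * \<rho> (snd p)) * ?E p) \<le> norm (\<rho> (fst p) * \<rho> (snd p))"
            by (simp only: real_norm_def abs_mult[of _ "?E p"] abs_exp_cancel mult_1_right)
        qed
      qed
      have "(LBINT p. (\<rho> (fst p) * \<rho> (snd p)) * \<kappa> t p)
          = (LBINT p. ((\<rho> (fst p) * \<rho> (snd p)) * ?E p - exp (- t) * (\<rho> (fst p) * \<rho> (snd p))) / t)"
      proof (rule integral_cong_AE)
        have "(\<lambda>p. \<kappa> t p) \<in> borel_measurable (borel \<Otimes>\<^sub>M borel)"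
          unfolding \<kappa>_def frullani_kernel_def by measurable
        then have "(\<lambda>p. \<kappa> t p) \<in> borel_measurable borel" by (simp add: borel_prod)
        from borel_measurable_times[OF mm this]
        show "(\<lambda>p. (\<rho> (fst p) * \<rho> (snd p)) * \<kappa> t p) \<in> borel_measurable lborel" by simp
        show "(\<lambda>p. ((\<rho> (fst p) * \<rho> (snd p)) * ?E p - exp (- t) * (\<rho> (fst p) * \<rho> (snd p))) / t) \<in> borel_measurable lborel"
          using iE rr(1) by auto
        show "AE p in lborel. (\<rho> (fst p) * \<rho> (snd p)) * \<kappa> t p
            = ((\<rho> (fst p) * \<rho> (snd p)) * ?E p - exp (- t) * (\<rho> (fst p) * \<rho> (snd p))) / t"
          using AE_lborel_off_diagonal
        proof eventually_elim
          case (elim p)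
          then have "\<kappa> t p = (?E p - exp (- t)) / t"
            using True by (simp add: \<kappa>_def frullani_kernel_def)
          then show ?case by (simp add: right_diff_distrib mult.commute)
        qed
      qed
      also have "\<dots> = ((LBINT p. (\<rho> (fst p) * \<rho> (snd p)) * ?E p)
          - exp (- t) * (\<integral>p. \<rho> (fst p) * \<rho> (snd p) \<partial>(lborel :: ('a \<times> 'a) measure))) / t"
        using iE rr(1) by simp
      also have "\<dots> = (LBINT p. (\<rho> (fst p) * \<rho> (snd p)) * ?E p) / t"
        unfolding rr(2) by simp
      also have "\<dots> \<ge> 0"
        using True gaussian_energy_nonneg[OF \<rho> True] by (intro divide_nonneg_pos) auto
      finally show ?thesis .
    qed (simp add: \<kappa>_def frullani_kernel_def)
  qed
  also have "\<dots> = - 2 * (LBINT p. (\<rho> (fst p) * \<rho> (snd p)) * ln (norm (fst p - snd p)))"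
    unfolding \<kappa>_def frullani_kernel_integral by (simp add: mult.left_commute)
  finally show ?thesis by simp
qed

text \<open>The logarithm is dominated by the Riesz kernel near the diagonal and by \<open>|x| + |y|\<close> far from it.\<close>

lemma (in density) integrable_log_interaction:
  assumes f: "integrable lborel f" and f1: "integrable lborel (\<lambda>x. norm x * f x)"
  shows "integrable lborel (\<lambda>p::'a \<times> 'a. (f (fst p) * U (snd p)) * ln (norm (fst p - snd p)))"
proof -
  have fm [measurable]: "f \<in> borel_measurable borel" using f by auto
  have "integrable (lborel \<Otimes>\<^sub>M lborel) (\<lambda>p::'a \<times> 'a. (f (fst p) * U (snd p)) * ln (norm (fst p - snd p)))"
  proof (rule lborel_pair.Fubini_integrable)
    show "(\<lambda>p::'a \<times> 'a. (f (fst p) * U (snd p)) * ln (norm (fst p - snd p))) \<in> borel_measurable (lborel \<Otimes>\<^sub>M lborel)"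
      by measurable
    have ln_int: "integrable lborel (\<lambda>y. U y * ln (norm (x - y)))" for x
      using integrable_log_reg[of 0 x] by (simp add: log_reg_0)
    show "AE x in lborel. integrable lborel (\<lambda>y. (f (fst (x, y)) * U (snd (x, y))) * ln (norm (fst (x, y) - snd (x, y))))"
      using ln_int by (intro AE_I2) (simp add: mult.assoc)
    let ?N = "\<lambda>x. LBINT y. norm ((f (fst (x, y)) * U (snd (x, y))) * ln (norm (fst (x, y) - snd (x, y))))"
    show "integrable lborel ?N"
    proof (rule Bochner_Integration.integrable_bound)
      show "integrable lborel (\<lambda>x. (riesz_bound + first_moment) * \<bar>f x\<bar> + mass * \<bar>norm x * f x\<bar>)"
        using f f1 by auto
      show "?N \<in> borel_measurable lborel" by measurable
      show "AE x in lborel. norm (?N x) \<le> norm ((riesz_bound + first_moment) * \<bar>f x\<bar> + mass * \<bar>norm x * f x\<bar>)"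
      proof (intro AE_I2)
        fix x
        have "(LBINT y. \<bar>U y * ln (norm (x - y))\<bar>)
            \<le> (LBINT y. U y * riesz (x - y) + norm x * U y + norm y * U y)"
        proof (rule integral_mono)
          show "integrable lborel (\<lambda>y. \<bar>U y * ln (norm (x - y))\<bar>)" by (rule integrable_abs[OF ln_int])
          show "integrable lborel (\<lambda>y. U y * riesz (x - y) + norm x * U y + norm y * U y)"
            by (intro Bochner_Integration.integrable_add integrable_mult_right integrable_U riesz_potential
                integrable_first_moment)
          fix y
          have "ln (norm (x - y)) \<le> norm (x - y)"
            using log_reg_le_norm[of 0 "x - y"] by (simp add: log_reg_0)
          moreover have "norm (x - y) \<le> norm x + norm y" by (rule norm_triangle_ineq4)
          moreover have "- ln (norm (x - y)) \<le> riesz (x - y)" by (rule ln_norm_ge)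
          moreover have "0 \<le> riesz (x - y)" "0 \<le> norm x" "0 \<le> norm y" by auto
          ultimately have "\<bar>ln (norm (x - y))\<bar> \<le> riesz (x - y) + norm x + norm y" by linarith
          then have "U y * \<bar>ln (norm (x - y))\<bar> \<le> U y * (riesz (x - y) + norm x + norm y)"
            by (intro mult_left_mono U_nonneg)
          also have "\<dots> = U y * riesz (x - y) + norm x * U y + norm y * U y"
            by (simp only: distrib_left mult.commute[of "U y" "norm _"])
          finally show "\<bar>U y * ln (norm (x - y))\<bar> \<le> U y * riesz (x - y) + norm x * U y + norm y * U y"
            unfolding abs_mult using U_nonneg[of y] by simp
        qed
        also have "\<dots> = (LBINT y. U y * riesz (x - y)) + norm x * mass + first_moment"
          using riesz_potential(1)[of x] integrable_U integrable_first_moment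
          by (simp add: mass_def first_moment_def)
        also have "\<dots> \<le> riesz_bound + norm x * mass + first_moment"
          using riesz_potential(2)[of x] by simp
        finally have "\<bar>f x\<bar> * (LBINT y. \<bar>U y * ln (norm (x - y))\<bar>)
            \<le> \<bar>f x\<bar> * (riesz_bound + norm x * mass + first_moment)"
          by (rule mult_left_mono) simp
        also have "\<dots> = (riesz_bound + first_moment) * \<bar>f x\<bar> + mass * \<bar>norm x * f x\<bar>"
          by (simp add: abs_mult algebra_simps)
        finally have le: "\<bar>f x\<bar> * (LBINT y. \<bar>U y * ln (norm (x - y))\<bar>)
            \<le> (riesz_bound + first_moment) * \<bar>f x\<bar> + mass * \<bar>norm x * f x\<bar>" .
        have "?N x = \<bar>f x\<bar> * (LBINT y. \<bar>U y * ln (norm (x - y))\<bar>)"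
          by (simp add: abs_mult mult.assoc)
        moreover have "0 \<le> ?N x" by (intro integral_nonneg_AE) auto
        ultimately show "norm (?N x) \<le> norm ((riesz_bound + first_moment) * \<bar>f x\<bar> + mass * \<bar>norm x * f x\<bar>)"
          using le unfolding real_norm_def by linarith
      qed
    qed
  qed
  then show ?thesis by (simp add: lborel_prod)
qed

section \<open>Uniqueness\<close>

text \<open>The logarithms of the two Gibbs densities differ by a constant and by \<open>L\<close>, the logarithmic potential
  of the neutral charge \<open>\<rho>\<close>. Integrated against \<open>\<rho>\<close>, the difference of the logarithms is nonnegative by
  monotonicity and \<open>L\<close> is nonpositive by \<open>log_energy_nonpos\<close>.\<close>

lemma densities_eq:
  fixes U1 U2 :: "'a::euclidean_space \<Rightarrow> real"
  assumes "stationary_density U1" and "stationary_density U2"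
    and mass: "(LBINT x. U1 x) = M" "(LBINT x. U2 x) = M" and M: "M > 0"
  shows "AE x in lborel. U1 x = U2 x"
proof -
  interpret u: stationary_density U1 by fact
  interpret v: stationary_density U2 by fact
  \<comment> \<open>a nonpositive factor would force the mass to vanish\<close>
  have positive_factor: "\<exists>k>0. AE x in lborel. U x = k * density.gibbs U 0 x"
    if "stationary_density U" "(LBINT x. U x) = M" for U :: "'a \<Rightarrow> real"
  proof -
    interpret stationary_density U by fact
    obtain k where k: "AE x in lborel. U x = k * gibbs 0 x"
      using stationary_density_is_gibbs by blast
    have "k > 0"
    proof (rule ccontr)
      assume "\<not> k > 0"
      have "AE x in lborel. U x = 0"
        using k
      proof eventually_elim
        case (elim x)
        have "k * gibbs 0 x \<le> 0" using \<open>\<not> k > 0\<close> gibbs_pos[of 0 x] by (simp add: mult_nonpos_nonneg)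
        then show ?case using elim U_nonneg[of x] by simp
      qed
      then have "(LBINT x. U x) = 0"
        by (rule integral_eq_zero_AE)
      then show False using that(2) M by simp
    qed
    then show ?thesis using k by blast
  qed
  obtain k where k: "k > 0" "AE x in lborel. U1 x = k * u.gibbs 0 x"
    using positive_factor[OF assms(1) mass(1)] by blast
  obtain l where l: "l > 0" "AE x in lborel. U2 x = l * v.gibbs 0 x"
    using positive_factor[OF assms(2) mass(2)] by blast
  define \<rho> where "\<rho> x = U1 x - U2 x" for x
  have \<rho>: "integrable lborel \<rho>"
    unfolding \<rho>_def by (intro Bochner_Integration.integrable_diff u.integrable_U v.integrable_U)
  have \<rho>1: "integrable lborel (\<lambda>x. norm x * \<rho> x)"
    unfolding \<rho>_def right_diff_distrib
    by (intro Bochner_Integration.integrable_diff u.integrable_first_moment v.integrable_first_moment)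
  have neutral: "(LBINT x. \<rho> x) = 0"
    unfolding \<rho>_def using u.integrable_U v.integrable_U mass by simp
  have i1: "integrable lborel (\<lambda>p::'a \<times> 'a. (\<rho> (fst p) * U1 (snd p)) * ln (norm (fst p - snd p)))"
    by (rule u.integrable_log_interaction[OF \<rho> \<rho>1])
  have i2: "integrable lborel (\<lambda>p::'a \<times> 'a. (\<rho> (fst p) * U2 (snd p)) * ln (norm (fst p - snd p)))"
    by (rule v.integrable_log_interaction[OF \<rho> \<rho>1])
  have int: "integrable lborel (\<lambda>p::'a \<times> 'a. (\<rho> (fst p) * \<rho> (snd p)) * ln (norm (fst p - snd p)))"
  proof -
    have "(\<rho> (fst p) * \<rho> (snd p)) * ln (norm (fst p - snd p)) = (\<rho> (fst p) * U1 (snd p)) * ln (norm (fst p - snd p))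
        - (\<rho> (fst p) * U2 (snd p)) * ln (norm (fst p - snd p))" for p :: "'a \<times> 'a"
      by (simp add: \<rho>_def algebra_simps)
    then show ?thesis using Bochner_Integration.integrable_diff[OF i1 i2] by simp
  qed
  define L where "L x = u.log_pot 0 x - v.log_pot 0 x" for x
  have L: "(LBINT y. (\<rho> x * \<rho> y) * ln (norm (x - y))) = \<rho> x * L x" for x
  proof -
    have "L x = (LBINT y. U1 y * ln (norm (x - y)) - U2 y * ln (norm (x - y)))"
      unfolding L_def u.log_pot_def v.log_pot_def log_reg_0
      using u.integrable_log_reg[of 0 x] v.integrable_log_reg[of 0 x]
      by (intro Bochner_Integration.integral_diff[symmetric]) (simp_all add: log_reg_0)
    also have "\<dots> = (LBINT y. \<rho> y * ln (norm (x - y)))"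
      by (simp only: \<rho>_def left_diff_distrib)
    finally show ?thesis by (simp only: mult.assoc integral_mult_right_zero)
  qed
  have int': "integrable (lborel \<Otimes>\<^sub>M lborel) (\<lambda>p::'a \<times> 'a. (\<rho> (fst p) * \<rho> (snd p)) * ln (norm (fst p - snd p)))"
    using int by (simp add: lborel_prod)
  have \<rho>L: "integrable lborel (\<lambda>x. \<rho> x * L x)"
    using lborel_pair.integrable_fst'[OF int'] by (simp add: L)
  have "(LBINT x. \<rho> x * L x) = (LBINT p. (\<rho> (fst p) * \<rho> (snd p)) * ln (norm (fst p - snd p)))"
    using lborel_pair.integral_fst'[OF int'] by (simp add: L lborel_prod)
  also have "\<dots> \<le> 0" by (rule log_energy_nonpos[OF \<rho> neutral int])
  finally have energy: "(LBINT x. \<rho> x * L x) \<le> 0" .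
  define c where "c = ln k - ln l"
  have logs: "AE x in lborel. U1 x > 0 \<and> U2 x > 0 \<and> ln (U1 x) - ln (U2 x) = c + L x"
    using k(2) l(2)
  proof eventually_elim
    case (elim x)
    have "ln (U1 x) = ln k + (u.log_pot 0 x - (norm x)\<^sup>2 / 4)"
      unfolding elim(1) u.gibbs_def using k(1) by (simp add: ln_mult)
    moreover have "ln (U2 x) = ln l + (v.log_pot 0 x - (norm x)\<^sup>2 / 4)"
      unfolding elim(2) v.gibbs_def using l(1) by (simp add: ln_mult)
    moreover have "U1 x > 0" "U2 x > 0"
      using elim k(1) l(1) u.gibbs_pos[of 0 x] v.gibbs_pos[of 0 x] by auto
    ultimately show ?case by (simp add: c_def L_def)
  qed
  have ae_nn: "AE x in lborel. 0 \<le> \<rho> x * (c + L x)"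
    using logs
  proof eventually_elim
    case (elim x)
    then have pos: "U1 x > 0" "U2 x > 0" and eq: "c + L x = ln (U1 x) - ln (U2 x)" by auto
    show ?case
    proof (cases "U1 x \<le> U2 x")
      case True
      then have "ln (U1 x) \<le> ln (U2 x)" using pos by simp
      then show ?thesis unfolding eq \<rho>_def using True by (intro mult_nonpos_nonpos) auto
    next
      case False
      then have "ln (U2 x) \<le> ln (U1 x)" using pos by simp
      then show ?thesis unfolding eq \<rho>_def using False by (intro mult_nonneg_nonneg) auto
    qed
  qed
  have tot: "integrable lborel (\<lambda>x. \<rho> x * (c + L x))"
    unfolding distrib_left by (intro Bochner_Integration.integrable_add integrable_mult_left \<rho> \<rho>L)
  have "(LBINT x. \<rho> x * (c + L x)) = (LBINT x. \<rho> x * c) + (LBINT x. \<rho> x * L x)"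
    unfolding distrib_left by (intro Bochner_Integration.integral_add integrable_mult_left \<rho> \<rho>L)
  then have "(LBINT x. \<rho> x * (c + L x)) \<le> 0" using neutral energy by simp
  moreover have "0 \<le> (LBINT x. \<rho> x * (c + L x))" by (rule integral_nonneg_AE[OF ae_nn])
  ultimately have "(LBINT x. \<rho> x * (c + L x)) = 0" by simp
  then have "AE x in lborel. \<rho> x * (c + L x) = 0"
    using integral_nonneg_eq_0_iff_AE[OF tot ae_nn] by simp
  then show ?thesis
    using logs
  proof eventually_elim
    case (elim x)
    then have "\<rho> x = 0 \<or> ln (U1 x) = ln (U2 x)" by auto
    then show ?case using elim by (auto simp: \<rho>_def)
  qed
qed

lemma gradient_log_kernel_eq:
  fixes z :: "'a::euclidean_space"
  assumes "z \<noteq> 0" shows "gradient log_kernel z = - grad_log_reg 0 z"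
  using gradient_log_kernel[OF assms] by (simp add: grad_log_reg_def power2_norm_eq_inner)

lemma measurable_gradient_log_kernel [measurable]:
  "gradient (log_kernel :: 'a::euclidean_space \<Rightarrow> real) \<in> borel_measurable borel"
proof -
  have "gradient (log_kernel :: 'a \<Rightarrow> real) = (\<lambda>z. if z \<in> {0} then gradient log_kernel 0 else - grad_log_reg 0 z)"
    by (auto simp: fun_eq_iff gradient_log_kernel_eq)
  moreover have "(\<lambda>z::'a. if z \<in> {0} then gradient log_kernel 0 else - grad_log_reg 0 z) \<in> borel_measurable borel"
    by (intro measurable_If_set) auto
  ultimately show ?thesis by metis
qed

lemma integral_lebesgue_cong:
  fixes f g :: "'a::euclidean_space \<Rightarrow> 'b::{banach, second_countable_topology}"
  assumes f: "f \<in> borel_measurable lebesgue" and g: "g \<in> borel_measurable borel"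
    and eq: "AE x in lborel. f x = g x"
  shows "(\<integral>x. f x \<partial>lebesgue) = (LBINT x. g x)"
    and "integrable lebesgue f \<longleftrightarrow> integrable lborel g"
proof -
  have g': "g \<in> borel_measurable lborel" using g by simp
  have ae: "AE x in lebesgue. f x = g x" using eq by (rule AE_completion)
  show "(\<integral>x. f x \<partial>lebesgue) = (LBINT x. g x)"
    using integral_cong_AE[OF f measurable_completion[OF g'] ae] integral_completion[OF g'] by simp
  show "integrable lebesgue f \<longleftrightarrow> integrable lborel g"
    using integrable_cong_AE[OF f measurable_completion[OF g'] ae] integrable_completion[OF g'] by simp
qed

lemma test_function_regular:
  fixes \<phi> :: "'a::euclidean_space \<Rightarrow> real"
  assumes "test_function \<phi>"
  shows "continuous_on UNIV (gradient \<phi>)" "continuous_on UNIV (laplacian \<phi>)"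
    and "\<exists>C. \<forall>x. norm (gradient \<phi> x) \<le> C"
proof -
  have C: "C_k k \<phi>" for k using assms by (simp add: test_function_def)
  have "C_k 0 (\<lambda>x. frechet_derivative \<phi> (at x) b)" for b
    by (rule C_k_SucD(2)[OF C])
  then have "continuous_on UNIV (\<lambda>x. frechet_derivative \<phi> (at x) b)" for b by simp
  then show grad: "continuous_on UNIV (gradient \<phi>)"
    unfolding gradient_def[abs_def] by (intro continuous_intros)
  have "C_k 1 (\<lambda>x. frechet_derivative \<phi> (at x) b)" for b
    unfolding One_nat_def by (rule C_k_SucD(2)[OF C])
  then have "C_k 0 (\<lambda>x. frechet_derivative (\<lambda>y. frechet_derivative \<phi> (at y) b) (at x) b)" for b
    unfolding One_nat_def by (rule C_k_SucD(2))
  then have "continuous_on UNIV (\<lambda>x. frechet_derivative (\<lambda>y. frechet_derivative \<phi> (at y) b) (at x) b)" for b by simp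
  then show "continuous_on UNIV (laplacian \<phi>)"
    unfolding laplacian_def[abs_def] by (intro continuous_intros)
  define K where "K = closure {x. \<phi> x \<noteq> 0}"
  have K: "compact K" using assms by (simp add: test_function_def K_def)
  have out: "gradient \<phi> x = 0" if "x \<notin> K" for x
  proof (rule gradient_GDERIV)
    have "((\<lambda>_. 0) has_derivative (\<lambda>h. h \<bullet> 0)) (at x)" by simp
    moreover have "open (- K)" by (simp add: K_def open_Compl)
    ultimately show "GDERIV \<phi> x :> 0"
      unfolding gderiv_def
      by (rule has_derivative_transform_within_open[of _ _ _ _ "- K"])
        (use that closure_subset[of "{x. \<phi> x \<noteq> 0}"] in \<open>auto simp: K_def\<close>)
  qed
  have "bounded (gradient \<phi> ` K)"
    by (intro compact_imp_bounded compact_continuous_image continuous_on_subset[OF grad] K) auto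
  then obtain C where "C > 0" "\<And>x. x \<in> K \<Longrightarrow> norm (gradient \<phi> x) \<le> C"
    by (auto simp: bounded_pos)
  then have "norm (gradient \<phi> x) \<le> C" for x
    using out[of x] by (cases "x \<in> K") auto
  then show "\<exists>C. \<forall>x. norm (gradient \<phi> x) \<le> C" by blast
qed

text \<open>Replacing \<open>U\<close> by a nonnegative Borel function that agrees with it almost everywhere changes none of the
  integrals, including the convolution that defines the drift.\<close>

lemma admissible_representative:
  fixes U :: "'a::euclidean_space \<Rightarrow> real"
  assumes dim: "DIM('a) \<ge> 2" and adm: "admissible M U" and weak: "weak_solution log_kernel U"
  obtains V where "stationary_density V" "(LBINT x. V x) = M" "AE x in lebesgue. U x = V x"
proof -
  have Lp: "in_Lp p U" if "p \<ge> 1" for p using adm that by (simp add: admissible_def)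
  have Um [measurable]: "U \<in> borel_measurable lebesgue" using Lp[of 1] by (simp add: in_Lp_def)
  obtain g where g: "g \<in> borel_measurable lborel" "AE x in lborel. U x = g x"
    using completion_ex_borel_measurable_real[OF Um] by blast
  have U0: "AE x in lborel. U x \<ge> 0"
    using adm by (simp add: admissible_def AE_completion_iff)
  define V where "V x = max 0 (g x)" for x
  have Vm [measurable]: "V \<in> borel_measurable borel"
    using g(1) unfolding V_def[abs_def] by simp
  have V0: "V x \<ge> 0" for x by (simp add: V_def)
  have UV: "AE x in lborel. U x = V x"
    using g(2) U0 by eventually_elim (simp add: V_def)
  have iV: "integrable lborel V"
  proof -
    have "integrable lebesgue (\<lambda>x. \<bar>U x\<bar> powr 1)" using Lp[of 1] by (simp add: in_Lp_def)
    moreover have "AE x in lborel. \<bar>U x\<bar> powr 1 = V x"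
      using UV by eventually_elim (simp add: V0)
    ultimately show ?thesis
      using integral_lebesgue_cong(2)[of "\<lambda>x. \<bar>U x\<bar> powr 1" V] Vm by auto
  qed
  have V5: "integrable lborel (\<lambda>x. V x ^ 5)"
  proof -
    have "integrable lebesgue (\<lambda>x. \<bar>U x\<bar> powr 5)" using Lp[of 5] by (simp add: in_Lp_def)
    moreover have "AE x in lborel. \<bar>U x\<bar> powr 5 = V x ^ 5"
      using UV by eventually_elim (simp add: V0)
    ultimately show ?thesis
      using integral_lebesgue_cong(2)[of "\<lambda>x. \<bar>U x\<bar> powr 5" "\<lambda>x. V x ^ 5"] Vm by auto
  qed
  have V2: "integrable lborel (\<lambda>x. (norm x)\<^sup>2 * V x)"
  proof -
    have "integrable lebesgue (\<lambda>x. (norm x)\<^sup>2 * U x)" using adm by (simp add: admissible_def)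
    moreover have "AE x in lborel. (norm x)\<^sup>2 * U x = (norm x)\<^sup>2 * V x"
      using UV by eventually_elim simp
    ultimately show ?thesis
      using integral_lebesgue_cong(2)[of "\<lambda>x. (norm x)\<^sup>2 * U x" "\<lambda>x. (norm x)\<^sup>2 * V x"] Vm by auto
  qed
  interpret density V
    using dim Vm V0 iV V5 V2 by unfold_locales auto
  have bm: "(\<lambda>x. U x *\<^sub>R h x) \<in> borel_measurable lebesgue" if "h \<in> borel_measurable borel" for h :: "'a \<Rightarrow> 'b::euclidean_space"
  proof -
    have "h \<in> borel_measurable lborel" using that by simp
    then have "h \<in> borel_measurable lebesgue" by (rule measurable_completion)
    then show ?thesis using Um by (rule borel_measurable_scaleR[rotated])
  qed
  have gc: "grad_conv log_kernel U x = - (LBINT y. V y *\<^sub>R grad_log_reg 0 (x - y))" for x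
  proof -
    have "grad_conv log_kernel U x = (LBINT y. - (V y *\<^sub>R grad_log_reg 0 (x - y)))"
      unfolding grad_conv_def
    proof (rule integral_lebesgue_cong)
      show "(\<lambda>y. U y *\<^sub>R gradient log_kernel (x - y)) \<in> borel_measurable lebesgue"
        by (rule bm) measurable
      show "AE y in lborel. U y *\<^sub>R gradient log_kernel (x - y) = - (V y *\<^sub>R grad_log_reg 0 (x - y))"
        using UV AE_lborel_singleton[of x]
        by eventually_elim (simp add: gradient_log_kernel_eq)
    qed measurable
    then show ?thesis by simp
  qed
  have drift: "drift 0 x = x /\<^sub>R 2 + grad_conv log_kernel U x" for x
    by (simp add: drift_def gc)
  have gcm [measurable]: "grad_conv log_kernel U \<in> borel_measurable borel"
  proof -
    have "grad_conv log_kernel U = (\<lambda>x. drift 0 x - x /\<^sub>R 2)" by (simp add: drift fun_eq_iff)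
    moreover have "(\<lambda>x. drift 0 x - x /\<^sub>R 2) \<in> borel_measurable borel" by measurable
    ultimately show ?thesis by metis
  qed
  have "stationary_density V"
  proof
    fix \<phi> :: "'a \<Rightarrow> real"
    assume \<phi>: "test_function \<phi>"
    have [measurable]: "gradient \<phi> \<in> borel_measurable borel" "laplacian \<phi> \<in> borel_measurable borel"
      using test_function_regular(1,2)[OF \<phi>] by (auto intro: borel_measurable_continuous_onI)
    obtain C where C: "\<And>x. norm (gradient \<phi> x) \<le> C" using test_function_regular(3)[OF \<phi>] by blast
    have C0: "C \<ge> 0" using C[of 0] norm_ge_zero[of "gradient \<phi> 0"] by linarith
    have tr: "(\<integral>x. U x * h x \<partial>lebesgue) = (LBINT x. V x * h x)" if [measurable]: "h \<in> borel_measurable borel" for h :: "'a \<Rightarrow> real"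
    proof (rule integral_lebesgue_cong)
      show "(\<lambda>x. U x * h x) \<in> borel_measurable lebesgue" using bm[OF that] by simp
      show "AE x in lborel. U x * h x = V x * h x" using UV by eventually_elim simp
    qed measurable
    have ib: "integrable lborel (\<lambda>x. V x * (X x \<bullet> gradient \<phi> x))"
      if X: "integrable lborel (\<lambda>x. V x *\<^sub>R X x)" and [measurable]: "X \<in> borel_measurable borel" for X :: "'a \<Rightarrow> 'a"
    proof (rule Bochner_Integration.integrable_bound)
      show "integrable lborel (\<lambda>x. C *\<^sub>R (V x *\<^sub>R X x))" using X by (rule integrable_scaleR_right)
      show "AE x in lborel. norm (V x * (X x \<bullet> gradient \<phi> x)) \<le> norm (C *\<^sub>R (V x *\<^sub>R X x))"
      proof (intro AE_I2)
        fix x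
        have "\<bar>X x \<bullet> gradient \<phi> x\<bar> \<le> norm (X x) * norm (gradient \<phi> x)" by (rule Cauchy_Schwarz_ineq2)
        also have "\<dots> \<le> norm (X x) * C" by (intro mult_left_mono C) auto
        finally have "V x * \<bar>X x \<bullet> gradient \<phi> x\<bar> \<le> V x * (norm (X x) * C)" by (intro mult_left_mono V0)
        then show "norm (V x * (X x \<bullet> gradient \<phi> x)) \<le> norm (C *\<^sub>R (V x *\<^sub>R X x))"
          using V0[of x] C0 by (simp add: abs_mult mult_ac)
      qed
    qed measurable
    have iX: "integrable lborel (\<lambda>x. V x *\<^sub>R x)"
    proof (rule Bochner_Integration.integrable_bound[OF integrable_first_moment])
      show "AE x in lborel. norm (V x *\<^sub>R x) \<le> norm (norm x * V x)"
        by (intro AE_I2) (simp add: abs_mult mult.commute)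
    qed measurable
    have iG: "integrable lborel (\<lambda>x. V x *\<^sub>R grad_conv log_kernel U x)"
    proof -
      have "integrable lborel (\<lambda>x. V x *\<^sub>R drift 0 x - (1/2) *\<^sub>R (V x *\<^sub>R x))"
        by (intro Bochner_Integration.integrable_diff integrable_U_drift integrable_scaleR_right iX)
      moreover have "V x *\<^sub>R drift 0 x - (1/2) *\<^sub>R (V x *\<^sub>R x) = V x *\<^sub>R grad_conv log_kernel U x" for x
      proof -
        have "(1/2) *\<^sub>R (V x *\<^sub>R x) = V x *\<^sub>R (x /\<^sub>R 2)" by simp
        then show ?thesis by (simp only: drift scaleR_right_distrib add_diff_cancel_left')
      qed
      ultimately show ?thesis by (simp only:)
    qed
    have "V \<xi> * (drift 0 \<xi> \<bullet> g) = 1 / 2 * (V \<xi> * (\<xi> \<bullet> g)) + V \<xi> * (grad_conv log_kernel U \<xi> \<bullet> g)" for \<xi> g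
      unfolding drift inner_add_left inner_scaleR_left by (simp add: distrib_left)
    then have "(LBINT \<xi>. V \<xi> * (drift 0 \<xi> \<bullet> gradient \<phi> \<xi>))
        = (LBINT \<xi>. 1 / 2 * (V \<xi> * (\<xi> \<bullet> gradient \<phi> \<xi>)) + V \<xi> * (grad_conv log_kernel U \<xi> \<bullet> gradient \<phi> \<xi>))"
      by (simp only:)
    also have "\<dots> = 1 / 2 * (LBINT \<xi>. V \<xi> * (\<xi> \<bullet> gradient \<phi> \<xi>))
        + (LBINT \<xi>. V \<xi> * (grad_conv log_kernel U \<xi> \<bullet> gradient \<phi> \<xi>))"
      using ib[OF iX] ib[OF iG] by simp
    finally have split: "(LBINT \<xi>. V \<xi> * (drift 0 \<xi> \<bullet> gradient \<phi> \<xi>)) = \<dots>" .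
    have "(\<integral>\<xi>. U \<xi> * laplacian \<phi> \<xi> \<partial>lebesgue)
        - 1 / 2 * (\<integral>\<xi>. U \<xi> * (\<xi> \<bullet> gradient \<phi> \<xi>) \<partial>lebesgue)
        - (\<integral>\<xi>. U \<xi> * (grad_conv log_kernel U \<xi> \<bullet> gradient \<phi> \<xi>) \<partial>lebesgue) = 0"
      using weak \<phi> unfolding weak_solution_def by blast
    moreover have "(\<integral>\<xi>. U \<xi> * laplacian \<phi> \<xi> \<partial>lebesgue) = (LBINT \<xi>. V \<xi> * laplacian \<phi> \<xi>)"
      by (rule tr) measurable
    moreover have "(\<integral>\<xi>. U \<xi> * (\<xi> \<bullet> gradient \<phi> \<xi>) \<partial>lebesgue) = (LBINT \<xi>. V \<xi> * (\<xi> \<bullet> gradient \<phi> \<xi>))"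
      by (rule tr) measurable
    moreover have "(\<integral>\<xi>. U \<xi> * (grad_conv log_kernel U \<xi> \<bullet> gradient \<phi> \<xi>) \<partial>lebesgue)
        = (LBINT \<xi>. V \<xi> * (grad_conv log_kernel U \<xi> \<bullet> gradient \<phi> \<xi>))"
      by (rule tr) measurable
    ultimately show "(LBINT \<xi>. V \<xi> * laplacian \<phi> \<xi>) - (LBINT \<xi>. V \<xi> * (drift 0 \<xi> \<bullet> gradient \<phi> \<xi>)) = 0"
      unfolding split by linarith
  qed
  moreover have "(LBINT x. V x) = M"
    using integral_lebesgue_cong(1)[OF Um Vm UV] adm by (simp add: admissible_def)
  moreover have "AE x in lebesgue. U x = V x" using UV by (rule AE_completion)
  ultimately show thesis by (rule that)
qed

theorem theorem6p11:
  fixes U\<^sub>1 U\<^sub>2 :: "'a::euclidean_space \<Rightarrow> real" and M :: real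
  assumes "DIM('a) \<ge> 2" and "M > 0"
    and "admissible M U\<^sub>1" and "admissible M U\<^sub>2"
    and "weak_solution log_kernel U\<^sub>1" and "weak_solution log_kernel U\<^sub>2"
  shows "AE \<xi> in lebesgue. U\<^sub>1 \<xi> = U\<^sub>2 \<xi>"
proof -
  obtain V\<^sub>1 where V1: "stationary_density V\<^sub>1" "(LBINT x. V\<^sub>1 x) = M" "AE x in lebesgue. U\<^sub>1 x = V\<^sub>1 x"
    using admissible_representative[OF assms(1,3,5)] by blast
  obtain V\<^sub>2 where V2: "stationary_density V\<^sub>2" "(LBINT x. V\<^sub>2 x) = M" "AE x in lebesgue. U\<^sub>2 x = V\<^sub>2 x"
    using admissible_representative[OF assms(1,4,6)] by blast
  have "AE x in lborel. V\<^sub>1 x = V\<^sub>2 x"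
    by (rule densities_eq[OF V1(1) V2(1) V1(2) V2(2) assms(2)])
  then have "AE x in lebesgue. V\<^sub>1 x = V\<^sub>2 x" by (rule AE_completion)
  with V1(3) V2(3) show ?thesis by eventually_elim simp
qed

end
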